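(* If $p$ is an odd prime such that $p\neq5$ and $p\not\equiv1\pmod 8$, then the sequence $(\mathfrak{p}(n,\chi_p))_{n\in\mathbb{N}}$ does not vanish on any arithmetic progression. Similarly, the sequence $(\mathfrak{p}(n,\chi_2))_{n\in\mathbb{N}}$ does not vanish on any arithmetic progression.
   Context: For $f:\mathbb{N}\to\{0,\pm1\}$ and a partition $\pi=(a_1,\dots,a_k)$ of $n$, put $f(\pi)=f(a_1)\cdots f(a_k)$, and define $\mathfrak{p}(n,f)=\sum_{\pi}f(\pi)$ over all partitions $\pi$ of $n$. For an odd prime $p$, $\chi_p(n)$ is the Legendre symbol $(\frac np)$. $\chi_2(n)$ is the Kronecker symbol $(\frac n2)$: $\chi_2(n)=1$ if $n\equiv\pm1\pmod8$, $-1$ if $n\equiv\pm3\pmod 8$, and $0$ otherwise. A sequence $(a_n)_{n\in\mathbb{N}}$ vanishes on some arithmetic progression if there exist $m\in\mathbb{N}$ and $0\le r<m$ with $a_{mj+r}=0$ for all $j\ge0$ (for which $mj+r\in\mathbb{N}$). *)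

theory Defs
  imports "HOL-Number_Theory.Number_Theory" "HOL-Library.Multiset"
begin

text \<open>
  A partition of \<open>n\<close> is a multiset of positive integers with sum \<open>n\<close>.
\<close>

definition partitions_of :: "nat \<Rightarrow> nat multiset set" where
  "partitions_of n = {\<pi>. 0 \<notin># \<pi> \<and> sum_mset \<pi> = n}"

text \<open>Finiteness guarantees that the sum in the next definition is a genuine one.\<close>

lemma finite_partitions_of: "finite (partitions_of n)"
proof -
  have "partitions_of n \<subseteq> (\<Union>k\<le>n. {\<pi>. size \<pi> = k \<and> set_mset \<pi> \<subseteq> {..n}})"
  proof
    fix \<pi> assume "\<pi> \<in> partitions_of n"
    then have pos: "0 \<notin># \<pi>" and sum: "sum_mset \<pi> = n"
      by (auto simp: partitions_of_def)
    have "0 \<notin># \<pi> \<Longrightarrow> size \<pi> \<le> sum_mset \<pi>"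
      by (induction \<pi>) auto
    moreover have "x \<le> n" if "x \<in># \<pi>" for x
      using sum_mset.remove[OF that] sum by simp
    ultimately show "\<pi> \<in> (\<Union>k\<le>n. {\<pi>. size \<pi> = k \<and> set_mset \<pi> \<subseteq> {..n}})"
      using pos sum by auto
  qed
  moreover have "finite {\<pi>. size \<pi> = k \<and> set_mset \<pi> \<subseteq> {..n}}" for k
  proof (rule finite_subset)
    show "{\<pi>. size \<pi> = k \<and> set_mset \<pi> \<subseteq> {..n}} \<subseteq> mset ` {xs. set xs \<subseteq> {..n} \<and> length xs = k}"
    proof
      fix \<pi> assume *: "\<pi> \<in> {\<pi>. size \<pi> = k \<and> set_mset \<pi> \<subseteq> {..n}}"
      obtain xs where "\<pi> = mset xs" by (metis ex_mset)
      with * show "\<pi> \<in> mset ` {xs. set xs \<subseteq> {..n} \<and> length xs = k}" by auto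
    qed
    show "finite (mset ` {xs. set xs \<subseteq> {..n} \<and> length xs = k})"
      by (intro finite_imageI finite_lists_length_eq) auto
  qed
  ultimately show ?thesis
    by (meson finite_UN finite_atMost finite_subset)
qed

definition signed_partition_number :: "nat \<Rightarrow> (nat \<Rightarrow> int) \<Rightarrow> int" where
  "signed_partition_number n f = (\<Sum>\<pi>\<in>partitions_of n. \<Prod>a\<in>#\<pi>. f a)"

definition chi :: "nat \<Rightarrow> nat \<Rightarrow> int" where
  "chi p n = Legendre (int n) (int p)"

definition chi2 :: "nat \<Rightarrow> int" where
  "chi2 n =
    (if [int n = 1] (mod 8) \<or> [int n = -1] (mod 8) then 1
     else if [int n = 3] (mod 8) \<or> [int n = -3] (mod 8) then -1
     else 0)"

text \<open>
  Sequences are indexed by the positive integers, so the value at index \<open>0\<close> (which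
  occurs as a term of the progression \<open>m * j + r\<close> only for \<open>r = 0\<close> and \<open>j = 0\<close>) is
  disregarded.
\<close>

definition vanishes_on_some_AP :: "(nat \<Rightarrow> int) \<Rightarrow> bool" where
  "vanishes_on_some_AP a \<longleftrightarrow>
    (\<exists>m r. r < m \<and> (\<forall>j. m * j + r > 0 \<longrightarrow> a (m * j + r) = 0))"

end

theory Submission
  imports Defs "HOL-Analysis.Analysis" "HOL-Real_Asymp.Real_Asymp"
begin

text \<open>
  For \<open>f\<close> with values in \<open>{0, 1, -1}\<close> the generating function of the signed partition numbers is
  \<open>\<Prod>(1 - f(a) z\<^sup>a)\<^sup>-\<^sup>1\<close>, and for periodic \<open>f\<close> its logarithm at \<open>\<omega> e\<^sup>-\<^sup>t\<close>, \<open>\<omega>\<close> a root of unity, is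
  asymptotic to \<open>G(\<omega>) / t\<close> as \<open>t\<close> tends to \<open>0\<close>. If the coefficients vanish on a residue class modulo
  \<open>m\<close>, a sum of the generating function over all \<open>m\<close>-th roots of unity, twisted by a character, is
  identically \<open>0\<close>, so the terms with maximal real part of \<open>G\<close> have to cancel up to an exponentially
  small error.

  For \<open>chi2\<close> the maximum is attained only at the conjugate pair \<open>cis (\<plusminus>\<pi>/4)\<close>, and the argument of the generating
  function there stays in a compact part of \<open>(0, \<pi>/4)\<close>. The twist is a multiple of \<open>\<pi>/4\<close>, so the two
  terms cannot cancel.

  For \<open>chi p\<close> the maximum is attained only at \<open>\<plusminus>1\<close>, and the logarithms there differ by
  \<open>2 (\<tau>(t) - chi p 2 \<tau>(2 t))\<close> with an explicit odd Lambert sum \<open>\<tau>\<close>; cancellation forces this to be \<open>O(t)\<close>.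
  If \<open>p\<close> is \<open>3\<close> modulo \<open>4\<close>, then \<open>\<tau>\<close> would be bounded, but it diverges because
  \<open>\<Sum>n chi p n\<close> is nonzero. If \<open>p\<close> is \<open>5\<close> modulo \<open>8\<close>, then \<open>chi p 2 = -1\<close> and \<open>\<tau>\<close> converges, so that its limit
  \<open>-(1/2) \<Sum>chi p i ln (sin (\<pi> i / p))\<close> over \<open>i < p/2\<close> would be \<open>0\<close>, which an elementary product argument excludes.
\<close>

section \<open>Generating functions of signed partition numbers\<close>

text \<open>Two dominant terms of equal size cannot be separated by growth alone, so each case needs
  a finer invariant: the argument for \<open>chi2\<close>, the real difference of the logarithms for
  \<open>chi p\<close>. The exclusions on \<open>p\<close> show the limits of this. For
  \<open>p = 5\<close> the growth at \<open>cis (2 * pi / 5)\<close> equals the growth at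
  \<open>1\<close> (both are pi^2 / 30), so there are further dominant terms. If \<open>p\<close> is
  \<open>1\<close> modulo \<open>8\<close>, then \<open>chi p 2 = 1\<close> while \<tau> converges,
  so \<tau>(t) - \<tau>(2 t) tends to \<open>0\<close> in any case and its limit yields no
  contradiction. Restricting the parts to \<open>{..N}\<close> gives finite products; the formula
  for the full generating function is then a limit in \<open>N\<close>.\<close>

definition bounded_partitions :: "nat \<Rightarrow> nat \<Rightarrow> nat multiset set" where
  "bounded_partitions N n = {\<pi> \<in> partitions_of n. set_mset \<pi> \<subseteq> {..N}}"

definition bounded_partition_sum :: "nat \<Rightarrow> (nat \<Rightarrow> int) \<Rightarrow> nat \<Rightarrow> int" where
  "bounded_partition_sum N f n = (\<Sum>\<pi>\<in>bounded_partitions N n. \<Prod>a\<in>#\<pi>. f a)"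

lemma finite_bounded_partitions: "finite (bounded_partitions N n)"
  by (rule finite_subset[OF _ finite_partitions_of[of n]]) (auto simp: bounded_partitions_def)

lemma bounded_partitions_0: "bounded_partitions 0 n = (if n = 0 then {{#}} else {})"
proof -
  have *: "0 \<notin># \<pi> \<and> set_mset \<pi> \<subseteq> {..0} \<longleftrightarrow> \<pi> = {#}" for \<pi> :: "nat multiset"
  proof (cases \<pi>)
    case (add x \<sigma>)
    then show ?thesis by (cases "x = 0") simp_all
  qed simp
  have "\<pi> \<in> bounded_partitions 0 n \<longleftrightarrow> \<pi> = {#} \<and> n = 0" for \<pi>
    unfolding bounded_partitions_def partitions_of_def mem_Collect_eq using *[of \<pi>] by (metis sum_mset.empty)
  then show ?thesis by (simp add: set_eq_iff)
qed

lemma bounded_partition_sum_0: "bounded_partition_sum 0 f n = (if n = 0 then 1 else 0)"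
  by (simp add: bounded_partition_sum_def bounded_partitions_0)

lemma bounded_partitions_eq_partitions_of:
  assumes "n \<le> N"
  shows "bounded_partitions N n = partitions_of n"
proof -
  have "set_mset \<pi> \<subseteq> {..N}" if "\<pi> \<in> partitions_of n" for \<pi>
  proof
    fix x assume "x \<in># \<pi>"
    then obtain \<sigma> where "\<pi> = add_mset x \<sigma>" by (meson mset_add)
    with that assms show "x \<in> {..N}" by (auto simp: partitions_of_def)
  qed
  then show ?thesis unfolding bounded_partitions_def by blast
qed

lemma bounded_partition_sum_eq_signed_partition_number:
  "n \<le> N \<Longrightarrow> bounded_partition_sum N f n = signed_partition_number n f"
  by (simp add: bounded_partition_sum_def signed_partition_number_def
      bounded_partitions_eq_partitions_of)

text \<open>Splits by whether the part \<open>Suc N\<close> occurs. Deleting one copy of it leaves a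
  partition that may still contain \<open>Suc N\<close>, so the second summand keeps the bound
  \<open>Suc N\<close>. This is the coefficient form of multiplying by 1 / (1 - f(N+1)
  z^(N+1)).\<close>

lemma bounded_partition_sum_Suc:
  "bounded_partition_sum (Suc N) f n = bounded_partition_sum N f n +
    (if Suc N \<le> n then f (Suc N) * bounded_partition_sum (Suc N) f (n - Suc N) else 0)"
proof -
  let ?w = "\<lambda>\<pi>. \<Prod>a\<in>#\<pi>. f a"
  let ?A = "{\<pi> \<in> bounded_partitions (Suc N) n. Suc N \<notin># \<pi>}"
  let ?B = "{\<pi> \<in> bounded_partitions (Suc N) n. Suc N \<in># \<pi>}"
  have A: "?A = bounded_partitions N n"
  proof -
    have "set_mset \<pi> \<subseteq> {..Suc N} \<and> Suc N \<notin># \<pi> \<longleftrightarrow> set_mset \<pi> \<subseteq> {..N}" for \<pi>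
      unfolding atMost_Suc using not_less_eq_eq by blast
    then show ?thesis
      unfolding bounded_partitions_def by blast
  qed
  have B: "?B = (if Suc N \<le> n then add_mset (Suc N) ` bounded_partitions (Suc N) (n - Suc N) else {})"
  proof -
    have 1: "Suc N \<le> n \<and> \<pi> \<in> add_mset (Suc N) ` bounded_partitions (Suc N) (n - Suc N)"
      if "\<pi> \<in> ?B" for \<pi>
    proof -
      from that obtain \<sigma> where \<sigma>: "\<pi> = add_mset (Suc N) \<sigma>"
        by (metis (lifting) mem_Collect_eq mset_add)
      with that have \<pi>: "0 \<notin># add_mset (Suc N) \<sigma>" "sum_mset (add_mset (Suc N) \<sigma>) = n"
        "set_mset (add_mset (Suc N) \<sigma>) \<subseteq> {..Suc N}"
        unfolding bounded_partitions_def partitions_of_def by blast+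
      then have "\<sigma> \<in> bounded_partitions (Suc N) (n - Suc N)" "Suc N \<le> n"
        unfolding bounded_partitions_def partitions_of_def by auto
      then show ?thesis using \<sigma> by blast
    qed
    have 2: "add_mset (Suc N) \<sigma> \<in> ?B"
      if "\<sigma> \<in> bounded_partitions (Suc N) (n - Suc N)" "Suc N \<le> n" for \<sigma>
      using that by (simp add: bounded_partitions_def partitions_of_def)
    show ?thesis
    proof (cases "Suc N \<le> n")
      case True
      have "?B = add_mset (Suc N) ` bounded_partitions (Suc N) (n - Suc N)"
        using 1 2[OF _ True] by blast
      then show ?thesis using True by (simp only: if_True)
    next
      case False
      have "?B = {}" using 1 False by blast
      then show ?thesis using False by (simp only: if_False)
    qed
  qed
  have "bounded_partition_sum (Suc N) f n = sum ?w (?A \<union> ?B)"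
    unfolding bounded_partition_sum_def by (rule sum.cong) blast+
  also have "\<dots> = sum ?w ?A + sum ?w ?B"
    using finite_bounded_partitions by (intro sum.union_disjoint) auto
  also have "sum ?w ?A = bounded_partition_sum N f n"
    unfolding A bounded_partition_sum_def ..
  also have "sum ?w ?B = (if Suc N \<le> n then f (Suc N) * bounded_partition_sum (Suc N) f (n - Suc N) else 0)"
  proof (cases "Suc N \<le> n")
    case True
    then show ?thesis
      unfolding B bounded_partition_sum_def
      by (simp add: sum.reindex inj_on_def sum_distrib_left)
  qed (simp add: B)
  finally show ?thesis .
qed

lemma abs_prod_mset_le_1:
  assumes "\<And>a. \<bar>f a\<bar> \<le> (1::int)"
  shows "\<bar>\<Prod>a\<in>#\<pi>. f a\<bar> \<le> 1"
proof (induction \<pi>)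
  case (add x \<pi>)
  show ?case using mult_mono[OF assms[of x] add] by (simp add: abs_mult)
qed simp

lemma abs_bounded_partition_sum_le:
  assumes "\<And>a. \<bar>f a\<bar> \<le> 1"
  shows "\<bar>bounded_partition_sum N f n\<bar> \<le> bounded_partition_sum N (\<lambda>_. 1) n"
  unfolding bounded_partition_sum_def
  by (rule order.trans[OF sum_abs]) (intro sum_mono, simp add: abs_prod_mset_le_1 assms)

lemma bounded_partition_sum_1_nonneg: "0 \<le> bounded_partition_sum N (\<lambda>_. 1) n"
  by (simp add: bounded_partition_sum_def)

lemma bounded_partition_sum_1_le:
  "bounded_partition_sum N (\<lambda>_. 1) n \<le> signed_partition_number n (\<lambda>_. 1)"
  unfolding bounded_partition_sum_def signed_partition_number_def
  by (rule sum_mono2) (auto simp: finite_partitions_of bounded_partitions_def)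

text \<open>Truncated sums are used so that no convergence has to be known. By the recurrence they
  satisfy S(N+1) (1 - x^(N+1)) <= S(N): the index shift only loses terms, and these are
  nonnegative.\<close>

lemma bounded_partition_sum_partial_le:
  fixes x :: real
  assumes "0 \<le> x" "x < 1"
  shows "(\<Sum>n\<le>M. of_int (bounded_partition_sum N (\<lambda>_. 1) n) * x ^ n) \<le> (\<Prod>i<N. 1 / (1 - x ^ Suc i))"
proof (induction N)
  case 0
  have "(\<Sum>n\<le>M. of_int (bounded_partition_sum 0 (\<lambda>_. 1) n) * x ^ n) = (\<Sum>n\<le>M. if n = 0 then 1 else 0)"
    by (rule sum.cong) (auto simp: bounded_partition_sum_0)
  then show ?case by simp
next
  case (Suc N)
  let ?b = "\<lambda>N n. of_int (bounded_partition_sum N (\<lambda>_. 1) n) :: real"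
  let ?S = "\<lambda>N. \<Sum>n\<le>M. ?b N n * x ^ n"
  have pow: "x ^ Suc N < 1"
    using assms power_Suc_less_one[of x N] by (cases "x = 0") auto
  have "?S (Suc N) = ?S N + (\<Sum>n\<le>M. if Suc N \<le> n then ?b (Suc N) (n - Suc N) * x ^ n else 0)"
    unfolding sum.distrib[symmetric]
    by (rule sum.cong[OF refl], subst bounded_partition_sum_Suc) (auto simp: algebra_simps)
  also have "(\<Sum>n\<le>M. if Suc N \<le> n then ?b (Suc N) (n - Suc N) * x ^ n else 0)
      = (\<Sum>n\<in>{Suc N..M}. ?b (Suc N) (n - Suc N) * x ^ n)"
    by (rule sum.mono_neutral_cong_right) auto
  also have "\<dots> = (\<Sum>n\<in>(\<lambda>n. n - Suc N) ` {Suc N..M}. ?b (Suc N) n * x ^ (n + Suc N))"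
    by (subst sum.reindex) (auto simp: inj_on_def simp del: power_Suc intro!: sum.cong)
  also have "\<dots> \<le> (\<Sum>n\<le>M. ?b (Suc N) n * x ^ (n + Suc N))"
    by (rule sum_mono2) (use assms in \<open>auto simp: bounded_partition_sum_1_nonneg\<close>)
  also have "\<dots> = x ^ Suc N * ?S (Suc N)"
    by (simp add: sum_distrib_left power_add mult_ac)
  finally have "?S (Suc N) * (1 - x ^ Suc N) \<le> ?S N"
    by (simp add: algebra_simps)
  also have "\<dots> \<le> (\<Prod>i<N. 1 / (1 - x ^ Suc i))" by (rule Suc.IH)
  finally have "?S (Suc N) \<le> (\<Prod>i<N. 1 / (1 - x ^ Suc i)) / (1 - x ^ Suc N)"
    using pow by (simp only: pos_le_divide_eq diff_gt_0_iff_gt)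
  then show ?case by (simp only: prod.lessThan_Suc times_divide_eq_right mult_1_right)
qed

text \<open>The exponents \<open>x ^ i / (1 - x)\<close> form a geometric series, so the bound is
  uniform in \<open>N\<close>. This uniformity yields convergence of the unsigned series, the
  majorant of all signed ones.\<close>

lemma prod_inverse_one_minus_power_le:
  fixes x :: real
  assumes "0 \<le> x" "x < 1"
  shows "(\<Prod>i<N. 1 / (1 - x ^ Suc i)) \<le> exp (1 / (1 - x)\<^sup>2)"
proof -
  have "1 / (1 - x ^ Suc i) \<le> exp (x ^ i / (1 - x))" for i
  proof -
    have le: "x ^ Suc i \<le> x" using assms power_decreasing[of 1 "Suc i" x] by simp
    have "1 / (1 - x ^ Suc i) = 1 + x ^ Suc i / (1 - x ^ Suc i)"
      using le assms by (simp add: field_simps)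
    also have "x ^ Suc i / (1 - x ^ Suc i) \<le> x ^ i / (1 - x)"
      using le assms power_decreasing[of i "Suc i" x] by (intro frac_le) auto
    also have "1 + x ^ i / (1 - x) \<le> exp (x ^ i / (1 - x))"
      by (rule exp_ge_add_one_self)
    finally show ?thesis by simp
  qed
  moreover have "0 \<le> 1 / (1 - x ^ Suc i)" for i
    using assms power_decreasing[of 1 "Suc i" x] by simp
  ultimately have "(\<Prod>i<N. 1 / (1 - x ^ Suc i)) \<le> (\<Prod>i<N. exp (x ^ i / (1 - x)))"
    by (intro prod_mono) blast
  also have "\<dots> = exp ((\<Sum>i<N. x ^ i) / (1 - x))"
    by (simp add: exp_sum sum_divide_distrib)
  also have "(\<Sum>i<N. x ^ i) \<le> 1 / (1 - x)"
    using sum_le_suminf[of "\<lambda>i. x ^ i" "{..<N}"] assms by (simp add: suminf_geometric summable_geometric)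
  then have "exp ((\<Sum>i<N. x ^ i) / (1 - x)) \<le> exp (1 / (1 - x)\<^sup>2)"
    using assms divide_right_mono[of _ "1 / (1 - x)" "1 - x"] by (simp add: power2_eq_square)
  finally show ?thesis .
qed

lemma summable_partition_numbers:
  fixes x :: real
  assumes "0 \<le> x" "x < 1"
  shows "summable (\<lambda>n. of_int (signed_partition_number n (\<lambda>_. 1)) * x ^ n)"
proof (rule bounded_imp_summable)
  fix M
  \<comment> \<open>Taking the bound on the parts equal to the truncation \<open>M\<close> makes all
    coefficients up to \<open>M\<close> exact.\<close>
  have "(\<Sum>n\<le>M. of_int (signed_partition_number n (\<lambda>_. 1)) * x ^ n) =
      (\<Sum>n\<le>M. of_int (bounded_partition_sum M (\<lambda>_. 1) n) * x ^ n)"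
    by (rule sum.cong) (auto simp: bounded_partition_sum_eq_signed_partition_number)
  also have "\<dots> \<le> exp (1 / (1 - x)\<^sup>2)"
    using bounded_partition_sum_partial_le[OF assms] prod_inverse_one_minus_power_le[OF assms]
    by (rule order.trans)
  finally show "(\<Sum>n\<le>M. of_int (signed_partition_number n (\<lambda>_. 1)) * x ^ n) \<le> exp (1 / (1 - x)\<^sup>2)" .
qed (use assms in \<open>auto simp: signed_partition_number_def\<close>)

text \<open>Dominated convergence for series, with a majorant valid eventually in \<open>x\<close>
  and for all \<open>k\<close> at once. It serves two kinds of limits: cut-offs tending to infinity,
  and \<open>t\<close> tending to \<open>0\<close>.\<close>

lemma tannery:
  fixes a :: "nat \<Rightarrow> _ \<Rightarrow> 'a :: {real_normed_algebra, banach}"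
  assumes "\<And>k. ((\<lambda>x. a k x) \<longlongrightarrow> b k) F"
    and "eventually (\<lambda>x. \<forall>k. norm (a k x) \<le> M k) F"
    and "summable M" "F \<noteq> bot"
  shows "summable (\<lambda>k. norm (b k))" "((\<lambda>x. \<Sum>k. a k x) \<longlongrightarrow> (\<Sum>k. b k)) F"
proof -
  have "eventually (\<lambda>(k, x). norm (a k x) \<le> M k) (at_top \<times>\<^sub>F F)"
    using eventually_prod2[THEN iffD2, OF _ assms(2), of sequentially]
    by (auto elim: eventually_mono)
  from tannerys_theorem[OF assms(1) this assms(3,4)]
  show "summable (\<lambda>k. norm (b k))" "((\<lambda>x. \<Sum>k. a k x) \<longlongrightarrow> (\<Sum>k. b k)) F" by auto
qed

lemma bounded_partition_sum_norm_le:
  fixes z :: complex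
  assumes "\<And>a. \<bar>f a\<bar> \<le> 1"
  shows "norm (of_int (bounded_partition_sum N f n) * z ^ n)
    \<le> of_int (signed_partition_number n (\<lambda>_. 1)) * norm z ^ n"
proof -
  have "\<bar>bounded_partition_sum N f n\<bar> \<le> signed_partition_number n (\<lambda>_. 1)"
    using abs_bounded_partition_sum_le[OF assms] bounded_partition_sum_1_le by (rule order.trans)
  then have "\<bar>of_int (bounded_partition_sum N f n) :: real\<bar> \<le> of_int (signed_partition_number n (\<lambda>_. 1))"
    by linarith
  then show ?thesis by (simp add: norm_mult norm_power mult_right_mono)
qed

text \<open>Summed against \<open>z ^ n\<close>, the recurrence reads s = P + w s, where P is the
  product for \<open>N\<close> and w = f(N+1) z^(N+1); since |w| < 1 it can be solved for s.
  Summability comes from the unsigned majorant.\<close>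

lemma bounded_partition_gf:
  fixes z :: complex
  assumes f: "\<And>a. \<bar>f a\<bar> \<le> 1" and z: "norm z < 1"
  shows "(\<lambda>n. of_int (bounded_partition_sum N f n) * z ^ n) sums
    (\<Prod>i<N. 1 / (1 - of_int (f (Suc i)) * z ^ Suc i))"
proof (induction N)
  case 0
  have "(\<lambda>n. of_int (bounded_partition_sum 0 f n) * z ^ n) = (\<lambda>n. if n = 0 then 1 else 0)"
    by (auto simp: bounded_partition_sum_0)
  then show ?case using sums_single[of 0 "\<lambda>_. 1 :: complex"] by simp
next
  case (Suc N)
  let ?b = "\<lambda>N n. of_int (bounded_partition_sum N f n) * z ^ n"
  let ?w = "of_int (f (Suc N)) * z ^ Suc N"
  have "summable (?b (Suc N))"
    by (rule summable_comparison_test'[OF summable_partition_numbers[of "norm z"]])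
      (use z bounded_partition_sum_norm_le[OF f] in auto)
  then obtain s where s: "?b (Suc N) sums s" by blast
  let ?g = "\<lambda>n. if Suc N \<le> n then ?w * ?b (Suc N) (n - Suc N) else 0"
  have "(\<lambda>n. ?g (n + Suc N)) sums (?w * s)"
    using sums_mult[OF s, of ?w] by simp
  then have "?g sums (?w * s)"
    by (subst (asm) sums_zero_iff_shift) auto
  from sums_add[OF Suc this]
  have "(\<lambda>n. ?b N n + ?g n) sums ((\<Prod>i<N. 1 / (1 - of_int (f (Suc i)) * z ^ Suc i)) + ?w * s)" .
  also have "(\<lambda>n. ?b N n + ?g n) = ?b (Suc N)"
  proof
    fix n
    show "?b N n + ?g n = ?b (Suc N) n"
    proof (cases "Suc N \<le> n")
      case True
      then have "z ^ n = z ^ Suc N * z ^ (n - Suc N)" by (metis le_add_diff_inverse power_add)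
      with True show ?thesis
        by (subst (2) bounded_partition_sum_Suc) (simp add: algebra_simps)
    next
      case False
      then show ?thesis by (subst bounded_partition_sum_Suc) simp
    qed
  qed
  finally have "(\<Prod>i<N. 1 / (1 - of_int (f (Suc i)) * z ^ Suc i)) + ?w * s = s"
    using s sums_unique2 by blast
  moreover have "norm ?w < 1"
  proof -
    have "norm (of_int (f (Suc N)) :: complex) \<le> 1" using f[of "Suc N"] by simp
    then have "norm ?w \<le> norm z ^ Suc N"
      using mult_right_mono[of "norm (of_int (f (Suc N)) :: complex)" 1 "norm z ^ Suc N"]
      by (simp only: norm_mult norm_power) simp
    also have "\<dots> \<le> norm z" using z power_decreasing[of 1 "Suc N" "norm z"] by simp
    finally show ?thesis using z by linarith
  qed
  then have "1 - ?w \<noteq> 0" by auto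
  ultimately have "s = (\<Prod>i<Suc N. 1 / (1 - of_int (f (Suc i)) * z ^ Suc i))"
    by (simp add: field_simps)
  with s show ?case by simp
qed

section \<open>Lambert series expansion of the logarithm\<close>

definition lambert :: "(nat \<Rightarrow> int) \<Rightarrow> nat \<Rightarrow> complex \<Rightarrow> complex" where
  "lambert f k z = (\<Sum>n. of_int (f (Suc n) ^ k) * z ^ (Suc n * k))"

text \<open>The sum of -log(1 - f(n) z^n) over all n, expanded with the order of summation reversed:
  the power \<open>k\<close> of the logarithm series is outermost, and \<open>lambert\<close> sums
  over the parts. Defining it by this series instead of \<open>Ln\<close> avoids a choice of
  branch.\<close>

definition log_gf :: "(nat \<Rightarrow> int) \<Rightarrow> complex \<Rightarrow> complex" where
  "log_gf f z = (\<Sum>k. lambert f (Suc k) z / of_nat (Suc k))"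

lemma norm_lambert_term_le:
  fixes z :: complex
  assumes "\<And>a. \<bar>f a\<bar> \<le> 1"
  shows "norm (of_int (f (Suc n) ^ k) * z ^ (Suc n * k)) \<le> (norm z ^ k) ^ Suc n"
proof -
  have "\<bar>of_int (f (Suc n)) :: real\<bar> \<le> 1" using assms[of "Suc n"] by linarith
  then have "\<bar>of_int (f (Suc n)) :: real\<bar> ^ k \<le> 1" by (simp add: power_le_one)
  then show ?thesis
    using mult_right_mono[of "\<bar>of_int (f (Suc n)) :: real\<bar> ^ k" 1 "norm z ^ (Suc n * k)"]
    by (simp add: norm_mult norm_power power_mult[symmetric] mult.commute power_add)
qed

lemma power_Suc_less_1:
  fixes x :: real assumes "0 \<le> x" "x < 1" shows "x ^ Suc k < 1"
  using assms power_Suc_less_one[of x k] by (cases "x = 0") auto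

lemma geometric_Suc_sums:
  fixes x :: real assumes "0 \<le> x" "x < 1"
  shows "(\<lambda>n. x ^ Suc n) sums (x / (1 - x))"
  using sums_mult[OF geometric_sums[of x], of x] assms by simp

lemma summable_lambert:
  fixes z :: complex
  assumes f: "\<And>a. \<bar>f a\<bar> \<le> 1" and z: "norm z < 1"
  shows "summable (\<lambda>n. of_int (f (Suc n) ^ Suc k) * z ^ (Suc n * Suc k))"
  proof (rule summable_comparison_test'[where N = 0 and g = "\<lambda>n. (norm z ^ Suc k) ^ Suc n"])
  show "summable (\<lambda>n. (norm z ^ Suc k) ^ Suc n)"
    using geometric_Suc_sums[of "norm z ^ Suc k"] power_Suc_less_1[of "norm z" k] z
    by (auto simp: sums_iff simp del: power_Suc)
qed (use norm_lambert_term_le[where f = f and k = "Suc k", OF f] in blast)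

lemma exp_geometric_log:
  fixes w :: complex
  assumes "norm w < 1"
  shows "summable (\<lambda>k. w ^ Suc k / of_nat (Suc k))"
    and "1 / (1 - w) = exp (\<Sum>k. w ^ Suc k / of_nat (Suc k))"
proof -
  have "(\<lambda>n. - (w ^ n) / of_nat n) sums ln (1 - w)"
    using Ln_series'[of "-w"] assms by simp
  then have "(\<lambda>n. - (w ^ Suc n) / of_nat (Suc n)) sums ln (1 - w)"
    by (subst sums_Suc_iff) simp
  from sums_minus[OF this] have s: "(\<lambda>n. w ^ Suc n / of_nat (Suc n)) sums (- ln (1 - w))"
    by (simp only: minus_divide_left minus_minus)
  then show "summable (\<lambda>k. w ^ Suc k / of_nat (Suc k))" by (rule sums_summable)
  have "1 - w \<noteq> 0" using assms by auto
  then show "1 / (1 - w) = exp (\<Sum>k. w ^ Suc k / of_nat (Suc k))"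
    unfolding sums_unique[OF s, symmetric] exp_minus by (simp add: inverse_eq_divide)
qed

text \<open>\<open>N\<close> tends to infinity on both sides of \<open>bounded_partition_gf\<close>.
  The left side is dominated by the unsigned partition numbers. On the right each factor becomes an
  exponential, and the resulting sum over \<open>k\<close> is dominated by
  \<open>norm z ^ Suc k / (1 - norm z)\<close>.\<close>

theorem signed_partition_gf:
  fixes z :: complex
  assumes f: "\<And>a. \<bar>f a\<bar> \<le> 1" and z: "norm z < 1"
  shows "(\<lambda>n. of_int (signed_partition_number n f) * z ^ n) sums exp (log_gf f z)"
proof -
  let ?\<rho> = "norm z"
  let ?P = "\<lambda>N. \<Prod>i<N. 1 / (1 - of_int (f (Suc i)) * z ^ Suc i)"
  let ?b = "\<lambda>n N. of_int (bounded_partition_sum N f n) * z ^ n"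
  let ?w = "\<lambda>i. of_int (f (Suc i)) * z ^ Suc i"
  have "((\<lambda>N. ?b n N) \<longlonglongrightarrow> of_int (signed_partition_number n f) * z ^ n)" for n
    by (rule tendsto_eventually)
      (auto simp: eventually_sequentially bounded_partition_sum_eq_signed_partition_number intro!: exI[of _ n])
  note tannery[OF this, where M = "\<lambda>n. of_int (signed_partition_number n (\<lambda>_. 1)) * ?\<rho> ^ n"]
  then have 1: "summable (\<lambda>n. norm (of_int (signed_partition_number n f) * z ^ n))"
    and 2: "(\<lambda>N. \<Sum>n. ?b n N) \<longlonglongrightarrow> (\<Sum>n. of_int (signed_partition_number n f) * z ^ n)"
    using bounded_partition_sum_norm_le[OF f] summable_partition_numbers[of ?\<rho>] z
    by (simp_all only: norm_ge_zero always_eventually trivial_limit_sequentially not_False_eq_True simp_thms)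
  have A: "(\<Sum>n. ?b n N) = ?P N" for N
    using bounded_partition_gf[OF f z, of N] by (simp add: sums_iff)
  have wle: "norm (?w i) \<le> ?\<rho> ^ Suc i" for i
    using norm_lambert_term_le[of f i 1 z, OF f] by simp
  have w1: "norm (?w i) < 1" for i
    using wle[of i] power_Suc_less_1[of ?\<rho> i] z by (meson norm_ge_zero le_less_trans)
  have B: "?P N = exp (\<Sum>k. (\<Sum>i<N. ?w i ^ Suc k) / of_nat (Suc k))" for N
  proof -
    have "?P N = exp (\<Sum>i<N. \<Sum>k. ?w i ^ Suc k / of_nat (Suc k))"
      unfolding exp_sum[OF finite_lessThan] by (rule prod.cong[OF refl], rule exp_geometric_log(2)[OF w1])
    also have "(\<Sum>i<N. \<Sum>k. ?w i ^ Suc k / of_nat (Suc k)) = (\<Sum>k. \<Sum>i<N. ?w i ^ Suc k / of_nat (Suc k))"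
      by (rule suminf_sum[symmetric]) (rule exp_geometric_log[OF w1])
    finally show ?thesis by (simp only: sum_divide_distrib)
  qed
  have wk: "?w i ^ Suc k = of_int (f (Suc i) ^ Suc k) * z ^ (Suc i * Suc k)" for i k
    by (simp only: power_mult_distrib of_int_power power_mult)
  have "(\<lambda>N. (\<Sum>i<N. ?w i ^ Suc k) / of_nat (Suc k)) \<longlonglongrightarrow> lambert f (Suc k) z / of_nat (Suc k)" for k
    unfolding lambert_def wk
    by (intro tendsto_divide tendsto_const summable_LIMSEQ summable_lambert f z of_nat_neq_0)
  moreover have "norm ((\<Sum>i<N. ?w i ^ Suc k) / of_nat (Suc k)) \<le> ?\<rho> ^ Suc k / (1 - ?\<rho>)" for N k
  proof -
    have "norm ((\<Sum>i<N. ?w i ^ Suc k) / of_nat (Suc k)) \<le> norm (\<Sum>i<N. ?w i ^ Suc k)"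
      using divide_left_mono[of 1 "real (Suc k)" "norm (\<Sum>i<N. ?w i ^ Suc k)"]
      by (simp only: norm_divide norm_of_nat) simp
    also have "\<dots> \<le> (\<Sum>i<N. (?\<rho> ^ Suc k) ^ Suc i)"
      unfolding wk by (rule sum_norm_le) (rule norm_lambert_term_le[OF f])
    also have "\<dots> \<le> ?\<rho> ^ Suc k / (1 - ?\<rho> ^ Suc k)"
      using geometric_Suc_sums[of "?\<rho> ^ Suc k"] power_Suc_less_1[of ?\<rho> k] z
        sum_le_suminf[of "\<lambda>i. (?\<rho> ^ Suc k) ^ Suc i" "{..<N}"]
      by (simp add: sums_iff del: power_Suc)
    also have "\<dots> \<le> ?\<rho> ^ Suc k / (1 - ?\<rho>)"
      using z power_decreasing[of 1 "Suc k" ?\<rho>] by (intro divide_left_mono mult_pos_pos) auto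
    finally show ?thesis .
  qed
  moreover have "summable (\<lambda>k. ?\<rho> ^ Suc k / (1 - ?\<rho>))"
    using geometric_Suc_sums[of ?\<rho>] z by (intro summable_divide sums_summable) auto
  ultimately have "(\<lambda>N. \<Sum>k. (\<Sum>i<N. ?w i ^ Suc k) / of_nat (Suc k)) \<longlonglongrightarrow> log_gf f z"
    unfolding log_gf_def
    by (intro tannery(2)[where M = "\<lambda>k. ?\<rho> ^ Suc k / (1 - ?\<rho>)"]) auto
  then have "?P \<longlonglongrightarrow> exp (log_gf f z)"
    unfolding B by (rule tendsto_exp)
  with 2 have "(\<Sum>n. of_int (signed_partition_number n f) * z ^ n) = exp (log_gf f z)"
    unfolding A using LIMSEQ_unique by blast
  with 1 show ?thesis using summable_sums[OF summable_norm_cancel[OF 1]] by simp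
qed

section \<open>Growth at roots of unity\<close>

lemma periodic_power_series:
  fixes b :: "nat \<Rightarrow> complex"
  assumes "T > 0" "\<And>n. b (n + T) = b n" "\<And>n. norm (b n) \<le> 1" "0 \<le> q" "q < 1"
  shows "(\<lambda>n. b n * of_real q ^ n) sums ((\<Sum>n<T. b n * of_real q ^ n) / (1 - of_real q ^ T))"
proof -
  let ?a = "\<lambda>n. b n * of_real q ^ n"
  have sm: "summable ?a"
  proof (rule summable_comparison_test'[where N = 0 and g = "\<lambda>n. q ^ n"])
    show "norm (?a n) \<le> q ^ n" for n
      using mult_right_mono[OF assms(3)[of n], of "q ^ n"] assms(4) by (simp add: norm_mult norm_power)
  qed (use assms in auto)
  have "q ^ T < 1" using assms(1,4,5) power_Suc_less_1[of q "T - 1"] by simp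
  then have ne: "1 - of_real q ^ T \<noteq> (0 :: complex)"
    by (metis eq_iff_diff_eq_0 less_irrefl of_real_eq_1_iff of_real_power)
  have "suminf ?a = (\<Sum>n. ?a (n + T)) + (\<Sum>n<T. ?a n)"
    by (rule suminf_split_initial_segment[OF sm])
  also have "(\<Sum>n. ?a (n + T)) = of_real q ^ T * suminf ?a"
    by (subst suminf_mult[OF sm, symmetric]) (simp add: assms(2) power_add mult_ac)
  finally have "suminf ?a * (1 - of_real q ^ T) = (\<Sum>n<T. ?a n)" by (simp add: algebra_simps)
  with ne have "suminf ?a = (\<Sum>n<T. ?a n) / (1 - of_real q ^ T)" by (simp add: eq_divide_eq)
  with sm show ?thesis by (metis summable_sums)
qed

text \<open>Read off from the pole of the rational function:
  \<open>u / (1 - exp (- u * real T))\<close> tends to \<open>1 / T\<close>, while the numerator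
  tends to the sum over one period.\<close>

lemma periodic_abel_mean:
  fixes b :: "nat \<Rightarrow> complex"
  assumes "T > 0" "\<And>n. b (n + T) = b n" "\<And>n. norm (b n) \<le> 1"
  shows "((\<lambda>u. of_real u * (\<Sum>n. b n * of_real (exp (- u)) ^ n)) \<longlongrightarrow> (\<Sum>n<T. b n) / of_nat T) (at_right 0)"
proof -
  have "((\<lambda>u. u / (1 - exp (- u * real T))) \<longlongrightarrow> 1 / real T) (at_right 0)"
    using assms(1) by (real_asymp simp: field_simps)
  then have "((\<lambda>u. of_real (u / (1 - exp (- u * real T))) :: complex) \<longlongrightarrow> of_real (1 / real T)) (at_right 0)"
    by (rule tendsto_of_real)
  moreover have "((\<lambda>u. \<Sum>n<T. b n * of_real (exp (- u)) ^ n) \<longlongrightarrow> (\<Sum>n<T. b n * of_real (exp (- 0)) ^ n)) (at_right 0)"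
    by (intro tendsto_intros)
  ultimately have "((\<lambda>u. of_real (u / (1 - exp (- u * real T))) * (\<Sum>n<T. b n * of_real (exp (- u)) ^ n)) \<longlongrightarrow>
      of_real (1 / real T) * (\<Sum>n<T. b n * of_real (exp (- 0)) ^ n)) (at_right 0)"
    by (rule tendsto_mult)
  moreover have "eventually (\<lambda>u. of_real (u / (1 - exp (- u * real T))) * (\<Sum>n<T. b n * of_real (exp (- u)) ^ n) =
      of_real u * (\<Sum>n. b n * of_real (exp (- u)) ^ n)) (at_right (0 :: real))"
    using eventually_at_right_less[of 0]
  proof eventually_elim
    case (elim u)
    have "exp (- u * real T) = exp (- u) ^ T" by (simp add: exp_of_nat_mult[symmetric] mult_ac)
    then show ?case
      using sums_unique[OF periodic_power_series[where b = b and T = T and q = "exp (- u)"]] assms elim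
      by (simp add: divide_inverse mult_ac)
  qed
  ultimately have "((\<lambda>u. of_real u * (\<Sum>n. b n * of_real (exp (- u)) ^ n)) \<longlongrightarrow>
      of_real (1 / real T) * (\<Sum>n<T. b n * of_real (exp (- 0)) ^ n)) (at_right 0)"
    by (blast intro: Lim_transform_eventually)
  then show ?thesis by simp
qed

text \<open>The Lambert sum of order \<open>k\<close> at \<omega> e^(-t) behaves like this mean
  divided by k t. \<open>T\<close> is meant to be a common period of \<open>f\<close> and of the
  powers of \<omega>.\<close>

definition twisted_mean :: "(nat \<Rightarrow> int) \<Rightarrow> nat \<Rightarrow> complex \<Rightarrow> nat \<Rightarrow> complex" where
  "twisted_mean f T \<omega> k = (\<Sum>n<T. of_int (f n ^ k) * \<omega> ^ (n * k)) / of_nat T"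

text \<open>The real part of the constant G of the overview. One factor 1 / k comes from the
  logarithm series, the other from the pole of the Lambert sum, whose variable is e^(-k t).\<close>

definition growth :: "(nat \<Rightarrow> int) \<Rightarrow> nat \<Rightarrow> complex \<Rightarrow> real" where
  "growth f T \<omega> = (\<Sum>k. Re (twisted_mean f T \<omega> (Suc k)) / (real (Suc k))\<^sup>2)"

lemma summable_inverse_squares_Suc: "summable (\<lambda>k. 1 / (real (Suc k))\<^sup>2)"
  using inverse_squares_sums by (simp add: sums_iff add.commute)

lemma norm_of_int_power_le_1:
  assumes "\<bar>a\<bar> \<le> (1 :: int)"
  shows "norm (of_int (a ^ k) :: complex) \<le> 1"
proof -
  have "\<bar>of_int a :: real\<bar> \<le> 1" using assms by linarith
  then show ?thesis by (simp add: norm_power power_le_one)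
qed

lemma norm_twisted_mean_le:
  assumes f: "\<And>a. \<bar>f a\<bar> \<le> 1" and \<omega>: "norm \<omega> = 1"
  shows "norm (twisted_mean f T \<omega> k) \<le> 1"
proof -
  have "norm (\<Sum>n<T. of_int (f n ^ k) * \<omega> ^ (n * k)) \<le> (\<Sum>n<T. 1)"
    by (rule sum_norm_le)
      (simp only: norm_mult norm_power[of \<omega>] \<omega> power_one mult_1_right norm_of_int_power_le_1 f)
  then show ?thesis
    by (cases "T = 0") (auto simp: twisted_mean_def norm_divide divide_le_eq)
qed

lemma norm_lambert_le:
  assumes f: "\<And>a. \<bar>f a\<bar> \<le> 1" and z: "norm z < 1"
  shows "norm (lambert f (Suc k) z) \<le> norm z ^ Suc k / (1 - norm z ^ Suc k)"
proof -
  have g: "(\<lambda>n. (norm z ^ Suc k) ^ Suc n) sums (norm z ^ Suc k / (1 - norm z ^ Suc k))"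
    using power_Suc_less_1[of "norm z" k] z by (intro geometric_Suc_sums) auto
  have "norm (lambert f (Suc k) z) \<le> (\<Sum>n. (norm z ^ Suc k) ^ Suc n)"
    unfolding lambert_def
    by (rule norm_suminf_le[OF norm_lambert_term_le[OF f] sums_summable[OF g]])
  then show ?thesis unfolding sums_unique[OF g, symmetric] .
qed

lemma summable_log_gf:
  assumes f: "\<And>a. \<bar>f a\<bar> \<le> 1" and z: "norm z < 1"
  shows "summable (\<lambda>k. lambert f (Suc k) z / of_nat (Suc k))"
proof (rule summable_comparison_test'[where N = 0])
  let ?q = "norm z"
  show "summable (\<lambda>k. ?q ^ Suc k / (1 - ?q))"
    using geometric_Suc_sums[of ?q] z by (intro summable_divide sums_summable) auto
  show "norm (lambert f (Suc k) z / of_nat (Suc k)) \<le> ?q ^ Suc k / (1 - ?q)" for k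
  proof -
    have "norm (lambert f (Suc k) z / of_nat (Suc k)) \<le> norm (lambert f (Suc k) z)"
      using divide_left_mono[of 1 "real (Suc k)" "norm (lambert f (Suc k) z)"]
      by (simp only: norm_divide norm_of_nat) simp
    also have "\<dots> \<le> ?q ^ Suc k / (1 - ?q ^ Suc k)"
      using norm_lambert_le[where f = f and z = z and k = k, OF f z] .
    also have "\<dots> \<le> ?q ^ Suc k / (1 - ?q)"
      using z power_decreasing[of 1 "Suc k" ?q] power_Suc_less_1[of ?q k]
      by (intro divide_left_mono mult_pos_pos) (auto simp del: power_Suc)
    finally show ?thesis .
  qed
qed

text \<open>Dominated convergence in \<open>k\<close>. The Lambert sum is at most e^(-u) / (1 -
  e^(-u)) <= 1 / u with u = t (k + 1), so after scaling by t / (k + 1) it is at most 1 / (k + 1)^2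
  for every t > 0. Each single limit is the Abel mean taken in the variable u.\<close>

theorem log_gf_asymptotic:
  assumes f: "\<And>a. \<bar>f a\<bar> \<le> 1" "f 0 = 0" and T: "T > 0" "\<And>n. f (n + T) = f n" "\<omega> ^ T = 1"
  shows "((\<lambda>t. t * Re (log_gf f (\<omega> * of_real (exp (- t))))) \<longlongrightarrow> growth f T \<omega>) (at_right 0)"
proof -
  have \<omega>: "norm \<omega> = 1"
    using T(1,3) by (metis norm_one norm_power power_eq_1_iff norm_ge_zero not_gr0)
  let ?z = "\<lambda>t::real. \<omega> * of_real (exp (- t))"
  let ?a = "\<lambda>k t. of_real t * (lambert f (Suc k) (?z t) / of_nat (Suc k))"
  let ?b = "\<lambda>k. twisted_mean f T \<omega> (Suc k) / (of_nat (Suc k))\<^sup>2"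
  have nz: "norm (?z t) = exp (- t)" for t by (simp add: norm_mult \<omega>)
  have lim: "(?a k \<longlongrightarrow> ?b k) (at_right 0)" for k
  proof -
    let ?c = "\<lambda>n. of_int (f n ^ Suc k) * \<omega> ^ (n * Suc k)"
    have "((\<lambda>u. of_real u * (\<Sum>n. ?c n * of_real (exp (- u)) ^ n)) \<longlongrightarrow> twisted_mean f T \<omega> (Suc k)) (at_right 0)"
      unfolding twisted_mean_def
    proof (rule periodic_abel_mean[OF T(1)])
      show "?c (n + T) = ?c n" for n
        unfolding T(2) add_mult_distrib power_add power_mult[of \<omega> T] T(3) power_one mult_1_right ..
      show "norm (?c n) \<le> 1" for n
        by (simp only: norm_mult norm_power[of \<omega>] \<omega> power_one mult_1_right norm_of_int_power_le_1 f)
    qed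
    moreover have "filterlim (\<lambda>t. t * real (Suc k)) (at_right 0) (at_right (0 :: real))"
      by real_asymp
    ultimately have "((\<lambda>t. of_real (t * real (Suc k)) * (\<Sum>n. ?c n * of_real (exp (- (t * real (Suc k)))) ^ n))
        \<longlongrightarrow> twisted_mean f T \<omega> (Suc k)) (at_right 0)"
      by (rule filterlim_compose)
    then have "((\<lambda>t. of_real (t * real (Suc k)) * (\<Sum>n. ?c n * of_real (exp (- (t * real (Suc k)))) ^ n) / (of_nat (Suc k))\<^sup>2)
        \<longlongrightarrow> ?b k) (at_right 0)"
      by (intro tendsto_divide tendsto_const) (auto simp del: of_nat_Suc)
    moreover have "eventually (\<lambda>t. of_real (t * real (Suc k)) * (\<Sum>n. ?c n * of_real (exp (- (t * real (Suc k)))) ^ n) / (of_nat (Suc k))\<^sup>2 = ?a k t) (at_right (0 :: real))"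
      using eventually_at_right_less[of 0]
    proof eventually_elim
      case (elim t)
      have 1: "?c n * of_real (exp (- (t * real (Suc k)))) ^ n = of_int (f n ^ Suc k) * ?z t ^ (n * Suc k)" for n
      proof -
        have "exp (- (t * real (Suc k))) = exp (- t) ^ Suc k"
          by (simp only: exp_of_nat_mult[symmetric]) (simp add: algebra_simps)
        then show ?thesis
          by (simp only: of_real_power power_mult[symmetric] power_mult_distrib mult.commute mult.left_commute mult.assoc)
      qed
      have "summable (\<lambda>n. of_int (f (Suc n) ^ Suc k) * ?z t ^ (Suc n * Suc k))"
        by (rule summable_lambert[OF f(1)]) (use elim nz in simp)
      then have "summable (\<lambda>n. of_int (f n ^ Suc k) * ?z t ^ (n * Suc k))"
        by (rule summable_Suc_iff[THEN iffD1])
      from suminf_split_head[OF this] have "(\<Sum>n. of_int (f n ^ Suc k) * ?z t ^ (n * Suc k)) = lambert f (Suc k) (?z t)"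
        unfolding lambert_def using f(2) by (simp del: mult_Suc_right mult_Suc)
      then show ?case unfolding 1
        by (simp add: power2_eq_square del: of_nat_Suc)
    qed
    ultimately show ?thesis by (blast intro: Lim_transform_eventually)
  qed
  have bnd: "norm (?a k t) \<le> 1 / (real (Suc k))\<^sup>2" if "0 < t" for k t
  proof -
    let ?u = "t * real (Suc k)"
    have u: "?u > 0" using that by simp
    have e: "exp (- t) ^ Suc k = exp (- ?u)"
      by (simp only: exp_of_nat_mult[symmetric]) (simp add: algebra_simps)
    have "norm (lambert f (Suc k) (?z t)) \<le> exp (- ?u) / (1 - exp (- ?u))"
      using norm_lambert_le[where f = f and z = "?z t" and k = k] f(1) that unfolding nz e by simp
    also have "\<dots> = 1 / (exp ?u - 1)"
      using u by (simp add: exp_minus divide_simps del: of_nat_Suc)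
    also have "\<dots> \<le> 1 / ?u"
      using u that exp_ge_add_one_self[of ?u] by (intro divide_left_mono mult_pos_pos) (linarith | simp)+
    finally have "norm (lambert f (Suc k) (?z t)) * (t / real (Suc k)) \<le> 1 / ?u * (t / real (Suc k))"
      using that by (intro mult_right_mono) auto
    then show ?thesis
      using that by (simp add: norm_mult norm_divide power2_eq_square mult_ac del: of_nat_Suc)
  qed
  have "eventually (\<lambda>t. \<forall>k. norm (?a k t) \<le> 1 / (real (Suc k))\<^sup>2) (at_right 0)"
    using eventually_at_right_less[of 0] by eventually_elim (use bnd in blast)
  note tan = tannery[OF lim this summable_inverse_squares_Suc trivial_limit_at_right_real]
  have sb: "summable ?b" by (rule summable_norm_cancel[OF tan(1)])
  have "((\<lambda>t. Re (\<Sum>k. ?a k t)) \<longlongrightarrow> Re (\<Sum>k. ?b k)) (at_right 0)"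
    by (rule tendsto_Re[OF tan(2)])
  also have "Re (\<Sum>k. ?b k) = growth f T \<omega>"
    unfolding growth_def Re_suminf[OF sb]
    by (intro suminf_cong) (simp add: Re_divide_of_nat[of _ "_\<^sup>2", simplified] del: of_nat_Suc flip: of_nat_power)
  finally have L: "((\<lambda>t. Re (\<Sum>k. ?a k t)) \<longlongrightarrow> growth f T \<omega>) (at_right 0)" .
  have "eventually (\<lambda>t. Re (\<Sum>k. ?a k t) = t * Re (log_gf f (?z t))) (at_right 0)"
    using eventually_at_right_less[of 0]
  proof eventually_elim
    case (elim t)
    have "summable (\<lambda>k. ?a k t)"
      by (rule summable_comparison_test'[where N = 0, OF summable_inverse_squares_Suc]) (use bnd[OF elim] in blast)
    then have "summable (\<lambda>k. (1 / of_real t) * ?a k t)" by (rule summable_mult)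
    then have "summable (\<lambda>k. lambert f (Suc k) (?z t) / of_nat (Suc k))"
      using elim by (simp del: of_nat_Suc)
    from suminf_mult[OF this, of "of_real t"] have "(\<Sum>k. ?a k t) = of_real t * log_gf f (?z t)"
      unfolding log_gf_def .
    then show ?case by simp
  qed
  with L show ?thesis by (blast intro: Lim_transform_eventually)
qed

section \<open>Sieving a residue class by roots of unity\<close>

lemma sum_powers_root_of_unity:
  fixes m a :: nat
  assumes "m > 0" "\<not> m dvd a"
  shows "(\<Sum>l<m. cis (2 * pi / m) ^ (l * a)) = 0"
proof -
  let ?w = "cis (2 * pi / m) ^ a"
  have "?w ^ m = (cis (2 * pi / m) ^ m) ^ a" by (simp only: power_mult[symmetric] mult.commute)
  also have "cis (2 * pi / m) ^ m = 1" using assms(1) by (simp add: Complex.DeMoivre)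
  finally have 1: "?w ^ m = 1" by simp
  have 2: "?w \<noteq> 1"
  proof
    assume "?w = 1"
    then have "Re (cis (real a * (2 * pi / m))) = Re 1" by (simp only: Complex.DeMoivre)
    then have "cos (real a * (2 * pi / m)) = 1" by (simp only: cis.sel one_complex.sel)
    then obtain k :: int where "real a * (2 * pi / m) = of_int k * 2 * pi"
      unfolding cos_one_2pi_int by (elim exE)
    then have "real a = of_int k * real m" using assms(1) by (simp add: field_simps)
    then have "real_of_int (int a) = real_of_int (k * int m)" by simp
    then have "int a = k * int m" by (simp only: of_int_eq_iff)
    then have "int m dvd int a" by simp
    then show False using assms(2) by (simp only: int_dvd_int_iff)
  qed
  have "(\<Sum>l<m. cis (2 * pi / m) ^ (l * a)) = (\<Sum>l<m. ?w ^ l)"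
    by (intro sum.cong refl) (simp only: power_mult[symmetric] mult.commute)
  also have "\<dots> = 0" using geometric_sum[OF 2, of m] 1 by simp
  finally show ?thesis .
qed

lemma cis_root_power_inj:
  assumes "l < m" "l' < m" "cis (2 * pi / real m) ^ l = cis (2 * pi / real m) ^ l'"
  shows "l = l'"
proof (rule ccontr)
  let ?\<zeta> = "cis (2 * pi / real m)"
  assume "l \<noteq> l'"
  define a where "a = min l l'"
  define b where "b = max l l'"
  have ab: "a < b" "b < m" "?\<zeta> ^ a = ?\<zeta> ^ b"
    using assms \<open>l \<noteq> l'\<close> by (auto simp: a_def b_def min_def max_def)
  have "?\<zeta> ^ b = ?\<zeta> ^ (a + (b - a))" using ab(1) by (simp only: le_add_diff_inverse less_imp_le)
  then have 1: "?\<zeta> ^ (b - a) = 1" using ab(3) unfolding power_add by simp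
  have "(\<Sum>j<m. ?\<zeta> ^ (j * (b - a))) = 0"
    using ab by (intro sum_powers_root_of_unity) (auto dest: dvd_imp_le)
  moreover have "?\<zeta> ^ (j * (b - a)) = 1" for j
    unfolding mult.commute[of j] power_mult 1 by simp
  ultimately show False using ab by simp
qed

text \<open>Orthogonality of the \<open>m\<close>-th roots of unity: the twisted sum retains only
  the coefficients with \<open>n mod m = r\<close>, and these are \<open>0\<close>. The exponent
  \<open>m - r\<close> represents - r modulo \<open>m\<close> within the natural numbers.\<close>

lemma residue_class_sieve:
  fixes a :: "nat \<Rightarrow> complex"
  assumes m: "r < m" and zero: "\<And>n. n mod m = r \<Longrightarrow> a n = 0"
    and sums: "\<And>z. norm z < 1 \<Longrightarrow> (\<lambda>n. a n * z ^ n) sums F z" and z: "norm z < 1"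
  shows "(\<Sum>l<m. cis (2 * pi / m) ^ (l * (m - r)) * F (cis (2 * pi / m) ^ l * z)) = 0"
proof -
  let ?\<zeta> = "cis (2 * pi / m)"
  have "(\<lambda>n. \<Sum>l<m. ?\<zeta> ^ (l * (m - r)) * (a n * (?\<zeta> ^ l * z) ^ n)) sums
      (\<Sum>l<m. ?\<zeta> ^ (l * (m - r)) * F (?\<zeta> ^ l * z))"
    by (intro sums_sum sums_mult sums) (use z in \<open>simp add: norm_mult norm_power\<close>)
  moreover have "(\<Sum>l<m. ?\<zeta> ^ (l * (m - r)) * (a n * (?\<zeta> ^ l * z) ^ n)) = 0" for n
  proof -
    have "(\<Sum>l<m. ?\<zeta> ^ (l * (m - r)) * (a n * (?\<zeta> ^ l * z) ^ n)) = a n * z ^ n * (\<Sum>l<m. ?\<zeta> ^ (l * (m - r + n)))"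
      unfolding sum_distrib_left
      by (intro sum.cong refl) (simp only: power_mult_distrib power_add distrib_left power_mult ac_simps)
    also have "\<dots> = 0"
    proof (cases "n mod m = r")
      case False
      have "\<not> m dvd m - r + n"
      proof
        assume "m dvd m - r + n"
        then obtain k where k: "m - r + n = m * k" by blast
        then have "m + n = m * k + r" using m by linarith
        then have "(m + n) mod m = r" using m by simp
        with False show False by simp
      qed
      then show ?thesis by (subst sum_powers_root_of_unity) (use m in simp_all)
    qed (simp add: zero)
    finally show ?thesis .
  qed
  ultimately have "(\<lambda>n. 0) sums (\<Sum>l<m. ?\<zeta> ^ (l * (m - r)) * F (?\<zeta> ^ l * z))" by simp
  then show ?thesis using sums_zero sums_unique2 by blast
qed

text \<open>Outside \<open>D\<close> a term with growth g has modulus exp(g / t + o(1 / t)). There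
  are finitely many of them, all with g < C, so a single \<open>C' < C\<close> absorbs the largest g
  together with the error.\<close>

theorem dominant_terms_cancel:
  assumes f: "\<And>a. \<bar>f a\<bar> \<le> 1" "f 0 = 0" and P: "P > 0" "\<And>n. f (n + P) = f n"
    and r: "r < m" "\<And>n. n mod m = r \<Longrightarrow> signed_partition_number n f = 0"
    and dom: "D \<subseteq> {..<m}" "\<And>l. l < m \<Longrightarrow> l \<notin> D \<Longrightarrow> growth f (P * m) (cis (2 * pi / m) ^ l) < C"
  obtains C' where "C' < C"
    "eventually (\<lambda>t. norm (\<Sum>l\<in>D. cis (2 * pi / m) ^ (l * (m - r)) *
        exp (log_gf f (cis (2 * pi / m) ^ l * of_real (exp (- t))))) \<le> real m * exp (C' / t)) (at_right 0)"
proof -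
  let ?\<zeta> = "cis (2 * pi / m)"
  let ?g = "\<lambda>l. growth f (P * m) (?\<zeta> ^ l)"
  let ?E = "{..<m} - D"
  let ?F = "\<lambda>l t. ?\<zeta> ^ (l * (m - r)) * exp (log_gf f (?\<zeta> ^ l * of_real (exp (- t))))"
  \<comment> \<open>\<open>C - 1\<close> keeps the set nonempty when \<open>D\<close> contains every
    index. The midpoint taken next leaves room for the error o(1 / t).\<close>
  define M where "M = Max (insert (C - 1) (?g ` ?E))"
  define C' where "C' = (M + C) / 2"
  have M: "M < C" unfolding M_def using dom(2) by (subst Max_less_iff) auto
  then have C': "C' < C" by (simp add: C'_def)
  have gC': "?g l < C'" if "l \<in> ?E" for l
  proof -
    have "?g l \<le> M" unfolding M_def using that by (intro Max_ge) auto
    with M show ?thesis unfolding C'_def by simp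
  qed
  have "eventually (\<lambda>t. \<forall>l\<in>?E. t * Re (log_gf f (?\<zeta> ^ l * of_real (exp (- t)))) < C') (at_right 0)"
  proof (rule eventually_ball_finite, simp, intro ballI)
    fix l assume l: "l \<in> ?E"
    have per: "f (n + P * j) = f n" for n j
    proof (induction j)
      case (Suc j)
      then show ?case using P(2)[of "n + P * j"] by (simp add: algebra_simps)
    qed simp
    have "(?\<zeta> ^ l) ^ (P * m) = (?\<zeta> ^ m) ^ (l * P)" by (simp only: power_mult[symmetric] mult_ac)
    also have "?\<zeta> ^ m = 1" using r(1) by (simp add: Complex.DeMoivre)
    finally have root: "(?\<zeta> ^ l) ^ (P * m) = 1" by simp
    have "((\<lambda>t. t * Re (log_gf f (?\<zeta> ^ l * of_real (exp (- t))))) \<longlongrightarrow> ?g l) (at_right 0)"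
      by (rule log_gf_asymptotic) (use f P r root per in auto)
    then show "eventually (\<lambda>t. t * Re (log_gf f (?\<zeta> ^ l * of_real (exp (- t)))) < C') (at_right 0)"
      by (rule order_tendstoD(2)) (rule gC'[OF l])
  qed
  then have "eventually (\<lambda>t. norm (\<Sum>l\<in>D. ?F l t) \<le> real m * exp (C' / t)) (at_right 0)"
    using eventually_at_right_less[of 0]
  proof eventually_elim
    case (elim t)
    have "(\<Sum>l<m. ?\<zeta> ^ (l * (m - r)) * exp (log_gf f (?\<zeta> ^ l * of_real (exp (- t))))) = 0"
    proof (rule residue_class_sieve[where a = "\<lambda>n. of_int (signed_partition_number n f)" and
            F = "\<lambda>z. exp (log_gf f z)"])
      show "r < m" by (rule r)
      show "of_int (signed_partition_number n f) = 0" if "n mod m = r" for n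
        using r(2)[OF that] by simp
      show "(\<lambda>n. of_int (signed_partition_number n f) * z ^ n) sums exp (log_gf f z)"
        if "norm z < 1" for z :: complex
        by (rule signed_partition_gf[OF f(1) that])
      show "norm (of_real (exp (- t)) :: complex) < 1" using elim(2) by simp
    qed
    then have "(\<Sum>l\<in>D. ?F l t) = - (\<Sum>l\<in>?E. ?F l t)"
      using sum.subset_diff[OF dom(1), of "\<lambda>l. ?F l t"] by (simp add: add_eq_0_iff)
    then have "norm (\<Sum>l\<in>D. ?F l t) = norm (\<Sum>l\<in>?E. ?F l t)" by simp
    also have "\<dots> \<le> real (card ?E) * exp (C' / t)"
    proof (rule sum_norm_bound)
      fix l assume l: "l \<in> ?E"
      then have "Re (log_gf f (?\<zeta> ^ l * of_real (exp (- t)))) \<le> C' / t"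
        using elim(2) bspec[OF elim(1) l] by (simp add: pos_le_divide_eq mult.commute)
      then show "norm (?F l t) \<le> exp (C' / t)"
        by (simp add: norm_mult norm_power norm_exp_eq_Re)
    qed
    also have "\<dots> \<le> real m * exp (C' / t)"
      using card_mono[of "{..<m}" ?E] by (intro mult_right_mono) auto
    finally show ?case .
  qed
  with C' show ?thesis by (rule that)
qed

section \<open>Termwise comparison of growth rates\<close>

definition odd_squares_sum :: real where
  "odd_squares_sum = (\<Sum>i. 1 / (2 * real i + 1)\<^sup>2)"

lemma odd_squares_sums: "(\<lambda>i. 1 / (2 * real i + 1)\<^sup>2) sums odd_squares_sum"
proof -
  have "summable (\<lambda>i. 1 / (2 * real i + 1)\<^sup>2)"
  proof (rule summable_comparison_test'[where N = 0, OF summable_inverse_squares_Suc])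
    show "norm (1 / (2 * real i + 1)\<^sup>2) \<le> 1 / (real (Suc i))\<^sup>2" for i
      by (simp add: divide_simps power_mono)
  qed
  then show ?thesis unfolding odd_squares_sum_def by (rule summable_sums)
qed

text \<open>The exact value is pi^2 / 8 = 1.2337...; the numerical comparisons below only use this
  upper bound. The first term is 1, and the rest is at most a telescoping series with sum 1 / 4,
  because (2 i + 3)^2 >= 4 (i + 1) (i + 2).\<close>

lemma odd_squares_sum_le: "odd_squares_sum \<le> 5 / 4"
proof -
  let ?a = "\<lambda>i. 1 / (2 * real i + 1)\<^sup>2"
  have "(\<lambda>i. 1 / real (Suc i)) \<longlonglongrightarrow> 0" by real_asymp
  from telescope_sums'[OF this] have "(\<lambda>i. 1 / real (Suc i) - 1 / real (Suc (Suc i))) sums 1" by simp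
  from sums_mult[OF this, of "1 / 4"] have b: "(\<lambda>i. (1 / 4) * (1 / real (Suc i) - 1 / real (Suc (Suc i)))) sums (1 / 4)"
    by (simp only: mult_1_right)
  have "(\<lambda>i. ?a (Suc i)) sums (odd_squares_sum - 1)"
    using odd_squares_sums by (subst sums_Suc_iff) simp
  moreover have "?a (Suc i) \<le> (1 / 4) * (1 / real (Suc i) - 1 / real (Suc (Suc i)))" for i
  proof -
    have "?a (Suc i) \<le> 1 / (4 * ((real i + 1) * (real i + 2)))"
    proof (rule divide_left_mono)
      show "4 * ((real i + 1) * (real i + 2)) \<le> (2 * real (Suc i) + 1)\<^sup>2"
        by (simp add: power2_eq_square algebra_simps)
    qed simp_all
    also have "\<dots> = (1 / 4) * (1 / real (Suc i) - 1 / real (Suc (Suc i)))"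
      by (simp add: divide_simps add.commute)
    finally show ?thesis .
  qed
  ultimately have "odd_squares_sum - 1 \<le> 1 / 4"
    by (intro sums_le[OF _ _ b])
  then show ?thesis by simp
qed

text \<open>The index is shifted by one: position \<open>k\<close> carries the summand for \<open>Suc k\<close>.\<close>

lemma scaled_odd_squares_sums:
  assumes "c > 0"
  shows "(\<lambda>k. if Suc k mod (2 * c) = c then 1 / (real (Suc k))\<^sup>2 else 0) sums (odd_squares_sum / (real c)\<^sup>2)"
    (is "?f sums _")
proof -
  let ?g = "\<lambda>i. c * (2 * i + 1) - 1"
  have Sg: "Suc (?g i) = c * (2 * i + 1)" for i using assms by simp
  have "strict_mono ?g" using assms by (intro strict_monoI diff_less_mono) auto
  moreover have "?f k = 0" if "k \<notin> range ?g" for k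
  proof (rule ccontr)
    assume "?f k \<noteq> 0"
    then have "Suc k mod (2 * c) = c" by (meson)
    then have "Suc k = c * (2 * (Suc k div (2 * c)) + 1)"
      using div_mult_mod_eq[of "Suc k" "2 * c"] by (simp add: algebra_simps)
    then obtain q where q: "Suc k = c * (2 * q + 1)" by blast
    have "k = ?g q" unfolding q[symmetric] by simp
    with that show False by blast
  qed
  ultimately have "(\<lambda>i. ?f (?g i)) sums (odd_squares_sum / (real c)\<^sup>2) \<longleftrightarrow> ?f sums (odd_squares_sum / (real c)\<^sup>2)"
    by (rule sums_mono_reindex)
  moreover have "?f (?g i) = 1 / (2 * real i + 1)\<^sup>2 / (real c)\<^sup>2" for i
  proof -
    have "c * (2 * i + 1) = c + i * (2 * c)" by (simp add: algebra_simps)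
    then have "c * (2 * i + 1) mod (2 * c) = c" using assms by (simp only: mod_mult_self1) simp
    then show ?thesis unfolding Sg
      by (simp only: if_True refl of_nat_mult of_nat_add of_nat_1 of_nat_numeral power_mult_distrib) simp
  qed
  ultimately show ?thesis using sums_divide[OF odd_squares_sums, of "(real c)\<^sup>2"] by simp
qed

text \<open>Writing n = j P + n' splits off a geometric sum over j < m with ratio (\<omega>^k)^P.
  The ratio is an \<open>m\<close>-th root of unity, so that sum is m or 0.\<close>

lemma twisted_mean_eq:
  assumes per: "\<And>n. f (n + P) = f n" and "m > 0" and \<omega>: "\<omega> ^ m = 1"
  shows "twisted_mean f (P * m) \<omega> k =
    (if (\<omega> ^ k) ^ P = 1 then (\<Sum>n<P. of_int (f n ^ k) * (\<omega> ^ k) ^ n) / of_nat P else 0)"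
proof -
  let ?v = "\<omega> ^ k"
  have per': "f (n + j * P) = f n" for n j
    by (induction j) (simp_all add: per add.assoc[symmetric] add.commute[of P])
  have "(\<Sum>n<P * m. of_int (f n ^ k) * \<omega> ^ (n * k)) = (\<Sum>j<m. \<Sum>n\<in>{j * P..<j * P + P}. of_int (f n ^ k) * \<omega> ^ (n * k))"
    by (simp only: sum.nat_group mult.commute)
  also have "\<dots> = (\<Sum>j<m. \<Sum>n<P. of_int (f n ^ k) * ?v ^ n * (?v ^ P) ^ j)"
  proof (rule sum.cong[OF refl])
    fix j
    have "(\<Sum>n\<in>{j * P..<j * P + P}. of_int (f n ^ k) * \<omega> ^ (n * k)) =
        (\<Sum>n\<in>{0 + j * P..<P + j * P}. of_int (f n ^ k) * \<omega> ^ (n * k))"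
      by (simp add: add.commute)
    also have "\<dots> = (\<Sum>n<P. of_int (f n ^ k) * ?v ^ n * (?v ^ P) ^ j)"
      unfolding sum.shift_bounds_nat_ivl lessThan_atLeast0 per'
      by (intro sum.cong refl) (simp add: power_add power_mult[symmetric] algebra_simps)
    finally show "(\<Sum>n\<in>{j * P..<j * P + P}. of_int (f n ^ k) * \<omega> ^ (n * k)) =
        (\<Sum>n<P. of_int (f n ^ k) * ?v ^ n * (?v ^ P) ^ j)" .
  qed
  also have "\<dots> = (\<Sum>n<P. of_int (f n ^ k) * ?v ^ n) * (\<Sum>j<m. (?v ^ P) ^ j)"
    by (simp only: sum_distrib_left[symmetric] sum_distrib_right[symmetric])
  also have "(\<Sum>j<m. (?v ^ P) ^ j) = (if ?v ^ P = 1 then of_nat m else 0)"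
  proof (cases "?v ^ P = 1")
    case False
    have "(?v ^ P) ^ m = (\<omega> ^ m) ^ (k * P)" by (simp only: power_mult[symmetric] mult_ac)
    then show ?thesis using geometric_sum[OF False, of m] False \<omega> by simp
  qed simp
  finally show ?thesis using \<open>m > 0\<close> by (simp add: twisted_mean_def)
qed

lemma growth_summable:
  assumes "\<And>a. \<bar>f a\<bar> \<le> 1" "norm \<omega> = 1"
  shows "summable (\<lambda>k. Re (twisted_mean f T \<omega> (Suc k)) / (real (Suc k))\<^sup>2)"
proof (rule summable_comparison_test'[where N = 0, OF summable_inverse_squares_Suc])
  show "norm (Re (twisted_mean f T \<omega> (Suc k)) / (real (Suc k))\<^sup>2) \<le> 1 / (real (Suc k))\<^sup>2" for k
    using norm_twisted_mean_le[where f = f and \<omega> = \<omega> and T = T and k = "Suc k"] assms abs_Re_le_cmod[of "twisted_mean f T \<omega> (Suc k)"]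
    by (simp add: divide_right_mono abs_divide del: of_nat_Suc)
qed

text \<open>The margin \<open>e k\<close> may be negative at some exponents; only its weighted total
  has to be positive. This lets a loss at odd exponents be paid by a gain at even ones.\<close>

lemma growth_less:
  assumes f: "\<And>a. \<bar>f a\<bar> \<le> 1" and n: "norm \<omega> = 1" "norm \<omega>' = 1"
    and e: "\<And>k. Re (twisted_mean f T \<omega> (Suc k)) + e k \<le> Re (twisted_mean f T \<omega>' (Suc k))"
    and s: "(\<lambda>k. e k / (real (Suc k))\<^sup>2) sums s" "s > 0"
  shows "growth f T \<omega> < growth f T \<omega>'"
proof -
  have "(\<lambda>k. Re (twisted_mean f T \<omega> (Suc k)) / (real (Suc k))\<^sup>2 + e k / (real (Suc k))\<^sup>2) sums (growth f T \<omega> + s)"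
    unfolding growth_def by (intro sums_add summable_sums growth_summable f n s)
  moreover have "(\<lambda>k. Re (twisted_mean f T \<omega>' (Suc k)) / (real (Suc k))\<^sup>2) sums growth f T \<omega>'"
    unfolding growth_def by (intro summable_sums growth_summable f n)
  ultimately have "growth f T \<omega> + s \<le> growth f T \<omega>'"
  proof (rule sums_le[rotated])
    show "Re (twisted_mean f T \<omega> (Suc k)) / (real (Suc k))\<^sup>2 + e k / (real (Suc k))\<^sup>2
        \<le> Re (twisted_mean f T \<omega>' (Suc k)) / (real (Suc k))\<^sup>2" for k
      unfolding add_divide_distrib[symmetric] by (intro divide_right_mono e) simp
  qed
  with s(2) show ?thesis by simp
qed

section \<open>Legendre symbols and their growth\<close>

lemma abs_chi_le_1: "\<bar>chi p n\<bar> \<le> 1"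
  by (simp add: chi_def Legendre_def)

lemma chi_0: "chi p 0 = 0"
  by (simp add: chi_def Legendre_def)

text \<open>The numbers -1, 0, 1 are distinct modulo p > 2. This turns Euler's criterion into
  equalities, from which multiplicativity and periodicity of \<open>chi p\<close> follow.\<close>

lemma cong_small_imp_eq:
  fixes a b :: int
  assumes "[a = b] (mod int p)" "2 < p" "\<bar>a\<bar> \<le> 1" "\<bar>b\<bar> \<le> 1"
  shows "a = b"
proof (rule ccontr)
  assume "a \<noteq> b"
  moreover have "int p dvd a - b" using assms(1) by (simp add: cong_iff_dvd_diff)
  ultimately have "int p \<le> \<bar>a - b\<bar>" using dvd_imp_le_int[of "a - b" "int p"] by simp
  with assms show False by linarith
qed

context
  fixes p :: nat
  assumes p: "prime p" "2 < p"
begin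

lemma chi_eq_0_iff: "chi p n = 0 \<longleftrightarrow> p dvd n"
  by (simp add: chi_def Legendre_def cong_0_iff)

lemma chi_power2: "\<not> p dvd n \<Longrightarrow> chi p n * chi p n = 1"
  using chi_eq_0_iff[of n] abs_chi_le_1[of p n] by (cases "chi p n = 1"; cases "chi p n = -1") auto

lemma chi_cong_power: "[chi p n = int n ^ ((p - 1) div 2)] (mod int p)"
  unfolding chi_def by (rule euler_criterion[OF p])

lemma chi_mult: "chi p (a * b) = chi p a * chi p b"
proof (rule cong_small_imp_eq[OF _ p(2)])
  have "[chi p a * chi p b = int a ^ ((p - 1) div 2) * int b ^ ((p - 1) div 2)] (mod int p)"
    by (intro cong_mult chi_cong_power)
  then show "[chi p (a * b) = chi p a * chi p b] (mod int p)"
    using chi_cong_power[of "a * b"] by (simp add: power_mult_distrib) (meson cong_sym cong_trans)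
  show "\<bar>chi p a * chi p b\<bar> \<le> 1"
    using mult_mono[OF abs_chi_le_1[of p a] abs_chi_le_1[of p b]] by (simp add: abs_mult)
qed (rule abs_chi_le_1)

lemma chi_cong:
  assumes "[a = b] (mod p)"
  shows "chi p a = chi p b"
proof (rule cong_small_imp_eq[OF _ p(2) abs_chi_le_1 abs_chi_le_1])
  have "[int a ^ ((p - 1) div 2) = int b ^ ((p - 1) div 2)] (mod int p)"
    using assms by (intro cong_pow) (simp add: cong_int_iff)
  then show "[chi p a = chi p b] (mod int p)"
    using chi_cong_power[of a] chi_cong_power[of b] by (meson cong_sym cong_trans)
qed

lemma chi_mod: "chi p (n mod p) = chi p n"
  by (rule chi_cong) (simp add: unique_euclidean_semiring_class.cong_def)

lemma chi_add: "chi p (n + p) = chi p n"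
  by (rule chi_cong) (simp add: unique_euclidean_semiring_class.cong_def)

lemma chi_minus_one: "chi p (p - 1) = (- 1) ^ ((p - 1) div 2)"
proof (rule cong_small_imp_eq[OF _ p(2)])
  have "[int (p - 1) = - 1] (mod int p)"
    using p by (simp add: of_nat_diff cong_iff_dvd_diff)
  then have "[int (p - 1) ^ ((p - 1) div 2) = (- 1) ^ ((p - 1) div 2)] (mod int p)"
    by (rule cong_pow)
  then show "[chi p (p - 1) = (- 1) ^ ((p - 1) div 2)] (mod int p)"
    by (rule cong_trans[OF chi_cong_power])
qed (auto simp: abs_chi_le_1)

lemma chi_reflect:
  assumes "0 < i" "i \<le> p"
  shows "chi p (p - i) = chi p (p - 1) * chi p i"
proof -
  have "(p - 1) * i = (p - i) + (i - 1) * p"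
    using assms p by (cases i) (auto simp: algebra_simps diff_mult_distrib2)
  then have "[p - i = (p - 1) * i] (mod p)" by (simp add: unique_euclidean_semiring_class.cong_def)
  then show ?thesis by (simp add: chi_cong chi_mult)
qed

lemma bij_betw_mult_mod:
  assumes "\<not> p dvd a"
  shows "bij_betw (\<lambda>n. a * n mod p) {..<p} {..<p}"
proof -
  have cop: "coprime a p" using assms p(1) by (metis coprime_commute prime_imp_coprime)
  have "inj_on (\<lambda>n. a * n mod p) {..<p}"
  proof (rule inj_onI)
    fix x y assume xy: "x \<in> {..<p}" "y \<in> {..<p}" "a * x mod p = a * y mod p"
    then have "[a * x = a * y] (mod p)" by (simp add: unique_euclidean_semiring_class.cong_def)
    then have "[x = y] (mod p)" using cop by (simp add: cong_mult_lcancel_nat)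
    with xy show "x = y" by (simp add: unique_euclidean_semiring_class.cong_def)
  qed
  moreover have "(\<lambda>n. a * n mod p) ` {..<p} \<subseteq> {..<p}" using p by auto
  ultimately show ?thesis by (simp add: bij_betw_def endo_inj_surj)
qed

lemma sum_mult_mod:
  assumes "\<not> p dvd a"
  shows "(\<Sum>n<p. g (a * n mod p)) = (\<Sum>n<p. g n)"
  by (rule sum.reindex_bij_betw[OF bij_betw_mult_mod[OF assms]])

lemma sum_chi_eq_0:
  assumes "chi p a = - 1"
  shows "(\<Sum>n<p. chi p n) = 0"
proof -
  have "\<not> p dvd a" using assms chi_eq_0_iff[of a] by auto
  from sum_mult_mod[OF this, of "chi p"] show ?thesis
    by (simp add: chi_mod chi_mult assms sum_negf)
qed

lemma root_power_eq_1_iff: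
  fixes w :: complex
  assumes w: "w ^ p = 1" "w \<noteq> 1"
  shows "w ^ n = 1 \<longleftrightarrow> p dvd n"
proof
  assume n: "w ^ n = 1"
  show "p dvd n"
  proof (rule ccontr)
    assume "\<not> p dvd n"
    then have "coprime n p" using p(1) by (metis coprime_commute prime_imp_coprime)
    then obtain x where "[n * x = 1] (mod p)" by (auto dest: cong_solve_coprime_nat)
    then have "n * x mod p = 1" using p(2) by (simp add: unique_euclidean_semiring_class.cong_def)
    then have "n * x = 1 + p * (n * x div p)" by (metis div_mult_mod_eq add.commute mult.commute)
    then have "w ^ (n * x) = w * (w ^ p) ^ (n * x div p)" by (metis power_add power_mult power_one_right)
    then show False using n w by (simp add: power_mult)
  qed
qed (use w in \<open>auto simp: power_mult\<close>)

lemma root_power_mod: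
  fixes w :: complex
  assumes "w ^ p = 1"
  shows "w ^ (n mod p) = w ^ n"
proof -
  have "w ^ n = w ^ (p * (n div p) + n mod p)" by simp
  also have "\<dots> = w ^ (n mod p)" by (simp only: power_add power_mult assms power_one mult_1)
  finally show ?thesis by simp
qed

text \<open>The sum of |G(b)|^2 over b < p is computed twice. Substituting b n for n gives G(b) =
  chi(b) G(1), hence the value (p - 1) |G(1)|^2; orthogonality of the powers of \<open>w\<close>
  gives p (p - 1). The hypothesis \<open>sum0\<close> supplies G(0) = 0.\<close>

lemma gauss_sum_norm:
  fixes w :: complex
  assumes sum0: "(\<Sum>n<p. chi p n) = 0" and w: "w ^ p = 1" "w \<noteq> 1"
  shows "norm (\<Sum>n<p. of_int (chi p n) * w ^ n) = sqrt p"
proof -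
  define G where "G b = (\<Sum>n<p. of_int (chi p n) * (w ^ n) ^ b)" for b
  have nw: "norm w = 1"
    using w(1) p by (metis norm_one norm_power power_eq_1_iff norm_ge_zero prime_gt_0_nat not_gr0)
  then have wc: "w * cnj w = 1" by (simp add: complex_norm_square[symmetric])
  have G: "G b = of_int (chi p b) * G 1" if "\<not> p dvd b" for b
  proof -
    have "G 1 = (\<Sum>n<p. of_int (chi p (b * n mod p)) * w ^ (b * n mod p))"
      unfolding G_def power_one_right by (rule sum_mult_mod[OF that, symmetric])
    also have "\<dots> = of_int (chi p b) * G b"
      unfolding G_def sum_distrib_left
      by (intro sum.cong refl)
        (simp add: chi_mod chi_mult root_power_mod[OF w(1)] power_mult[symmetric] mult_ac)
    finally have "of_int (chi p b) * G 1 = of_int (chi p b * chi p b) * G b" by simp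
    then show ?thesis using chi_power2[OF that] by simp
  qed
  have G0: "G 0 = 0"
    using sum0 unfolding G_def by (simp flip: of_int_sum)
  have "(\<Sum>b<p. G b * cnj (G b)) = (\<Sum>b<p. if b = 0 then 0 else G 1 * cnj (G 1))"
  proof (rule sum.cong[OF refl])
    fix b assume b: "b \<in> {..<p}"
    show "G b * cnj (G b) = (if b = 0 then 0 else G 1 * cnj (G 1))"
    proof (cases "b = 0")
      case False
      then have nd: "\<not> p dvd b" using b by (auto dest: dvd_imp_le)
      have "G b * cnj (G b) = of_int (chi p b * chi p b) * (G 1 * cnj (G 1))"
        by (simp add: G[OF nd] mult_ac)
      then show ?thesis using chi_power2[OF nd] False by simp
    qed (simp add: G0)
  qed
  also have "\<dots> = of_nat (p - 1) * (G 1 * cnj (G 1))"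
    using p by (simp add: sum.If_cases Diff_eq[symmetric] lessThan_def)
  finally have 1: "(\<Sum>b<p. G b * cnj (G b)) = of_nat (p - 1) * (G 1 * cnj (G 1))" .
  have orth: "(\<Sum>b<p. (w ^ n * cnj w ^ m) ^ b) = (if n = m then of_nat p else 0)" if "n < p" "m < p" for n m
  proof (cases "n = m")
    case True
    then show ?thesis by (simp add: power_mult_distrib[symmetric] wc)
  next
    case False
    let ?v = "w ^ n * cnj w ^ m"
    have "?v \<noteq> 1"
    proof
      assume v: "?v = 1"
      have "w ^ n * (w * cnj w) ^ m = w ^ m * ?v" by (simp add: power_mult_distrib)
      then have nm: "w ^ n = w ^ m" by (simp add: wc v)
      have "w \<noteq> 0" using nw by auto
      have "w ^ (max n m - min n m) = 1"
      proof -
        have "w ^ max n m = w ^ min n m" using nm by (simp add: max_def min_def)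
        moreover have "w ^ max n m = w ^ min n m * w ^ (max n m - min n m)"
          by (simp flip: power_add)
        ultimately show ?thesis using \<open>w \<noteq> 0\<close> by simp
      qed
      then have "p dvd max n m - min n m" by (simp only: root_power_eq_1_iff[OF w])
      moreover have "0 < max n m - min n m" "max n m - min n m < p" using False that by auto
      ultimately show False by (meson nat_dvd_not_less)
    qed
    moreover have "?v ^ p = (w ^ p) ^ n * cnj (w ^ p) ^ m"
      by (simp add: power_mult_distrib power_mult[symmetric] mult.commute)
    ultimately show ?thesis using geometric_sum[of ?v p] False w by simp
  qed
  have "(\<Sum>b<p. G b * cnj (G b)) = (\<Sum>b<p. \<Sum>n<p. \<Sum>m<p. of_int (chi p n * chi p m) * (w ^ n * cnj w ^ m) ^ b)"
    unfolding G_def cnj_sum sum_product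
    by (intro sum.cong refl) (simp add: power_mult_distrib mult_ac)
  also have "\<dots> = (\<Sum>n<p. \<Sum>m<p. of_int (chi p n * chi p m) * (\<Sum>b<p. (w ^ n * cnj w ^ m) ^ b))"
  proof -
    have "(\<Sum>b<p. \<Sum>n<p. \<Sum>m<p. of_int (chi p n * chi p m) * (w ^ n * cnj w ^ m) ^ b) =
        (\<Sum>n<p. \<Sum>b<p. \<Sum>m<p. of_int (chi p n * chi p m) * (w ^ n * cnj w ^ m) ^ b)"
      by (rule sum.swap)
    also have "\<dots> = (\<Sum>n<p. \<Sum>m<p. \<Sum>b<p. of_int (chi p n * chi p m) * (w ^ n * cnj w ^ m) ^ b)"
      by (intro sum.cong refl sum.swap)
    finally show ?thesis by (simp only: sum_distrib_left)
  qed
  also have "\<dots> = (\<Sum>n<p. \<Sum>m<p. of_int (chi p n * chi p m) * (if n = m then of_nat p else 0))"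
    by (intro sum.cong refl) (simp add: orth)
  also have "\<dots> = (\<Sum>n<p. if n = 0 then 0 else of_nat p)"
  proof (rule sum.cong[OF refl])
    fix n assume n: "n \<in> {..<p}"
    have "(\<Sum>m<p. of_int (chi p n * chi p m) * (if n = m then of_nat p else 0)) =
        (\<Sum>m<p. if m = n then of_int (chi p n * chi p n) * of_nat p else (0 :: complex))"
      by (intro sum.cong refl) auto
    also have "\<dots> = of_int (chi p n * chi p n) * of_nat p" using n by simp
    also have "\<dots> = (if n = 0 then 0 else of_nat p)"
    proof (cases "n = 0")
      case False
      then have "\<not> p dvd n" using n by (auto dest: dvd_imp_le)
      from chi_power2[OF this] False show ?thesis by simp
    qed (simp add: chi_0)
    finally show "(\<Sum>m<p. of_int (chi p n * chi p m) * (if n = m then of_nat p else 0)) =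
        (if n = 0 then 0 else of_nat p :: complex)" .
  qed
  also have "\<dots> = of_nat (p - 1) * of_nat p"
    using p by (simp add: sum.If_cases Diff_eq[symmetric] lessThan_def)
  finally have "of_nat (p - 1) * (G 1 * cnj (G 1)) = of_nat (p - 1) * (of_nat p :: complex)"
    using 1 by simp
  then have "G 1 * cnj (G 1) = of_nat p" using p by simp
  then have "complex_of_real ((norm (G 1))\<^sup>2) = of_real (real p)"
    by (simp only: complex_norm_square of_real_of_nat_eq)
  then have "(norm (G 1))\<^sup>2 = real p" by (simp only: of_real_eq_iff)
  then have "norm (G 1) = sqrt p" by (metis norm_ge_zero real_sqrt_unique)
  then show ?thesis by (simp add: G_def)
qed

end

section \<open>Growth of Legendre symbols at roots of unity\<close>

context
  fixes p :: nat
  assumes p: "prime p" "2 < p"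
begin

text \<open>An even power of \<open>chi p\<close> is the indicator of the nonmultiples of
  \<open>p\<close>, so the numerator is a full geometric sum without its term at \<open>0\<close>:
  either p - 1 or -1.\<close>

lemma twisted_mean_chi_even:
  assumes "even k" "k > 0" "m > 0" "\<omega> ^ m = 1"
  shows "twisted_mean (chi p) (p * m) \<omega> k =
    (if \<omega> ^ k = 1 then of_real ((p - 1) / p) else if (\<omega> ^ k) ^ p = 1 then - of_real (1 / p) else 0)"
proof -
  let ?v = "\<omega> ^ k"
  have c: "chi p n ^ k = (if n = 0 then 0 else 1)" if "n < p" for n
  proof (cases "n = 0")
    case False
    then have "\<not> p dvd n" using that by (auto dest: dvd_imp_le)
    obtain j where j: "k = 2 * j" using assms(1) by (elim evenE)
    show ?thesis
      using chi_power2[OF p \<open>\<not> p dvd n\<close>] False by (simp add: j power_mult power2_eq_square)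
  qed (use assms(2) in \<open>simp add: chi_0\<close>)
  have "(\<Sum>n<p. of_int (chi p n ^ k) * ?v ^ n) = (\<Sum>n<p. ?v ^ n - (if n = 0 then 1 else 0))"
    by (intro sum.cong refl) (simp add: c)
  also have "\<dots> = (\<Sum>n<p. ?v ^ n) - 1" using p by (simp add: sum_subtractf)
  finally have s: "(\<Sum>n<p. of_int (chi p n ^ k) * ?v ^ n) = (\<Sum>n<p. ?v ^ n) - 1" .
  have g: "(\<Sum>n<p. ?v ^ n) = (if ?v = 1 then of_nat p else 0)" if "?v ^ p = 1"
    using that geometric_sum[of ?v p] by (cases "?v = 1") auto
  have v: "?v ^ p = 1" if "?v = 1" using that by simp
  show ?thesis
    using twisted_mean_eq[where f = "chi p" and P = p, OF chi_add[OF p] assms(3,4), of k] s g v p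
    by (auto simp: of_nat_diff)
qed

lemma twisted_mean_chi_odd:
  assumes "odd k" "m > 0" "\<omega> ^ m = 1"
  shows "twisted_mean (chi p) (p * m) \<omega> k =
    (if (\<omega> ^ k) ^ p = 1 then (\<Sum>n<p. of_int (chi p n) * (\<omega> ^ k) ^ n) / of_nat p else 0)"
proof -
  obtain j where j: "k = 2 * j + 1" using assms(1) by (elim oddE)
  have "chi p n ^ k = chi p n" for n
  proof (cases "p dvd n")
    case True
    then show ?thesis using chi_eq_0_iff[OF p] by (simp add: j)
  next
    case False
    then show ?thesis using chi_power2[OF p False] by (simp add: j power_mult power2_eq_square)
  qed
  then show ?thesis
    using twisted_mean_eq[where f = "chi p" and P = p, OF chi_add[OF p] assms(2,3), of k] by simp
qed

text \<open>At odd exponents both means vanish, for different reasons: at \<open>1\<close> by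
  \<open>sum0\<close>, at \<open>- 1\<close> because an odd power is \<open>- 1\<close>, which is
  not a \<open>p\<close>-th root of unity.\<close>

lemma growth_chi_minus_one:
  assumes sum0: "(\<Sum>n<p. chi p n) = 0" and m: "even m" "m > 0"
  shows "growth (chi p) (p * m) (- 1) = growth (chi p) (p * m) 1"
proof -
  have odd_p: "odd p" by (rule prime_odd_nat[OF p])
  have m1: "(- 1 :: complex) ^ m = 1" using m by simp
  have "twisted_mean (chi p) (p * m) (- 1) (Suc k) = twisted_mean (chi p) (p * m) 1 (Suc k)" for k
  proof (cases "even (Suc k)")
    case True
    then show ?thesis
      using twisted_mean_chi_even[of "Suc k" m "- 1"] twisted_mean_chi_even[of "Suc k" m 1] m m1
      by (simp only: neg_one_even_power power_one)
  next
    case False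
    have "twisted_mean (chi p) (p * m) (- 1) (Suc k) = 0"
      using twisted_mean_chi_odd[OF False m(2) m1] False odd_p
      by (simp only: neg_one_odd_power) simp
    moreover have "twisted_mean (chi p) (p * m) 1 (Suc k) = 0"
      using twisted_mean_chi_odd[OF False m(2), of 1] sum0 by (simp flip: of_int_sum)
    ultimately show ?thesis by simp
  qed
  then show ?thesis by (simp only: growth_def)
qed

lemma Re_twisted_mean_chi_one:
  assumes sum0: "(\<Sum>n<p. chi p n) = 0" and "m > 0" "k > 0"
  shows "Re (twisted_mean (chi p) (p * m) 1 k) = (if even k then (p - 1) / p else 0)"
proof (cases "even k")
  case True
  then show ?thesis using twisted_mean_chi_even[of k m 1] assms by simp
next
  case False
  then show ?thesis using twisted_mean_chi_odd[OF False, of m 1] assms by (simp flip: of_int_sum)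
qed

lemma Re_twisted_mean_chi_even_le:
  assumes "even k" "k > 0" "m > 0" "\<omega> ^ m = 1"
  shows "Re (twisted_mean (chi p) (p * m) \<omega> k) \<le> (if \<omega> ^ k = 1 then (p - 1) / p else 0)"
  unfolding twisted_mean_chi_even[OF assms] by (auto simp del: of_real_divide)

text \<open>The reflection of n to p - n sends the sum to minus its conjugate, so it is purely
  imaginary.\<close>

lemma Re_sum_chi_odd_character:
  assumes "chi p (p - 1) = - 1" "v ^ p = 1"
  shows "Re (\<Sum>n<p. of_int (chi p n) * v ^ n) = 0"
proof -
  have nv: "norm v = 1"
    using assms(2) p by (metis norm_one norm_power power_eq_1_iff norm_ge_zero prime_gt_0_nat not_gr0)
  then have vc: "v * cnj v = 1" by (simp add: complex_norm_square[symmetric])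
  have "(\<Sum>n<p. of_int (chi p n) * v ^ n) = (\<Sum>n\<in>{1..<p}. of_int (chi p n) * v ^ n)"
    using p by (simp add: sum.atLeast_Suc_lessThan lessThan_atLeast0 chi_0)
  also have "\<dots> = (\<Sum>n\<in>{1..<p}. of_int (chi p (p - n)) * v ^ (p - n))"
    by (rule sum.reindex_bij_witness[of _ "\<lambda>n. p - n" "\<lambda>n. p - n"]) auto
  also have "\<dots> = (\<Sum>n\<in>{1..<p}. - cnj (of_int (chi p n) * v ^ n))"
  proof (rule sum.cong[OF refl])
    fix n assume n: "n \<in> {1..<p}"
    have "v ^ (p - n) * v ^ n = 1" using n assms(2) by (simp flip: power_add)
    moreover have "cnj (v ^ n) * v ^ n = 1"
      by (simp add: power_mult_distrib[symmetric] mult.commute vc)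
    moreover have "v ^ n \<noteq> 0" using nv by auto
    ultimately have "v ^ (p - n) = cnj (v ^ n)" by (metis mult_right_cancel)
    then show "of_int (chi p (p - n)) * v ^ (p - n) = - cnj (of_int (chi p n) * v ^ n)"
      using chi_reflect[OF p, of n] assms(1) n by simp
  qed
  also have "\<dots> = - cnj (\<Sum>n\<in>{1..<p}. of_int (chi p n) * v ^ n)"
    by (simp add: sum_negf)
  also have "(\<Sum>n\<in>{1..<p}. of_int (chi p n) * v ^ n) = (\<Sum>n<p. of_int (chi p n) * v ^ n)"
    using p by (simp add: sum.atLeast_Suc_lessThan lessThan_atLeast0 chi_0)
  finally have "Re (\<Sum>n<p. of_int (chi p n) * v ^ n) = Re (- cnj (\<Sum>n<p. of_int (chi p n) * v ^ n))"
    by (rule arg_cong)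
  then show ?thesis by (simp only: uminus_complex.sel cnj.sel)
qed

text \<open>When no odd exponent contributes positively, \<omega> is nowhere above \<open>1\<close>,
  and exponent 2 alone makes the inequality strict.\<close>

lemma growth_chi_less_aux:
  assumes sum0: "(\<Sum>n<p. chi p n) = 0" and m: "m > 0" "\<omega> ^ m = 1" and \<omega>2: "\<omega>\<^sup>2 \<noteq> 1"
    and odd: "\<And>k. odd k \<Longrightarrow> Re (twisted_mean (chi p) (p * m) \<omega> k) \<le> 0"
  shows "growth (chi p) (p * m) \<omega> < growth (chi p) (p * m) 1"
proof (rule growth_less[OF abs_chi_le_1])
  show "norm \<omega> = 1"
    using m by (metis norm_one norm_power power_eq_1_iff norm_ge_zero not_gr0)
  have nonneg: "0 \<le> real (p - 1) / real p" by simp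
  \<comment> \<open>Index \<open>1\<close> stands for exponent 2, whence the weight 1 / 4 below;
    there \<omega>^2 \<noteq> 1 costs at least (p - 1) / p.\<close>
  let ?e = "\<lambda>k. if k = 1 then (p - 1) / p else 0"
  show "Re (twisted_mean (chi p) (p * m) \<omega> (Suc k)) + ?e k \<le> Re (twisted_mean (chi p) (p * m) 1 (Suc k))" for k
  proof (cases "even (Suc k)")
    case True
    note A = Re_twisted_mean_chi_even_le[OF True zero_less_Suc m]
    have B: "Re (twisted_mean (chi p) (p * m) 1 (Suc k)) = real (p - 1) / real p"
      using Re_twisted_mean_chi_one[OF sum0 m(1) zero_less_Suc, of k] True by (simp only: if_True)
    show ?thesis
    proof (cases "k = 1")
      case True
      from True have "\<omega> ^ Suc k \<noteq> 1" using \<omega>2 by (simp add: power2_eq_square)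
      with A have "Re (twisted_mean (chi p) (p * m) \<omega> (Suc k)) \<le> 0" by (simp only: if_False)
      with True show ?thesis unfolding B by (simp only: if_True refl add_le_same_cancel2)
    next
      case F: False
      have "Re (twisted_mean (chi p) (p * m) \<omega> (Suc k)) \<le> real (p - 1) / real p"
        by (rule order.trans[OF A]) (use nonneg in simp)
      with F \<open>even (Suc k)\<close> show ?thesis unfolding B by (simp only: if_False not_True_eq_False)
    qed
  next
    case False
    then show ?thesis
      using odd[OF False] Re_twisted_mean_chi_one[OF sum0 m(1), of "Suc k"] by auto
  qed
  have "(\<lambda>k. ?e k / (real (Suc k))\<^sup>2) = (\<lambda>k. if k = 1 then (p - 1) / p / 4 else 0)" by auto
  then show "(\<lambda>k. ?e k / (real (Suc k))\<^sup>2) sums ((p - 1) / p / 4)"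
    using sums_single[of 1 "\<lambda>_. (p - 1) / p / 4"] by simp
  show "0 < (p - 1) / p / (4 :: real)" using p by simp
qed simp

lemma growth_chi_less_odd_character:
  assumes "chi p (p - 1) = - 1" and m: "m > 0" "\<omega> ^ m = 1" and "\<omega>\<^sup>2 \<noteq> 1"
  shows "growth (chi p) (p * m) \<omega> < growth (chi p) (p * m) 1"
proof (rule growth_chi_less_aux[OF sum_chi_eq_0[OF p assms(1)] m assms(4)])
  fix k :: nat assume "odd k"
  from twisted_mean_chi_odd[OF this m] show "Re (twisted_mean (chi p) (p * m) \<omega> k) \<le> 0"
    using Re_sum_chi_odd_character[OF assms(1), of "\<omega> ^ k"]
    by (auto simp: Re_divide_of_nat)
qed

text \<open>By the Gauss sum an odd exponent may contribute up to 1 / sqrt p. If a nonzero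
  contribution occurs, some odd power of \<omega> is a nontrivial \<open>p\<close>-th root of unity,
  and then \<omega>^k = 1 with \<open>k\<close> even forces 2 p to divide \<open>k\<close>. Hence
  \<omega> falls behind at every even exponent below 2 p, which pays for the odd ones.\<close>

lemma growth_chi_less_large:
  assumes sum0: "(\<Sum>n<p. chi p n) = 0" and "13 \<le> p" and m: "m > 0" "\<omega> ^ m = 1" and \<omega>2: "\<omega>\<^sup>2 \<noteq> 1"
  shows "growth (chi p) (p * m) \<omega> < growth (chi p) (p * m) 1"
proof (cases "\<exists>k0. odd k0 \<and> (\<omega> ^ k0) ^ p = 1 \<and> \<omega> ^ k0 \<noteq> 1")
  case False
  show ?thesis
  proof (rule growth_chi_less_aux[OF sum0 m \<omega>2])
    fix k :: nat assume k: "odd k"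
    have "twisted_mean (chi p) (p * m) \<omega> k = 0"
    proof (cases "(\<omega> ^ k) ^ p = 1")
      case True
      then have "\<omega> ^ k = 1" using False k by blast
      then show ?thesis
        using twisted_mean_chi_odd[OF k m] sum0 by (simp flip: of_int_sum)
    qed (use twisted_mean_chi_odd[OF k m] in simp)
    then show "Re (twisted_mean (chi p) (p * m) \<omega> k) \<le> 0" by simp
  qed
next
  case True
  then obtain k0 where k0: "odd k0" "(\<omega> ^ k0) ^ p = 1" "\<omega> ^ k0 \<noteq> 1" by blast
  have nr: "\<omega> ^ k \<noteq> 1" if "0 < k" "k < 2 * p" "even k" for k
  proof
    assume "\<omega> ^ k = 1"
    moreover have "(\<omega> ^ k0) ^ k = (\<omega> ^ k) ^ k0" by (simp only: power_mult[symmetric] mult.commute)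
    ultimately have "(\<omega> ^ k0) ^ k = 1" by (simp only: power_one)
    then have "p dvd k" by (simp only: root_power_eq_1_iff[OF p k0(2,3)])
    moreover have "coprime p 2" using prime_odd_nat[OF p] by (simp add: coprime_right_2_iff_odd)
    ultimately have "p * 2 dvd k" using that(3) by (simp add: divides_mult)
    then show False using that by (auto dest: dvd_imp_le)
  qed
  have nonneg: "0 \<le> real (p - 1) / real p" by simp
  \<comment> \<open>The indices of the exponents 2, 4, ..., 24. All are below 2 p because p >= 13,
    so \<open>nr\<close> applies to them.\<close>
  let ?K = "(\<lambda>i. 2 * i + 1) ` {..<12::nat}"
  let ?q = "(p - 1) / p :: real"
  let ?a = "\<lambda>k. if k \<in> ?K then ?q / (real (Suc k))\<^sup>2 else 0"
  let ?b = "\<lambda>k. if Suc k mod (2 * 1) = 1 then 1 / (real (Suc k))\<^sup>2 else 0"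
  let ?e = "\<lambda>k. if k \<in> ?K then ?q else if odd (Suc k) then - 1 / sqrt p else 0"
  show ?thesis
  proof (rule growth_less[OF abs_chi_le_1])
    show "norm \<omega> = 1"
      using m by (metis norm_one norm_power power_eq_1_iff norm_ge_zero not_gr0)
    show "Re (twisted_mean (chi p) (p * m) \<omega> (Suc k)) + ?e k \<le> Re (twisted_mean (chi p) (p * m) 1 (Suc k))" for k
    proof (cases "even (Suc k)")
      case True
    note A = Re_twisted_mean_chi_even_le[OF True zero_less_Suc m]
    have B: "Re (twisted_mean (chi p) (p * m) 1 (Suc k)) = real (p - 1) / real p"
      using Re_twisted_mean_chi_one[OF sum0 m(1) zero_less_Suc, of k] True by (simp only: if_True)
    show ?thesis
    proof (cases "k \<in> ?K")
      case True
      from True have "\<omega> ^ Suc k \<noteq> 1" using assms(2) by (intro nr) auto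
      with A have "Re (twisted_mean (chi p) (p * m) \<omega> (Suc k)) \<le> 0" by (simp only: if_False)
      with True show ?thesis unfolding B by (simp only: if_True refl add_le_same_cancel2)
    next
      case F: False
      have "Re (twisted_mean (chi p) (p * m) \<omega> (Suc k)) \<le> real (p - 1) / real p"
        by (rule order.trans[OF A]) (use nonneg in simp)
      with F \<open>even (Suc k)\<close> show ?thesis unfolding B by (simp only: if_False not_True_eq_False)
    qed
    next
      case False
      then have "k \<notin> ?K" by auto
      have "norm (twisted_mean (chi p) (p * m) \<omega> (Suc k)) \<le> 1 / sqrt p"
      proof (cases "(\<omega> ^ Suc k) ^ p = 1")
        case True
        show ?thesis
        proof (cases "\<omega> ^ Suc k = 1")
          case True
          then show ?thesis
            using twisted_mean_chi_odd[OF False m] sum0 by (simp flip: of_int_sum)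
        next
          case ne: False
          have "norm (twisted_mean (chi p) (p * m) \<omega> (Suc k)) = sqrt p / p"
            using twisted_mean_chi_odd[OF False m] True gauss_sum_norm[OF p sum0 True ne]
            by (simp add: norm_divide del: power_Suc)
          also have "sqrt p / p = 1 / sqrt p" using p by (simp add: field_simps)
          finally show ?thesis by simp
        qed
      qed (use twisted_mean_chi_odd[OF False m] in simp)
      then have "Re (twisted_mean (chi p) (p * m) \<omega> (Suc k)) \<le> 1 / sqrt p"
        by (rule order.trans[OF complex_Re_le_cmod])
      then show ?thesis
        using Re_twisted_mean_chi_one[OF sum0 m(1), of "Suc k"] False \<open>k \<notin> ?K\<close>
        by (simp only: if_False if_True not_False_eq_True)
    qed
    have a: "?a sums (\<Sum>k\<in>?K. ?q / (real (Suc k))\<^sup>2)"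
      by (rule sums_If_finite_set[OF finite_imageI[OF finite_lessThan]])
    note b = sums_mult[OF scaled_odd_squares_sums[OF zero_less_one], of "- 1 / sqrt p",
        unfolded of_nat_1 power_one div_by_1]
    note sums_add[OF a b]
    moreover have "(\<lambda>k. ?a k + (- 1 / sqrt p) * ?b k) = (\<lambda>k. ?e k / (real (Suc k))\<^sup>2)"
    proof (rule ext)
      fix k show "?a k + (- 1 / sqrt p) * ?b k = ?e k / (real (Suc k))\<^sup>2"
    proof (cases "k \<in> ?K")
      case True
      then have "even (Suc k)" by auto
      then show ?thesis using True by (simp only: even_iff_mod_2_eq_zero) simp
    next
      case False
      show ?thesis
      proof (cases "odd (Suc k)")
        case True
        then have "Suc k mod (2 * 1) = 1" unfolding odd_iff_mod_2_eq_one by (simp only: mult_1_right)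
        then show ?thesis using True False by (simp only: if_True if_False) simp
      next
        case 2: False
        then have "Suc k mod (2 * 1) \<noteq> 1" unfolding odd_iff_mod_2_eq_one by (simp only: mult_1_right not_False_eq_True)
        then show ?thesis using 2 False by (simp only: if_False if_True not_False_eq_True div_0 mult_zero_right add_0_left)
      qed
    qed
    qed
    ultimately show "(\<lambda>k. ?e k / (real (Suc k))\<^sup>2) sums
        ((\<Sum>k\<in>?K. ?q / (real (Suc k))\<^sup>2) + (- 1 / sqrt p) * odd_squares_sum)" by (simp only:)
    have "(\<Sum>i<12. g i) = g 0 + g 1 + g 2 + g 3 + g 4 + g 5 + g 6 + g 7 + g 8 + g 9 + g 10 + g 11"
      for g :: "nat \<Rightarrow> real" by (simp add: eval_nat_numeral)
    then have h1: "(\<Sum>i<12. 1 / (2 * real i + 2)\<^sup>2) \<ge> 39 / 100" by simp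
    have h2: "?q \<ge> 12 / 13" using assms(2) by (simp add: field_simps)
    have "?q * (\<Sum>i<12. 1 / (2 * real i + 2)\<^sup>2) \<ge> (12 / 13) * (39 / 100)"
      by (rule mult_mono[OF h2 h1]) simp_all
    moreover have "(\<Sum>k\<in>?K. ?q / (real (Suc k))\<^sup>2) = ?q * (\<Sum>i<12. 1 / (2 * real i + 2)\<^sup>2)"
      by (subst sum.reindex) (auto simp: inj_on_def sum_distrib_left add.commute)
    ultimately have A: "(\<Sum>k\<in>?K. ?q / (real (Suc k))\<^sup>2) \<ge> (12 / 13) * (39 / 100)" by (simp only:)
    \<comment> \<open>The square of 3.6 is 12.96. The gain is at least (12 / 13) (39 / 100) = 0.36,
      the loss at most 1.25 / 3.6, which is below 0.348.\<close>
    have "sqrt p \<ge> 36 / 10"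
      using assms(2) by (intro real_le_rsqrt) (simp add: power2_eq_square)
    then have "odd_squares_sum / sqrt p \<le> (5 / 4) / (36 / 10)"
      using odd_squares_sum_le by (intro frac_le) auto
    with A show "0 < (\<Sum>k\<in>?K. ?q / (real (Suc k))\<^sup>2) + (- 1 / sqrt p) * odd_squares_sum"
      by simp
  qed simp
qed

end

section \<open>The Kronecker symbol modulo 8\<close>

lemma chi2_mod_8: "chi2 n = (if n mod 8 = 1 \<or> n mod 8 = 7 then 1 else if n mod 8 = 3 \<or> n mod 8 = 5 then - 1 else 0)"
proof -
  have "int n mod 8 = int (n mod 8)" by (simp add: zmod_int)
  then show ?thesis by (simp add: chi2_def unique_euclidean_semiring_class.cong_def)
qed

lemma abs_chi2_le_1: "\<bar>chi2 n\<bar> \<le> 1"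
  by (simp add: chi2_mod_8)

lemma chi2_0: "chi2 0 = 0"
  by (simp add: chi2_mod_8)

lemma chi2_add: "chi2 (n + 8) = chi2 n"
  by (simp add: chi2_mod_8)

lemma sum_lessThan_8: "(\<Sum>n<8. g n) = g 0 + g 1 + g 2 + g 3 + g 4 + g 5 + g 6 + g (7::nat)"
  by (simp add: eval_nat_numeral)

lemma chi2_power:
  "chi2 n ^ k = (if k = 0 then 1 else if odd k then chi2 n else if odd n then 1 else 0)"
proof -
  have "odd r \<longleftrightarrow> r = 1 \<or> r = 3 \<or> r = 5 \<or> r = 7" if "r < 8" for r :: nat
  proof -
    have "r = 0 \<or> r = 1 \<or> r = 2 \<or> r = 3 \<or> r = 4 \<or> r = 5 \<or> r = 6 \<or> r = 7"
      using that by arith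
    then show ?thesis by (elim disjE) simp_all
  qed
  from this[of "n mod 8"] have "odd n \<longleftrightarrow> n mod 8 = 1 \<or> n mod 8 = 3 \<or> n mod 8 = 5 \<or> n mod 8 = 7"
    by (simp add: dvd_mod_iff)
  then show ?thesis by (auto simp: chi2_mod_8)
qed

lemma eighth_root_cases:
  fixes v :: complex
  assumes "v ^ 8 = 1"
  shows "v\<^sup>2 = 1 \<or> Re v = 0 \<and> v ^ 4 = 1 \<or> v ^ 4 = - 1 \<and> (Re v)\<^sup>2 = 1 / 2"
    and "norm v = 1"
proof -
  show n: "norm v = 1"
    using assms by (metis norm_one norm_power power_eq_1_iff norm_ge_zero zero_neq_numeral)
  have n2: "(Re v)\<^sup>2 + (Im v)\<^sup>2 = 1" using n cmod_power2[of v] by simp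
  have sq: "x = 1 \<or> x = - 1" if "x\<^sup>2 = 1" for x :: complex
    using that by (simp only: power2_eq_1_iff)
  have "(v ^ 4)\<^sup>2 = 1" using assms by (simp flip: power_mult)
  then have "v ^ 4 = 1 \<or> v ^ 4 = - 1" by (rule sq)
  then show "v\<^sup>2 = 1 \<or> Re v = 0 \<and> v ^ 4 = 1 \<or> v ^ 4 = - 1 \<and> (Re v)\<^sup>2 = 1 / 2"
  proof
    assume 4: "v ^ 4 = 1"
    then have "(v\<^sup>2)\<^sup>2 = 1" by (simp flip: power_mult)
    then have "v\<^sup>2 = 1 \<or> v\<^sup>2 = - 1" by (rule sq)
    moreover have "Re v = 0" if "v\<^sup>2 = - 1"
    proof -
      have "Re (v\<^sup>2) = - 1" using that by simp
      then have "(Re v)\<^sup>2 - (Im v)\<^sup>2 = - 1" by (simp add: power2_eq_square)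
      with n2 have "(Re v)\<^sup>2 = 0" by linarith
      then show ?thesis by simp
    qed
    ultimately show ?thesis using 4 by blast
  next
    assume 4: "v ^ 4 = - 1"
    have "(v\<^sup>2)\<^sup>2 = v ^ 4" by (simp flip: power_mult)
    then have "Re ((v\<^sup>2)\<^sup>2) = - 1" using 4 by simp
    then have "(Re (v\<^sup>2))\<^sup>2 - (Im (v\<^sup>2))\<^sup>2 = - 1" by (simp add: power2_eq_square)
    moreover have "(Re (v\<^sup>2))\<^sup>2 + (Im (v\<^sup>2))\<^sup>2 = 1"
      using cmod_power2[of "v\<^sup>2"] n by (simp add: norm_power)
    ultimately have "(Re (v\<^sup>2))\<^sup>2 = 0" by linarith
    then have "Re (v\<^sup>2) = 0" by (simp only: zero_eq_power2)
    then have "(Re v)\<^sup>2 = (Im v)\<^sup>2" by (simp add: power2_eq_square)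
    with n2 4 show ?thesis by simp
  qed
qed

lemma Re_eighth_root_powers:
  fixes v :: complex
  assumes "v ^ 8 = 1"
  shows "Re (v ^ 3) = 4 * (Re v) ^ 3 - 3 * Re v" "Re (v ^ 5) = Re (v ^ 3)" "Re (v ^ 7) = Re v"
proof -
  have nv: "norm v = 1" by (rule eighth_root_cases(2)[OF assms])
  have n2: "(Im v)\<^sup>2 = 1 - (Re v)\<^sup>2" using nv cmod_power2[of v] by simp
  have c: "v * cnj v = 1" using nv by (simp add: complex_norm_square[symmetric])
  have "v \<noteq> 0" using nv by auto
  have "Re (v ^ 3) = (Re v) ^ 3 - 3 * Re v * (Im v)\<^sup>2"
    by (simp add: power3_eq_cube power2_eq_square algebra_simps)
  then show "Re (v ^ 3) = 4 * (Re v) ^ 3 - 3 * Re v"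
    unfolding n2 by (simp add: power3_eq_cube power2_eq_square algebra_simps)
  have 8: "v ^ i = cnj v ^ j" if "i + j = 8" for i j
  proof -
    have "v ^ i * v ^ j = cnj v ^ j * v ^ j"
      using assms that c by (simp add: power_mult_distrib[symmetric] mult.commute flip: power_add)
    then show ?thesis using \<open>v \<noteq> 0\<close> by simp
  qed
  show "Re (v ^ 5) = Re (v ^ 3)" using 8[of 5 3] by (simp flip: complex_cnj_power)
  show "Re (v ^ 7) = Re v" using 8[of 7 1] by simp
qed

text \<open>With v = \<omega>^k, v^8 = 1 and c = Re v, the real part of the mean is c (1 - c^2) for
  odd \<open>k\<close> and c (2 c^2 - 1) / 2 for even \<open>k\<close>. The former survives only at
  primitive eighth roots, the latter only at 1 and -1.\<close>

lemma Re_twisted_mean_chi2: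
  assumes "m > 0" "\<omega> ^ m = 1" "k > 0"
  shows "Re (twisted_mean chi2 (8 * m) \<omega> k) =
    (if odd k then if (\<omega> ^ k) ^ 4 = - 1 then Re (\<omega> ^ k) / 2 else 0
     else if (\<omega> ^ k)\<^sup>2 = 1 then Re (\<omega> ^ k) / 2 else 0)"
proof -
  define v where "v = \<omega> ^ k"
  note tm = twisted_mean_eq[where f = chi2 and P = 8, OF chi2_add assms(1,2), of k, folded v_def]
  have v2: "(v\<^sup>2)\<^sup>2 = v ^ 4" "(v ^ 4)\<^sup>2 = v ^ 8" by (simp_all flip: power_mult)
  have "Re (twisted_mean chi2 (8 * m) \<omega> k) =
    (if odd k then if v ^ 4 = - 1 then Re v / 2 else 0 else if v\<^sup>2 = 1 then Re v / 2 else 0)"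
  proof (cases "v ^ 8 = 1")
    case False
    have "v ^ 4 \<noteq> - 1"
    proof
      assume "v ^ 4 = - 1"
      then have "(- 1)\<^sup>2 = v ^ 8" using v2(2) by (simp only:)
      with False show False by simp
    qed
    moreover have "v\<^sup>2 \<noteq> 1"
    proof
      assume "v\<^sup>2 = 1"
      then have "(1\<^sup>2)\<^sup>2 = v ^ 8" using v2 by (simp only:)
      with False show False by simp
    qed
    ultimately show ?thesis using False tm by simp
  next
    case True
    have tm': "Re (twisted_mean chi2 (8 * m) \<omega> k) = Re (\<Sum>n<8. of_int (chi2 n ^ k) * v ^ n) / 8"
      using True tm by (simp only: refl if_True of_nat_numeral Re_divide_numeral)
    show ?thesis
    proof (cases "odd k")
      case k: True
      have "(\<Sum>n<8. of_int (chi2 n ^ k) * v ^ n) = v - v ^ 3 - v ^ 5 + v ^ 7"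
        using k assms(3) by (simp add: sum_lessThan_8 chi2_mod_8 power_0_left)
      then have "Re (twisted_mean chi2 (8 * m) \<omega> k) = (Re v - Re (v ^ 3) - Re (v ^ 5) + Re (v ^ 7)) / 8"
        unfolding tm' by (simp only: plus_complex.sel minus_complex.sel)
      also have "\<dots> = Re v * (1 - (Re v)\<^sup>2)"
        unfolding Re_eighth_root_powers[OF True] by (simp add: power3_eq_cube power2_eq_square field_simps)
      also have "\<dots> = (if v ^ 4 = - 1 then Re v / 2 else 0)"
        using eighth_root_cases(1)[OF True]
      proof (elim disjE conjE)
        assume "v\<^sup>2 = 1"
        then have "v = 1 \<or> v = - 1" by (simp only: power2_eq_1_iff)
        then show ?thesis by auto
      qed auto
      finally show ?thesis using k by (simp only: if_True not_False_eq_True)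
    next
      case k: False
      have "(\<Sum>n<8. of_int (chi2 n ^ k) * v ^ n) = v + v ^ 3 + v ^ 5 + v ^ 7"
        using k assms(3) by (simp add: sum_lessThan_8 chi2_power)
      then have "Re (twisted_mean chi2 (8 * m) \<omega> k) = (Re v + Re (v ^ 3) + Re (v ^ 5) + Re (v ^ 7)) / 8"
        unfolding tm' by (simp only: plus_complex.sel)
      also have "\<dots> = Re v * (2 * (Re v)\<^sup>2 - 1) / 2"
        unfolding Re_eighth_root_powers[OF True] by (simp add: power3_eq_cube power2_eq_square field_simps)
      also have "\<dots> = (if v\<^sup>2 = 1 then Re v / 2 else 0)"
        using eighth_root_cases(1)[OF True]
      proof (elim disjE conjE)
        assume v: "v\<^sup>2 = 1"
        then have "v = 1 \<or> v = - 1" by (simp only: power2_eq_1_iff)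
        then show ?thesis by auto
      next
        assume a: "v ^ 4 = - 1" "(Re v)\<^sup>2 = 1 / 2"
        have "v\<^sup>2 \<noteq> 1"
        proof
          assume "v\<^sup>2 = 1"
          then have "1\<^sup>2 = - (1 :: complex)" using v2(1) a(1) by (simp only:)
          then show False by simp
        qed
        with a show ?thesis by simp
      next
        assume "Re v = 0"
        then show ?thesis by simp
      qed
      finally show ?thesis using k by (simp only: if_False)
    qed
  qed
  then show ?thesis unfolding v_def .
qed

text \<open>The shape of the margin for \<open>growth_less\<close> used below: an extra at exponent
  1, then constants on the odd multiples of 1, 2 and 4. Multiples of 8 carry no margin, because
  there \<open>cis (pi / 4)\<close> attains 1 / 2, the largest mean possible at an even
  exponent.\<close>

lemma chi2_growth_comparison_sums:
  "(\<lambda>k. ((if k = 0 then \<alpha> else 0) + (if odd (Suc k) then \<beta> else 0) + (if Suc k mod 4 = 2 then \<gamma> else 0) +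
      (if Suc k mod 8 = 4 then \<delta> else 0)) / (real (Suc k))\<^sup>2)
    sums (\<alpha> + \<beta> * odd_squares_sum + \<gamma> * (odd_squares_sum / 4) + \<delta> * (odd_squares_sum / 16))"
proof -
  let ?s = "\<lambda>c k. if Suc k mod (2 * c) = c then 1 / (real (Suc k))\<^sup>2 else 0"
  have a: "(\<lambda>k. if k = 0 then \<alpha> else 0) sums \<alpha>"
    using sums_single[of 0 "\<lambda>_. \<alpha>"] by simp
  have b: "(\<lambda>k. \<beta> * ?s 1 k) sums (\<beta> * odd_squares_sum)"
    using sums_mult[OF scaled_odd_squares_sums[of 1], of \<beta>] by simp
  have c: "(\<lambda>k. \<gamma> * ?s 2 k) sums (\<gamma> * (odd_squares_sum / 4))"
    using sums_mult[OF scaled_odd_squares_sums[of 2], of \<gamma>] by simp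
  have d: "(\<lambda>k. \<delta> * ?s 4 k) sums (\<delta> * (odd_squares_sum / 16))"
    using sums_mult[OF scaled_odd_squares_sums[of 4], of \<delta>] by simp
  have "(\<lambda>k. ((if k = 0 then \<alpha> else 0) + (if odd (Suc k) then \<beta> else 0) + (if Suc k mod 4 = 2 then \<gamma> else 0) +
      (if Suc k mod 8 = 4 then \<delta> else 0)) / (real (Suc k))\<^sup>2) =
    (\<lambda>k. (if k = 0 then \<alpha> else 0) + \<beta> * ?s 1 k + \<gamma> * ?s 2 k + \<delta> * ?s 4 k)"
  proof
    fix k
    have 1: "(if odd (Suc k) then \<beta> else 0) / (real (Suc k))\<^sup>2 = \<beta> * ?s 1 k"
      unfolding odd_iff_mod_2_eq_one by simp
    have 2: "(if Suc k mod 4 = 2 then \<gamma> else 0) / (real (Suc k))\<^sup>2 = \<gamma> * ?s 2 k" by simp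
    have 4: "(if Suc k mod 8 = 4 then \<delta> else 0) / (real (Suc k))\<^sup>2 = \<delta> * ?s 4 k" by simp
    have 0: "(if k = 0 then \<alpha> else 0) / (real (Suc k))\<^sup>2 = (if k = 0 then \<alpha> else 0)" by simp
    show "((if k = 0 then \<alpha> else 0) + (if odd (Suc k) then \<beta> else 0) + (if Suc k mod 4 = 2 then \<gamma> else 0) +
      (if Suc k mod 8 = 4 then \<delta> else 0)) / (real (Suc k))\<^sup>2 =
      (if k = 0 then \<alpha> else 0) + \<beta> * ?s 1 k + \<gamma> * ?s 2 k + \<delta> * ?s 4 k"
      unfolding add_divide_distrib 0 1 2 4 ..
  qed
  with sums_add[OF sums_add[OF sums_add[OF a b] c] d] show ?thesis by (simp only:)
qed

lemma cis_pi_4: "cis (pi / 4) ^ 4 = - 1" "cis (pi / 4) ^ 8 = 1" "Re (cis (pi / 4)) = sqrt 2 / 2" "Im (cis (pi / 4)) = sqrt 2 / 2"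
  by (simp_all add: Complex.DeMoivre cos_45 sin_45 complex_eq_iff)

lemma nat_mod_8_cases:
  fixes k :: nat
  obtains "odd k" "k mod 4 \<noteq> 2" "k mod 8 \<noteq> 4" "k mod 8 \<noteq> 0" | "even k" "k mod 4 = 2" "k mod 8 \<noteq> 4" "k mod 8 \<noteq> 0" | "even k" "k mod 8 = 4" "k mod 4 = 0" | "even k" "k mod 8 = 0" "k mod 4 = 0"
proof -
  define r where "r = k mod 8"
  have "r < 8" by (simp add: r_def)
  then have r: "r = 0 \<or> r = 1 \<or> r = 2 \<or> r = 3 \<or> r = 4 \<or> r = 5 \<or> r = 6 \<or> r = 7" by arith
  have "k mod 4 = r mod 4" unfolding r_def by (simp add: mod_mod_cancel)
  moreover have "odd k \<longleftrightarrow> odd r" unfolding r_def by (simp add: dvd_mod_iff)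
  ultimately show ?thesis using r that unfolding r_def[symmetric] by (elim disjE) simp_all
qed

lemma power_mod_8:
  fixes u :: complex
  assumes "u ^ 8 = 1"
  shows "u ^ k = u ^ (k mod 8)"
proof -
  have "u ^ k = u ^ (8 * (k div 8) + k mod 8)" by simp
  also have "\<dots> = u ^ (k mod 8)" by (simp only: power_add power_mult assms power_one mult_1)
  finally show ?thesis .
qed

lemma Re_twisted_mean_chi2_cis:
  assumes "m > 0" "cis (pi / 4) ^ m = 1" "k > 0"
  shows "odd k \<Longrightarrow> - (sqrt 2 / 4) \<le> Re (twisted_mean chi2 (8 * m) (cis (pi / 4)) k)"
    and "k = 1 \<Longrightarrow> Re (twisted_mean chi2 (8 * m) (cis (pi / 4)) k) = sqrt 2 / 4"
    and "k mod 4 = 2 \<Longrightarrow> Re (twisted_mean chi2 (8 * m) (cis (pi / 4)) k) = 0"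
    and "k mod 8 = 4 \<Longrightarrow> Re (twisted_mean chi2 (8 * m) (cis (pi / 4)) k) = - (1 / 2)"
    and "k mod 8 = 0 \<Longrightarrow> Re (twisted_mean chi2 (8 * m) (cis (pi / 4)) k) = 1 / 2"
proof -
  let ?u = "cis (pi / 4)"
  note tm = Re_twisted_mean_chi2[OF assms]
  have uk8: "(?u ^ k) ^ 8 = 1"
  proof -
    have "(?u ^ k) ^ 8 = (?u ^ 8) ^ k" by (simp only: power_mult[symmetric] mult.commute)
    then show ?thesis by (simp add: cis_pi_4)
  qed
  show "- (sqrt 2 / 4) \<le> Re (twisted_mean chi2 (8 * m) ?u k)" if "odd k"
  proof (cases "(?u ^ k) ^ 4 = - 1")
    case True
    have "(?u ^ k)\<^sup>2 \<noteq> 1"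
    proof
      assume "(?u ^ k)\<^sup>2 = 1"
      moreover have "(x\<^sup>2)\<^sup>2 = x ^ 4" for x :: complex by (simp flip: power_mult)
      from this[of "?u ^ k"] have "((?u ^ k)\<^sup>2)\<^sup>2 = (?u ^ k) ^ 4" .
      ultimately have "1\<^sup>2 = - (1 :: complex)" using True by (simp only:)
      then show False by simp
    qed
    with True have "(Re (?u ^ k))\<^sup>2 = 1 / 2" using eighth_root_cases(1)[OF uk8] by auto
    also have "\<dots> = (sqrt 2 / 2)\<^sup>2" by (simp add: power_divide)
    finally have "\<bar>Re (?u ^ k)\<bar> = sqrt 2 / 2" using power2_eq_iff_nonneg[of "\<bar>Re (?u ^ k)\<bar>" "sqrt 2 / 2"] by simp
    then have "- (sqrt 2 / 2) \<le> Re (?u ^ k)" by linarith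
    then show ?thesis unfolding tm using that True by simp
  qed (use tm that in simp)
  show "Re (twisted_mean chi2 (8 * m) ?u k) = sqrt 2 / 4" if "k = 1"
    unfolding tm using that by (simp add: cis_pi_4(1) cos_45)
  show "Re (twisted_mean chi2 (8 * m) ?u k) = 0" if k: "k mod 4 = 2"
  proof -
    have "k = 4 * (k div 4) + 2" using k div_mult_mod_eq[of k 4] by simp
    then obtain j where j: "k = 4 * j + 2" by blast
    have "(x ^ k)\<^sup>2 = (x ^ 8) ^ j * x ^ 4" for x :: complex
      unfolding j power_mult[symmetric] power_add[symmetric] by (rule arg_cong[of _ _ "power x"]) simp
    from this[of ?u] have "(?u ^ k)\<^sup>2 = - 1" by (simp add: cis_pi_4)
    moreover have "even k" by (simp add: j)
    ultimately show ?thesis unfolding tm by simp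
  qed
  show "Re (twisted_mean chi2 (8 * m) ?u k) = - (1 / 2)" if k: "k mod 8 = 4"
  proof -
    have "?u ^ k = - 1" using power_mod_8[OF cis_pi_4(2), of k] k cis_pi_4(1) by simp
    moreover have "even k" using k by (cases k rule: nat_mod_8_cases) auto
    ultimately show ?thesis unfolding tm by simp
  qed
  show "Re (twisted_mean chi2 (8 * m) ?u k) = 1 / 2" if k: "k mod 8 = 0"
  proof -
    have "?u ^ k = 1" using power_mod_8[OF cis_pi_4(2), of k] k by simp
    moreover have "even k" using k by (cases k rule: nat_mod_8_cases) auto
    ultimately show ?thesis unfolding tm by simp
  qed
qed

text \<open>The cases are whether some odd power of \<omega> is a primitive eighth root. If none is,
  \<omega> gets nothing from odd exponents. If one is, then \<omega>^k \<noteq> 1 at every even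
  \<open>k\<close> not divisible by 8, so \<omega> gets nothing positive at the exponents where
  \<open>cis (pi / 4)\<close> has mean 0 or -1/2.\<close>

lemma growth_chi2_less:
  assumes m: "m > 0" "cis (pi / 4) ^ m = 1" "\<omega> ^ m = 1" and ne: "\<omega> \<noteq> cis (pi / 4)" "\<omega> \<noteq> cnj (cis (pi / 4))"
  shows "growth chi2 (8 * m) \<omega> < growth chi2 (8 * m) (cis (pi / 4))"
proof -
  let ?M = "\<lambda>k. Re (twisted_mean chi2 (8 * m) \<omega> k)"
  let ?N = "\<lambda>k. Re (twisted_mean chi2 (8 * m) (cis (pi / 4)) k)"
  have n\<omega>: "norm \<omega> = 1"
    using m by (metis norm_one norm_power power_eq_1_iff norm_ge_zero not_gr0)
  have n0: "norm (cis (pi / 4)) = 1" by simp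
  note tm = Re_twisted_mean_chi2[OF m(1,3)]
  note N = Re_twisted_mean_chi2_cis[OF m(1,2)]
  have s2: "1414 / 1000 \<le> sqrt 2" by (rule real_le_rsqrt) (simp add: power2_eq_square)
  define X where "X = sqrt 2 * odd_squares_sum"
  have X: "X \<le> sqrt 2 * (5 / 4)"
    unfolding X_def by (intro mult_left_mono odd_squares_sum_le) simp
  have even_le: "?M k \<le> 1 / 2" if "even k" "k > 0" for k
  proof -
    have "Re (\<omega> ^ k) \<le> 1" using complex_Re_le_cmod[of "\<omega> ^ k"] n\<omega> by (simp add: norm_power)
    then show ?thesis using tm[OF that(2)] that(1) by simp
  qed
  have even_le_0: "?M k \<le> 0" if "even k" "k > 0" "\<omega> ^ k \<noteq> 1" for k
  proof (cases "(\<omega> ^ k)\<^sup>2 = 1")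
    case True
    then have "\<omega> ^ k = 1 \<or> \<omega> ^ k = - 1" by (simp only: power2_eq_1_iff)
    with that(3) have "\<omega> ^ k = - 1" by blast
    then show ?thesis using tm[OF that(2)] that(1) by simp
  qed (use tm[OF that(2)] that(1) in simp)
  have less: "growth chi2 (8 * m) \<omega> < growth chi2 (8 * m) (cis (pi / 4))"
    if c: "\<And>k. odd k \<Longrightarrow> ?M k + ((if k = 1 then \<alpha> else 0) + \<beta>) \<le> ?N k"
      "\<And>k. k > 0 \<Longrightarrow> even k \<Longrightarrow> k mod 4 = 2 \<Longrightarrow> ?M k + \<gamma> \<le> 0"
      "\<And>k. k > 0 \<Longrightarrow> even k \<Longrightarrow> k mod 8 = 4 \<Longrightarrow> ?M k + \<delta> \<le> - (1 / 2)"
      and pos: "0 < \<alpha> + \<beta> * odd_squares_sum + \<gamma> * (odd_squares_sum / 4) + \<delta> * (odd_squares_sum / 16)"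
    for \<alpha> \<beta> \<gamma> \<delta>
  proof (rule growth_less[OF abs_chi2_le_1 n\<omega> n0 _ chi2_growth_comparison_sums pos])
    fix k
    let ?k = "Suc k"
    show "?M ?k + ((if k = 0 then \<alpha> else 0) + (if odd ?k then \<beta> else 0) + (if ?k mod 4 = 2 then \<gamma> else 0) +
        (if ?k mod 8 = 4 then \<delta> else 0)) \<le> ?N ?k"
    proof (cases ?k rule: nat_mod_8_cases)
      case 1
      then show ?thesis using c(1)[OF 1(1)] by simp
    next
      case 2
      have "k \<noteq> 0" using 2(1) by (cases k) auto
      then show ?thesis using c(2)[OF _ 2(1,2)] N(3)[OF _ 2(2)] 2 by simp
    next
      case 3
      have "k \<noteq> 0" using 3(1) by (cases k) auto
      then show ?thesis using c(3)[OF _ 3(1,2)] N(4)[OF _ 3(2)] 3 by simp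
    next
      case 4
      have "k \<noteq> 0" using 4(1) by (cases k) auto
      then show ?thesis using even_le[OF 4(1)] N(5)[OF _ 4(2)] 4 by simp
    qed
  qed
  show ?thesis
  proof (cases "\<exists>k0. odd k0 \<and> (\<omega> ^ k0) ^ 4 = - 1")
    case False
    have odd0: "?M k = 0" if "odd k" for k
      using tm[of k] that False by (cases "k = 0") auto
    show ?thesis
    \<comment> \<open>The means of \<omega> are 0 at odd and at most 1 / 2 at even exponents. Those
      of \<open>cis (pi / 4)\<close> are at least - sqrt 2 / 4 at odd exponents, sqrt 2 / 4 at
      exponent 1, then 0 and - 1 / 2 on the two even classes. The constants are the differences; the
      total exceeds 0.03.\<close>
    proof (rule less[where \<alpha> = "sqrt 2 / 2" and \<beta> = "- (sqrt 2 / 4)" and \<gamma> = "- (1 / 2)" and \<delta> = "- 1"])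
      show "?M k + ((if k = 1 then sqrt 2 / 2 else 0) + - (sqrt 2 / 4)) \<le> ?N k" if "odd k" for k
        using odd0[OF that] N(1)[OF odd_pos[OF that] that] N(2)[of k] by (cases "k = 1") auto
      show "?M k + - (1 / 2) \<le> 0" if "k > 0" "even k" for k using even_le[OF that(2,1)] by simp
      show "?M k + - 1 \<le> - (1 / 2)" if "k > 0" "even k" for k using even_le[OF that(2,1)] by simp
      have "sqrt 2 / 2 + - (sqrt 2 / 4) * odd_squares_sum + - (1 / 2) * (odd_squares_sum / 4) + - 1 * (odd_squares_sum / 16)
          = sqrt 2 / 2 - X / 4 - odd_squares_sum * (3 / 16)"
        by (simp add: X_def field_simps)
      with X s2 odd_squares_sum_le show "0 < sqrt 2 / 2 + - (sqrt 2 / 4) * odd_squares_sum + - (1 / 2) * (odd_squares_sum / 4) + - 1 * (odd_squares_sum / 16)"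
        by linarith
    qed
  next
    case True
    then obtain k0 where k0: "odd k0" "(\<omega> ^ k0) ^ 4 = - 1" by blast
    let ?u = "\<omega> ^ k0"
    have p4: "(x\<^sup>2)\<^sup>2 = x ^ 4" "(x ^ 4)\<^sup>2 = x ^ 8" for x :: complex by (simp_all flip: power_mult)
    have u8: "?u ^ 8 = 1" using p4(2)[of ?u] k0(2) by simp
    have nr: "\<omega> ^ k \<noteq> 1" if "k mod 4 = 2 \<or> k mod 8 = 4" for k
    proof
      assume "\<omega> ^ k = 1"
      moreover have "?u ^ k = (\<omega> ^ k) ^ k0" by (simp only: power_mult[symmetric] mult.commute)
      ultimately have uk: "?u ^ k = 1" by (simp only: power_one)
      then have "?u ^ (k mod 8) = 1" using power_mod_8[OF u8, of k] by simp
      moreover have "(?u\<^sup>2) ^ k = 1"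
      proof -
        have "(x\<^sup>2) ^ k = (x ^ k)\<^sup>2" for x :: complex by (simp only: power_mult[symmetric] mult.commute)
        from this[of ?u] show ?thesis using uk by simp
      qed
      moreover have "(?u\<^sup>2) ^ k = - 1" if k: "k mod 4 = 2"
      proof -
        have "k = 4 * (k div 4) + 2" using k div_mult_mod_eq[of k 4] by simp
        then obtain j where j: "k = 4 * j + 2" by blast
        have "(x\<^sup>2) ^ k = (x ^ 8) ^ j * x ^ 4" for x :: complex
          unfolding j power_mult[symmetric] power_add[symmetric] by (rule arg_cong[of _ _ "power x"]) simp
        from this[of ?u] show ?thesis using u8 k0(2) by simp
      qed
      ultimately show False using that k0(2) by auto
    qed
    have odd_le: "?M k \<le> sqrt 2 / 4" if "odd k" for k
    proof (cases "(\<omega> ^ k) ^ 4 = - 1")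
      case True
      have "(\<omega> ^ k) ^ 8 = 1" using p4(2)[of "\<omega> ^ k"] True by simp
      moreover have "(\<omega> ^ k)\<^sup>2 \<noteq> 1"
      proof
        assume "(\<omega> ^ k)\<^sup>2 = 1"
        then have "1\<^sup>2 = - (1 :: complex)" using p4(1)[of "\<omega> ^ k"] True by (simp only:)
        then show False by simp
      qed
      ultimately have "(Re (\<omega> ^ k))\<^sup>2 = 1 / 2" using eighth_root_cases(1)[of "\<omega> ^ k"] True by auto
      also have "\<dots> = (sqrt 2 / 2)\<^sup>2" by (simp add: power_divide)
      finally have "Re (\<omega> ^ k) \<le> sqrt 2 / 2" by (rule power2_le_imp_le[OF eq_refl]) simp
      then show ?thesis using tm[OF odd_pos[OF that]] that True by simp
    next
      case False
      then show ?thesis using tm[OF odd_pos[OF that]] that by simp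
    qed
    \<comment> \<open>Among the primitive eighth roots only \<open>cis (pi / 4)\<close> and its
      conjugate have positive real part; this is where \<open>ne\<close> enters.\<close>
    have M1: "?M 1 \<le> 0"
    proof (cases "\<omega> ^ 4 = - 1")
      case True
      have "\<omega> ^ 8 = 1" using p4(2)[of \<omega>] True by simp
      moreover have "\<omega>\<^sup>2 \<noteq> 1"
      proof
        assume "\<omega>\<^sup>2 = 1"
        then have "1\<^sup>2 = - (1 :: complex)" using p4(1)[of \<omega>] True by (simp only:)
        then show False by simp
      qed
      ultimately have "(Re \<omega>)\<^sup>2 = 1 / 2" using eighth_root_cases(1)[of \<omega>] True by auto
      then have R: "(Re \<omega>)\<^sup>2 = (sqrt 2 / 2)\<^sup>2" by (simp add: power_divide)
      have "(Re \<omega>)\<^sup>2 + (Im \<omega>)\<^sup>2 = 1" using n\<omega> cmod_power2[of \<omega>] by simp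
      then have "(Im \<omega>)\<^sup>2 = (sqrt 2 / 2)\<^sup>2" using R by (simp add: power_divide)
      then have I: "Im \<omega> = sqrt 2 / 2 \<or> Im \<omega> = - (sqrt 2 / 2)" by (simp only: power2_eq_iff)
      have "Re \<omega> \<noteq> sqrt 2 / 2" using I ne by (auto simp: complex_eq_iff cos_45 sin_45)
      moreover have "Re \<omega> = sqrt 2 / 2 \<or> Re \<omega> = - (sqrt 2 / 2)" using R by (simp only: power2_eq_iff)
      ultimately have "Re \<omega> = - (sqrt 2 / 2)" by blast
      then show ?thesis using tm[of 1] by simp
    qed (use tm[of 1] in simp)
    show ?thesis
    \<comment> \<open>Now the mean of \<omega> is at most sqrt 2 / 4 at odd exponents, and at most 0
      at exponent 1 and on the classes 2 modulo 4 and 4 modulo 8.\<close>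
    proof (rule less[where \<alpha> = "3 * sqrt 2 / 4" and \<beta> = "- (sqrt 2 / 2)" and \<gamma> = 0 and \<delta> = "- (1 / 2)"])
      show "?M k + ((if k = 1 then 3 * sqrt 2 / 4 else 0) + - (sqrt 2 / 2)) \<le> ?N k" if "odd k" for k
        using odd_le[OF that] M1 N(1)[OF odd_pos[OF that] that] N(2)[of k] by (cases "k = 1") auto
      show "?M k + 0 \<le> 0" if "k > 0" "even k" "k mod 4 = 2" for k using even_le_0[OF that(2,1) nr] that by simp
      show "?M k + - (1 / 2) \<le> - (1 / 2)" if "k > 0" "even k" "k mod 8 = 4" for k using even_le_0[OF that(2,1) nr] that by simp
      have "3 * sqrt 2 / 4 + - (sqrt 2 / 2) * odd_squares_sum + 0 * (odd_squares_sum / 4) + - (1 / 2) * (odd_squares_sum / 16)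
          = 3 * sqrt 2 / 4 - X / 2 - odd_squares_sum / 32"
        by (simp add: X_def field_simps)
      with X s2 odd_squares_sum_le show "0 < 3 * sqrt 2 / 4 + - (sqrt 2 / 2) * odd_squares_sum + 0 * (odd_squares_sum / 4) + - (1 / 2) * (odd_squares_sum / 16)"
        by linarith
    qed
  qed
qed

section \<open>The argument of the generating function for chi2\<close>

lemma lambert_eq_periodic:
  assumes f: "\<And>a. \<bar>f a\<bar> \<le> 1" "f 0 = 0" and T: "T > 0" "\<And>n. f (n + T) = f n" "\<omega> ^ T = 1"
    and q: "0 \<le> q" "q < 1"
  shows "lambert f (Suc k) (\<omega> * of_real q) =
    (\<Sum>n<T. of_int (f n ^ Suc k) * (\<omega> ^ Suc k) ^ n * of_real (q ^ Suc k) ^ n) / (1 - of_real (q ^ Suc k) ^ T)"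
proof -
  have \<omega>: "norm \<omega> = 1"
    using T(1,3) by (metis norm_one norm_power power_eq_1_iff norm_ge_zero not_gr0)
  let ?b = "\<lambda>n. of_int (f n ^ Suc k) * (\<omega> ^ Suc k) ^ n"
  have "(\<lambda>n. ?b n * of_real (q ^ Suc k) ^ n) sums ((\<Sum>n<T. ?b n * of_real (q ^ Suc k) ^ n) / (1 - of_real (q ^ Suc k) ^ T))"
  proof (rule periodic_power_series[OF T(1)])
    have "(\<omega> ^ Suc k) ^ T = (\<omega> ^ T) ^ Suc k" by (simp only: power_mult[symmetric] mult.commute)
    then show "?b (n + T) = ?b n" for n
      unfolding T(2) power_add T(3) power_one by (simp only: mult_1_right)
    show "norm (?b n) \<le> 1" for n
      by (simp only: norm_mult norm_power[of \<omega>] norm_power[of "\<omega> ^ Suc k"] \<omega> power_one mult_1_right norm_of_int_power_le_1 f)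
    show "0 \<le> q ^ Suc k" "q ^ Suc k < 1" using q power_Suc_less_1[of q k] by auto
  qed
  then have "(\<lambda>n. ?b (Suc n) * of_real (q ^ Suc k) ^ Suc n) sums ((\<Sum>n<T. ?b n * of_real (q ^ Suc k) ^ n) / (1 - of_real (q ^ Suc k) ^ T))"
    by (subst sums_Suc_iff) (simp add: f(2))
  moreover have "?b (Suc n) * of_real (q ^ Suc k) ^ Suc n = of_int (f (Suc n) ^ Suc k) * (\<omega> * of_real q) ^ (Suc n * Suc k)" for n
    by (simp only: of_real_power power_mult[symmetric] power_mult_distrib mult.commute[of "Suc k"] mult.assoc)
  ultimately show ?thesis unfolding lambert_def by (simp only: sums_unique[symmetric])
qed

text \<open>For q = e^(-t) this is 1 / (2 k cosh(k t)), which decreases in \<open>k\<close>.\<close>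

definition damped :: "real \<Rightarrow> nat \<Rightarrow> real" where
  "damped q k = q ^ k / (1 + q ^ (2 * k)) / real k"

lemma Im_eighth_root_powers:
  fixes v :: complex
  assumes "v ^ 8 = 1"
  shows "Im (v ^ 5) = - Im (v ^ 3)" "Im (v ^ 7) = - Im v"
    and "v ^ 4 = - 1 \<Longrightarrow> Im (v ^ 3) = Im v" and "v ^ 4 = 1 \<Longrightarrow> Im (v ^ 3) = - Im v"
proof -
  have nv: "norm v = 1" by (rule eighth_root_cases(2)[OF assms])
  have c: "v * cnj v = 1" using nv by (simp add: complex_norm_square[symmetric])
  have "v \<noteq> 0" using nv by auto
  have 8: "v ^ i = e * cnj v ^ j" if "v ^ (i + j) = e" for i j e
  proof -
    have "v ^ i * v ^ j = e * cnj v ^ j * v ^ j"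
      using that c by (simp add: mult.assoc power_mult_distrib[symmetric] mult.commute[of "cnj v"] flip: power_add)
    then show ?thesis using \<open>v \<noteq> 0\<close> by simp
  qed
  show "Im (v ^ 5) = - Im (v ^ 3)" using 8[of 5 3 1] assms by (simp flip: complex_cnj_power)
  show "Im (v ^ 7) = - Im v" using 8[of 7 1 1] assms by simp
  show "Im (v ^ 3) = Im v" if "v ^ 4 = - 1" using 8[of 3 1 "- 1"] that by simp
  show "Im (v ^ 3) = - Im v" if "v ^ 4 = 1" using 8[of 3 1 1] that by simp
qed

text \<open>For both parities the numerator has imaginary part Im v (x - x^3 + x^5 - x^7): at odd
  exponents the signs come from \<open>chi2\<close> and Im v^3 = Im v, at even ones from Im v^3 = -
  Im v. Division by 1 - x^8 leaves x / (1 + x^2).\<close>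

lemma Im_lambert_chi2:
  assumes "0 < q" "q < 1"
  shows "Im (lambert chi2 (Suc k) (cis (pi / 4) * of_real q)) / real (Suc k) =
    Im (cis (pi / 4) ^ Suc k) * damped q (Suc k)"
proof -
  define x where "x = q ^ Suc k"
  define v where "v = cis (pi / 4) ^ Suc k"
  have x: "0 < x" "x < 1" using assms power_Suc_less_1[of q k] by (auto simp: x_def)
  have v8: "v ^ 8 = 1"
  proof -
    have "v ^ 8 = (cis (pi / 4) ^ 8) ^ Suc k" unfolding v_def by (simp only: power_mult[symmetric] mult.commute)
    then show ?thesis by (simp only: cis_pi_4(2) power_one)
  qed
  have v4: "v ^ 4 = (- 1) ^ Suc k"
  proof -
    have "v ^ 4 = (cis (pi / 4) ^ 4) ^ Suc k" unfolding v_def by (simp only: power_mult[symmetric] mult.commute)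
    then show ?thesis by (simp only: cis_pi_4(1))
  qed
  have L: "lambert chi2 (Suc k) (cis (pi / 4) * of_real q) =
    (\<Sum>n<8. of_int (chi2 n ^ Suc k) * v ^ n * of_real x ^ n) / (1 - of_real x ^ 8)"
    unfolding v_def x_def
    by (rule lambert_eq_periodic[OF abs_chi2_le_1 chi2_0 _ chi2_add]) (use assms cis_pi_4(2) in simp_all)
  have N: "Im (\<Sum>n<8. of_int (chi2 n ^ Suc k) * v ^ n * of_real x ^ n) = Im v * (x - x ^ 3 + x ^ 5 - x ^ 7)"
  proof (cases "odd (Suc k)")
    case True
    from True have 3: "Im (v ^ 3) = Im v"
      by (intro Im_eighth_root_powers(3)[OF v8]) (simp only: v4 neg_one_odd_power[OF True])
    have "(\<Sum>n<8. of_int (chi2 n ^ Suc k) * v ^ n * of_real x ^ n) =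
      v * of_real x - v ^ 3 * of_real (x ^ 3) - v ^ 5 * of_real (x ^ 5) + v ^ 7 * of_real (x ^ 7)"
      using True by (simp add: sum_lessThan_8 chi2_power chi2_mod_8 del: power_Suc)
    then have "Im (\<Sum>n<8. of_int (chi2 n ^ Suc k) * v ^ n * of_real x ^ n) =
      Im v * x - Im (v ^ 3) * x ^ 3 - Im (v ^ 5) * x ^ 5 + Im (v ^ 7) * x ^ 7"
      by (simp only: plus_complex.sel minus_complex.sel Im_complex_of_real Re_complex_of_real times_complex.sel mult_zero_right add_0_left)
    then show ?thesis unfolding Im_eighth_root_powers(1,2)[OF v8] 3 by (simp add: algebra_simps)
  next
    case False
    then have "even (Suc k)" by (simp only: not_not)
    then have 3: "Im (v ^ 3) = - Im v"
      by (intro Im_eighth_root_powers(4)[OF v8]) (simp only: v4 neg_one_even_power)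
    have "(\<Sum>n<8. of_int (chi2 n ^ Suc k) * v ^ n * of_real x ^ n) =
      v * of_real x + v ^ 3 * of_real (x ^ 3) + v ^ 5 * of_real (x ^ 5) + v ^ 7 * of_real (x ^ 7)"
      using False by (simp add: sum_lessThan_8 chi2_power del: power_Suc)
    then have "Im (\<Sum>n<8. of_int (chi2 n ^ Suc k) * v ^ n * of_real x ^ n) =
      Im v * x + Im (v ^ 3) * x ^ 3 + Im (v ^ 5) * x ^ 5 + Im (v ^ 7) * x ^ 7"
      by (simp only: plus_complex.sel minus_complex.sel Im_complex_of_real Re_complex_of_real times_complex.sel mult_zero_right add_0_left)
    then show ?thesis unfolding Im_eighth_root_powers(1,2)[OF v8] 3 by (simp add: algebra_simps)
  qed
  have "Im (lambert chi2 (Suc k) (cis (pi / 4) * of_real q)) = Im v * (x - x ^ 3 + x ^ 5 - x ^ 7) / (1 - x ^ 8)"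
  proof -
    have "(1 - of_real x ^ 8 :: complex) = of_real (1 - x ^ 8)" by simp
    then show ?thesis unfolding L by (simp only: Im_divide_of_real N)
  qed
  also have "\<dots> = Im v * (x / (1 + x\<^sup>2))"
  proof -
    have "x ^ 8 < 1" using x power_Suc_less_1[of x 7] by simp
    moreover have "0 < 1 + x\<^sup>2" by (simp add: add_pos_nonneg)
    moreover have "(x - x ^ 3 + x ^ 5 - x ^ 7) * (1 + x\<^sup>2) = x * (1 - x ^ 8)"
      by (simp add: algebra_simps power2_eq_square eval_nat_numeral)
    ultimately have "(x - x ^ 3 + x ^ 5 - x ^ 7) / (1 - x ^ 8) = x / (1 + x\<^sup>2)"
      by (simp add: divide_eq_eq eq_divide_eq)
    then show ?thesis by (simp only: times_divide_eq_right[symmetric])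
  qed
  also have "x\<^sup>2 = q ^ (2 * Suc k)" unfolding x_def by (simp only: power_mult[symmetric] mult.commute)
  finally show ?thesis
    unfolding damped_def v_def[symmetric] x_def[symmetric] by (simp only: times_divide_eq_right)
qed

lemma damped_antimono:
  assumes "0 < q" "q < 1" "0 < i" "i \<le> j"
  shows "damped q j \<le> damped q i"
proof -
  let ?x = "q ^ i" and ?y = "q ^ j"
  have y: "0 < ?y" "?y \<le> ?x" "?x < 1" "0 < ?x"
    using assms by (auto intro: power_decreasing power_less_one_iff[THEN iffD2])
  have "?x * ?y \<le> 1" using y by (intro mult_le_one) auto
  then have "0 \<le> (?x - ?y) * (1 - ?x * ?y)" using y by (intro mult_nonneg_nonneg) auto
  then have "?y * (1 + ?x\<^sup>2) \<le> ?x * (1 + ?y\<^sup>2)" by (simp add: algebra_simps power2_eq_square)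
  moreover have "0 < 1 + ?x\<^sup>2" "0 < 1 + ?y\<^sup>2" by (simp_all add: add_pos_nonneg)
  ultimately have le: "?y / (1 + ?y\<^sup>2) \<le> ?x / (1 + ?x\<^sup>2)"
    by (simp add: divide_le_eq pos_le_divide_eq mult_ac)
  have "0 \<le> ?x / (1 + ?x\<^sup>2)" using y by (intro divide_nonneg_nonneg) auto
  from frac_le[OF this le] have "?y / (1 + ?y\<^sup>2) / real j \<le> ?x / (1 + ?x\<^sup>2) / real i"
    using assms by simp
  then show ?thesis unfolding damped_def by (simp only: power_mult[symmetric] mult.commute)
qed

lemma damped_bounds:
  assumes "0 < q" "q < 1" "0 < k"
  shows "0 \<le> damped q k" "damped q k \<le> 1 / (2 * real k)"
proof -
  have "2 * q ^ k \<le> 1 + (q ^ k)\<^sup>2"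
    using sum_squares_bound[of 1 "q ^ k"] by simp
  then have "q ^ k / (1 + (q ^ k)\<^sup>2) \<le> 1 / 2" by (simp add: divide_le_eq add_pos_nonneg)
  then have "q ^ k / (1 + (q ^ k)\<^sup>2) / real k \<le> 1 / 2 / real k" by (intro divide_right_mono) auto
  then show "damped q k \<le> 1 / (2 * real k)" unfolding damped_def by (simp add: power_mult[symmetric] mult.commute)
  show "0 \<le> damped q k" unfolding damped_def using assms by (simp add: add_pos_nonneg)
qed

lemma Im_cis_pi_4_power:
  "Im (cis (pi / 4) ^ (j * 8 + i)) = (if i mod 8 = 0 \<or> i mod 8 = 4 then 0 else if i mod 8 = 1 \<or> i mod 8 = 3 then sqrt 2 / 2
    else if i mod 8 = 2 then 1 else if i mod 8 = 6 then - 1 else - (sqrt 2 / 2))"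
proof -
  let ?u = "cis (pi / 4)"
  define r where "r = i mod 8"
  have "r < 8" by (simp add: r_def)
  then have r: "r = 0 \<or> r = 1 \<or> r = 2 \<or> r = 3 \<or> r = 4 \<or> r = 5 \<or> r = 6 \<or> r = 7" by arith
  have "(j * 8 + i) mod 8 = r" by (simp add: r_def)
  then have 1: "?u ^ (j * 8 + i) = ?u ^ r" using power_mod_8[OF cis_pi_4(2), of "j * 8 + i"] by simp
  have u: "?u = Complex (sqrt 2 / 2) (sqrt 2 / 2)" by (simp add: complex_eq_iff cos_45 sin_45)
  have s: "sqrt 2 * sqrt 2 = 2" by simp
  have u2: "?u ^ 2 = \<i>" unfolding u by (simp add: power2_eq_square complex_eq_iff)
  have u3: "?u ^ 3 = \<i> * ?u" using u2 by (simp add: power3_eq_cube power2_eq_square)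
  have u5: "?u ^ 5 = - ?u" using cis_pi_4(1) by (simp add: power_Suc2[of _ 4, simplified])
  have u6: "?u ^ 6 = - \<i>" using cis_pi_4(1) u2 power_add[of ?u 4 2] by simp
  have u7: "?u ^ 7 = - (\<i> * ?u)" using cis_pi_4(1) u3 power_add[of ?u 4 3] by simp
  show ?thesis
    unfolding 1 r_def[symmetric] using r u2 u3 u5 u6 u7 cis_pi_4
    by (elim disjE) simp_all
qed

lemma damped_block_sum:
  "(\<Sum>k\<in>{j * 8..<j * 8 + 8}. Im (cis (pi / 4) ^ Suc k) * d (Suc k)) =
    sqrt 2 / 2 * (d (j * 8 + 1) + d (j * 8 + 3) - d (j * 8 + 5) - d (j * 8 + 7)) + (d (j * 8 + 2) - d (j * 8 + 6))"
proof -
  have "(\<Sum>k\<in>{j * 8..<j * 8 + 8}. Im (cis (pi / 4) ^ Suc k) * d (Suc k)) =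
      (\<Sum>i<8. Im (cis (pi / 4) ^ (j * 8 + Suc i)) * d (j * 8 + Suc i))"
    by (simp only: sum.atLeastLessThan_shift_0[of _ "j * 8"] comp_def add_diff_cancel_left' lessThan_atLeast0 add_Suc_right)
  also have "\<dots> = sqrt 2 / 2 * (d (j * 8 + 1) + d (j * 8 + 3) - d (j * 8 + 5) - d (j * 8 + 7)) + (d (j * 8 + 2) - d (j * 8 + 6))"
    unfolding sum_lessThan_8 Im_cis_pi_4_power by (simp add: algebra_simps)
  finally show ?thesis .
qed

text \<open>In blocks of eight the signs of Im(cis(pi/4)^k) are + + + 0 - - - 0, and
  \<open>damped\<close> decreases. So every block is nonnegative, and the first one alone gives the
  lower bound; telescoping over the positive entries gives the upper bound. What matters is that
  sqrt 2 / 3 + 1 / 4 is less than pi / 4.\<close>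

lemma Im_log_gf_chi2_bounds:
  assumes q: "0 < q" "q < 1"
  shows "sqrt 2 * 2 / 5 * damped q 1 \<le> Im (log_gf chi2 (cis (pi / 4) * of_real q))"
    and "Im (log_gf chi2 (cis (pi / 4) * of_real q)) \<le> sqrt 2 / 3 + 1 / 4"
proof -
  let ?z = "cis (pi / 4) * of_real q"
  let ?d = "damped q"
  let ?f = "\<lambda>k. Im (cis (pi / 4) ^ Suc k) * ?d (Suc k)"
  have nz: "norm ?z = q" using q by (simp add: norm_mult)
  have "summable (\<lambda>k. lambert chi2 (Suc k) ?z / of_nat (Suc k))"
    by (rule summable_log_gf[OF abs_chi2_le_1]) (use nz q in simp)
  from sums_Im[OF summable_sums[OF this]]
  have "(\<lambda>k. Im (lambert chi2 (Suc k) ?z / of_nat (Suc k))) sums Im (log_gf chi2 ?z)"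
    unfolding log_gf_def .
  then have "?f sums Im (log_gf chi2 ?z)"
    unfolding Im_divide_of_nat Im_lambert_chi2[OF q] .
  from sums_group[OF this, of 8]
  have S: "(\<lambda>j. \<Sum>k\<in>{j * 8..<j * 8 + 8}. ?f k) sums Im (log_gf chi2 ?z)" by simp
  \<comment> \<open>The positive entries of block \<open>j\<close>. In absolute value the negative
    entries 5, 6, 7 of a block are at least the entries 1, 2, 3 of the next block.\<close>
  let ?B = "\<lambda>j. sqrt 2 / 2 * (?d (j * 8 + 1) + ?d (j * 8 + 3)) + ?d (j * 8 + 2)"
  have anti: "?d b \<le> ?d a" if "0 < a" "a \<le> b" for a b by (rule damped_antimono[OF q that])
  have nn: "0 \<le> (\<Sum>k\<in>{j * 8..<j * 8 + 8}. ?f k)" for j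
    unfolding damped_block_sum
    using anti[of "j * 8 + 1" "j * 8 + 5"] anti[of "j * 8 + 3" "j * 8 + 7"] anti[of "j * 8 + 2" "j * 8 + 6"]
    by (intro add_nonneg_nonneg mult_nonneg_nonneg) auto
  have le: "(\<Sum>k\<in>{j * 8..<j * 8 + 8}. ?f k) \<le> ?B j - ?B (Suc j)" for j
  proof -
    have "sqrt 2 / 2 * (?d (j * 8 + 1) + ?d (j * 8 + 3) - ?d (j * 8 + 5) - ?d (j * 8 + 7)) \<le>
        sqrt 2 / 2 * (?d (j * 8 + 1) + ?d (j * 8 + 3) - ?d (Suc j * 8 + 1) - ?d (Suc j * 8 + 3))"
      using anti[of "j * 8 + 5" "Suc j * 8 + 1"] anti[of "j * 8 + 7" "Suc j * 8 + 3"]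
      by (intro mult_left_mono) auto
    moreover have "?d (Suc j * 8 + 2) \<le> ?d (j * 8 + 6)" by (rule anti) auto
    ultimately show ?thesis unfolding damped_block_sum by (simp add: algebra_simps)
  qed
  have "(\<Sum>j<n. \<Sum>k\<in>{j * 8..<j * 8 + 8}. ?f k) \<le> ?B 0 - ?B n" for n
  proof (induction n)
    case (Suc n)
    then show ?case unfolding sum.lessThan_Suc using le[of n] by linarith
  qed simp
  moreover have "0 \<le> ?B n" for n
    by (intro add_nonneg_nonneg mult_nonneg_nonneg damped_bounds(1)[OF q]) auto
  ultimately have "(\<Sum>j<n. \<Sum>k\<in>{j * 8..<j * 8 + 8}. ?f k) \<le> ?B 0" for n by (smt (verit))
  then have "Im (log_gf chi2 ?z) \<le> ?B 0"
    using S by (intro LIMSEQ_le_const2[of "\<lambda>n. \<Sum>j<n. \<Sum>k\<in>{j * 8..<j * 8 + 8}. ?f k"]) (auto simp only: sums_def)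
  also have "?B 0 \<le> sqrt 2 / 2 * (1 / (2 * real 1) + 1 / (2 * real 3)) + 1 / (2 * real 2)"
    unfolding mult_zero_left add_0_left
    by (intro add_mono mult_left_mono damped_bounds(2)[OF q]) auto
  finally show "Im (log_gf chi2 ?z) \<le> sqrt 2 / 3 + 1 / 4" by simp
  have "(\<Sum>k\<in>{0 * 8..<0 * 8 + 8}. ?f k) \<le> Im (log_gf chi2 ?z)"
    using sum_le_suminf[OF sums_summable[OF S], of "{0}"] nn sums_unique[OF S] by simp
  moreover have "sqrt 2 * 2 / 5 * ?d 1 \<le> (\<Sum>k\<in>{0 * 8..<0 * 8 + 8}. ?f k)"
  proof -
    \<comment> \<open>The function x / (1 + x^2) is no larger at q^5 than at q, and the divisor
      contributes 1 / 5. With \<open>damped q 7 \<le> damped q 3\<close> this leaves 4 / 5 of the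
      first entry.\<close>
    have "?d 5 \<le> ?d 1 / 5"
    proof -
      have "q ^ 5 / (1 + q ^ 10) \<le> q / (1 + q\<^sup>2)"
      proof -
        have y: "0 < q ^ 5" "q ^ 5 \<le> q" using q power_decreasing[of 1 5 q] by auto
        have "q * q ^ 5 \<le> 1" using q y by (intro mult_le_one) auto
        then have "0 \<le> (q - q ^ 5) * (1 - q * q ^ 5)" using y by (intro mult_nonneg_nonneg) auto
        then have "q ^ 5 * (1 + q\<^sup>2) \<le> q * (1 + q ^ 10)" by (simp add: algebra_simps eval_nat_numeral)
        moreover have "0 < 1 + q\<^sup>2" "0 < 1 + q ^ 10" using q by (simp_all add: add_pos_nonneg)
        ultimately show ?thesis by (simp add: divide_le_eq pos_le_divide_eq mult_ac)
      qed
      moreover have "?d 5 = (q ^ 5 / (1 + q ^ 10)) / 5" "?d 1 = q / (1 + q\<^sup>2)"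
        by (simp_all add: damped_def)
      ultimately show ?thesis by (simp only: divide_right_mono zero_le_numeral)
    qed
    then have "sqrt 2 / 2 * (4 / 5 * ?d 1) \<le> sqrt 2 / 2 * (?d 1 + ?d 3 - ?d 5 - ?d 7)"
      using anti[of 3 7] by (intro mult_left_mono) auto
    moreover have "?d 6 \<le> ?d 2" by (rule anti) auto
    ultimately show ?thesis unfolding damped_block_sum unfolding mult_zero_left add_0_left by linarith
  qed
  ultimately show "sqrt 2 * 2 / 5 * ?d 1 \<le> Im (log_gf chi2 ?z)" by (rule order.trans[rotated])
qed

text \<open>Passing to the class of \<open>m + r\<close> modulo \<open>8 * m\<close> avoids the disregarded index \<open>0\<close>.\<close>

lemma vanishes_on_some_AP_refine:
  assumes "vanishes_on_some_AP a"
  obtains m r where "8 dvd m" "r < m" "\<And>n. n mod m = r \<Longrightarrow> a n = 0"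
proof -
  from assms obtain m r where r: "r < m" and z: "\<And>j. m * j + r > 0 \<Longrightarrow> a (m * j + r) = 0"
    unfolding vanishes_on_some_AP_def by auto
  have "a n = 0" if n: "n mod (8 * m) = m + r" for n
  proof -
    have "n mod m = n mod (8 * m) mod m" by (simp add: mod_mod_cancel)
    also have "\<dots> = r" unfolding n using r by simp
    finally have "n = m * (n div m) + r" using div_mult_mod_eq[of n m] by (simp add: mult.commute)
    moreover have "n > 0" using n r by (cases n) auto
    ultimately show ?thesis using z[of "n div m"] by simp
  qed
  moreover have "m + r < 8 * m" using r by simp
  ultimately show ?thesis using that[of "8 * m" "m + r"] by simp
qed

section \<open>Excluding cancellation for chi2\<close>

lemma exponential_growth_contradiction:
  fixes g :: "real \<Rightarrow> real"
  assumes "c > 0" "C' < C" "((\<lambda>t. t * g t) \<longlongrightarrow> C) (at_right 0)"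
    "eventually (\<lambda>t. c * exp (g t) \<le> m * exp (C' / t)) (at_right 0)"
  shows False
proof -
  define D where "D = (C + C') / 2"
  have D: "C' < D" "D < C" using assms(2) by (simp_all add: D_def)
  have "filterlim (\<lambda>t. exp ((D - C') / t)) at_top (at_right 0)"
    using D(1) by real_asymp
  then have "eventually (\<lambda>t. exp ((D - C') / t) > m / c) (at_right 0)"
    by (rule filterlim_at_top_dense[THEN iffD1, rule_format])
  then have "eventually (\<lambda>t :: real. False) (at_right 0)"
    using assms(4) order_tendstoD(1)[OF assms(3) D(2)] eventually_at_right_less[of 0]
  proof eventually_elim
    case (elim t)
    have "D / t \<le> g t" using elim(3,4) by (simp add: pos_divide_le_eq mult.commute)
    then have "c * exp (D / t) \<le> c * exp (g t)" using assms(1) by simp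
    with elim(2) have "c * exp (D / t) \<le> m * exp (C' / t)" by linarith
    moreover have "exp (D / t) = exp ((D - C') / t) * exp (C' / t)"
      by (simp flip: exp_add add: diff_divide_distrib)
    ultimately have "c * exp ((D - C') / t) \<le> m" by simp
    with elim(1) assms(1) show False by (simp add: pos_divide_less_eq mult.commute)
  qed
  then show False by simp
qed

lemma exp_log_gf_cnj:
  assumes f: "\<And>a. \<bar>f a\<bar> \<le> 1" and z: "norm z < 1"
  shows "exp (log_gf f (cnj z)) = cnj (exp (log_gf f z))"
proof -
  have "(\<lambda>n. cnj (of_int (signed_partition_number n f) * z ^ n)) sums cnj (exp (log_gf f z))"
    unfolding sums_cnj by (rule signed_partition_gf[OF f z])
  moreover have "(\<lambda>n. of_int (signed_partition_number n f) * (cnj z) ^ n) sums exp (log_gf f (cnj z))"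
    by (rule signed_partition_gf[OF f]) (use z in simp)
  ultimately show ?thesis by (simp add: sums_iff)
qed

lemma abs_cos_add_quarter_turns:
  "\<bar>cos (x + real e * (pi / 2))\<bar> \<le> max \<bar>cos x\<bar> \<bar>sin x\<bar>"
proof -
  have "\<bar>cos (x + real e * (pi / 2))\<bar> \<le> max \<bar>cos x\<bar> \<bar>sin x\<bar> \<and> \<bar>sin (x + real e * (pi / 2))\<bar> \<le> max \<bar>cos x\<bar> \<bar>sin x\<bar>"
  proof (induction e)
    case (Suc e)
    define y where "y = x + real e * (pi / 2)"
    have "x + real (Suc e) * (pi / 2) = y + pi / 2" by (simp add: y_def algebra_simps)
    then have "cos (x + real (Suc e) * (pi / 2)) = - sin y" "sin (x + real (Suc e) * (pi / 2)) = cos y"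
      by (simp_all only: cos_add sin_add cos_pi_half sin_pi_half mult_zero_right mult_1_right diff_0 add_0_left)
    then show ?case using Suc unfolding y_def[symmetric] by (simp only: abs_minus_cancel simp_thms)
  qed simp
  then show ?thesis by blast
qed

text \<open>Doubling the angle turns eighth turns into quarter turns, which only permute the values
  \<plusminus>cos and \<plusminus>sin of 2 \<theta>. These stay away from 1 in absolute value while
  \<theta> is in a compact part of (0, pi / 4), so (cos x)^2 = (1 + cos(2 x)) / 2 is bounded below
  for all \<open>e\<close> at once.\<close>

lemma abs_cos_add_eighth_turns_lower_bound:
  assumes "0 < \<alpha>" "\<alpha> \<le> \<theta>" "\<theta> \<le> \<beta>" "\<beta> < pi / 4"
  shows "(1 - max (cos (2 * \<alpha>)) (sin (2 * \<beta>))) / 2 \<le> \<bar>cos (\<theta> + real e * (pi / 4))\<bar>"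
proof -
  let ?\<phi> = "\<theta> + real e * (pi / 4)"
  have "cos (2 * \<theta>) \<le> cos (2 * \<alpha>)" by (rule cos_monotone_0_pi_le) (use assms in auto)
  moreover have "0 \<le> cos (2 * \<theta>)" by (rule cos_ge_zero) (use assms in auto)
  moreover have "sin (2 * \<theta>) \<le> sin (2 * \<beta>)" by (rule sin_monotone_2pi_le) (use assms in auto)
  moreover have "0 \<le> sin (2 * \<theta>)" by (rule sin_ge_zero) (use assms in auto)
  moreover have "2 * \<theta> + real e * (pi / 2) = 2 * ?\<phi>" by (simp add: algebra_simps)
  then have "\<bar>cos (2 * ?\<phi>)\<bar> \<le> max \<bar>cos (2 * \<theta>)\<bar> \<bar>sin (2 * \<theta>)\<bar>"
    using abs_cos_add_quarter_turns[of "2 * \<theta>" e] by (simp only:)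
  ultimately have "- cos (2 * ?\<phi>) \<le> max (cos (2 * \<alpha>)) (sin (2 * \<beta>))" by linarith
  then have 1: "(1 - max (cos (2 * \<alpha>)) (sin (2 * \<beta>))) / 2 \<le> (cos ?\<phi>)\<^sup>2"
    unfolding cos_double_cos by simp
  have "(cos ?\<phi>)\<^sup>2 = \<bar>cos ?\<phi>\<bar> * \<bar>cos ?\<phi>\<bar>" by (simp add: power2_eq_square)
  also have "\<dots> \<le> \<bar>cos ?\<phi>\<bar> * 1" by (intro mult_left_mono abs_cos_le_one) simp
  finally show ?thesis using 1 by simp
qed

theorem chi2_not_vanishing:
  "\<not> vanishes_on_some_AP (\<lambda>n. signed_partition_number n chi2)"
proof
  assume "vanishes_on_some_AP (\<lambda>n. signed_partition_number n chi2)"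
  then obtain m r where m: "8 dvd m" "r < m" and z: "\<And>n. n mod m = r \<Longrightarrow> signed_partition_number n chi2 = 0"
    by (rule vanishes_on_some_AP_refine) blast
  \<comment> \<open>Since 8 divides the modulus, both dominant points are among the
    \<open>m\<close>-th roots of unity, at the indices \<open>d\<close> and
    \<open>7 * d\<close>.\<close>
  then obtain d where d: "m = 8 * d" by (elim dvdE)
  have d0: "d > 0" using m d by auto
  let ?\<zeta> = "cis (2 * pi / m)" and ?u = "cis (pi / 4)"
  have \<zeta>d: "?\<zeta> ^ d = ?u" using d0 by (simp add: Complex.DeMoivre d field_simps)
  have um: "?u ^ m = 1" unfolding d power_mult cis_pi_4(2) by simp
  have \<zeta>7d: "?\<zeta> ^ (7 * d) = cnj ?u"
  proof -
    have "?\<zeta> ^ (7 * d) = ?u ^ 7" by (simp only: mult.commute[of 7] power_mult \<zeta>d)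
    also have "\<dots> = cnj ?u * (?u * ?u ^ 7)" by (simp add: cis_cnj cis_mult mult.assoc[symmetric])
    also have "?u * ?u ^ 7 = ?u ^ 8" by (simp flip: power_Suc)
    finally show ?thesis by (simp only: cis_pi_4(2) mult_1_right)
  qed
  have \<zeta>m: "?\<zeta> ^ m = 1" using m by (simp add: Complex.DeMoivre)
  let ?C = "growth chi2 (8 * m) ?u"
  obtain C' where C': "C' < ?C" and ev: "eventually (\<lambda>t. norm (\<Sum>l\<in>{d, 7 * d}. ?\<zeta> ^ (l * (m - r)) *
        exp (log_gf chi2 (?\<zeta> ^ l * of_real (exp (- t))))) \<le> real m * exp (C' / t)) (at_right 0)"
  proof (rule dominant_terms_cancel[where f = chi2 and P = 8 and m = m and r = r and D = "{d, 7 * d}" and C = ?C])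
    show "{d, 7 * d} \<subseteq> {..<m}" using d d0 by auto
    show "growth chi2 (8 * m) (?\<zeta> ^ l) < ?C" if l: "l < m" "l \<notin> {d, 7 * d}" for l
    proof (rule growth_chi2_less[OF _ um])
      show "m > 0" using m by simp
      have "(?\<zeta> ^ l) ^ m = (?\<zeta> ^ m) ^ l" by (simp only: power_mult[symmetric] mult.commute)
      then show "(?\<zeta> ^ l) ^ m = 1" by (simp only: \<zeta>m power_one)
      show "?\<zeta> ^ l \<noteq> ?u" using cis_root_power_inj[of l m d] l d d0 \<zeta>d by auto
      show "?\<zeta> ^ l \<noteq> cnj ?u" using cis_root_power_inj[of l m "7 * d"] l d d0 \<zeta>7d by auto
    qed
  qed (use abs_chi2_le_1 chi2_0 chi2_add m z in auto)
  let ?L = "\<lambda>t. log_gf chi2 (?u * of_real (exp (- t)))"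
  \<comment> \<open>The factor 1 / 4 is a value below the limit 1 / 2 of
    \<open>damped (exp (- t)) 1\<close>, so \<alpha> bounds the argument from below for small
    \<open>t\<close>.\<close>
  define \<alpha> where "\<alpha> = sqrt 2 * 2 / 5 * (1 / 4)"
  define \<beta> where "\<beta> = sqrt 2 / 3 + 1 / 4"
  define c where "c = (1 - max (cos (2 * \<alpha>)) (sin (2 * \<beta>))) / 2"
  have pi3: "pi > 3" by (rule pi_gt3)
  have s2: "sqrt 2 < 1415 / 1000" by (rule real_less_lsqrt) (simp_all add: power2_eq_square)
  have \<alpha>: "0 < \<alpha>" by (simp add: \<alpha>_def)
  have \<beta>: "0 < \<beta>" "\<beta> < pi / 4" using pi3 s2 by (simp_all add: \<beta>_def add_pos_pos)
  have "\<alpha> < pi / 4" using pi3 s2 by (simp add: \<alpha>_def)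
  have c: "c > 0"
  proof -
    have "cos (2 * \<alpha>) < cos 0" by (rule cos_monotone_0_pi) (use \<alpha> \<open>\<alpha> < pi / 4\<close> in auto)
    moreover have "sin (2 * \<beta>) < sin (pi / 2)" by (rule sin_monotone_2pi) (use \<beta> in auto)
    ultimately show ?thesis by (simp add: c_def)
  qed
  have "((\<lambda>t. damped (exp (- t)) 1) \<longlongrightarrow> 1 / 2) (at_right 0)"
    unfolding damped_def by real_asymp
  then have "eventually (\<lambda>t. damped (exp (- t)) 1 > 1 / 4) (at_right 0)"
    by (rule order_tendstoD) simp
  then have "eventually (\<lambda>t. 2 * c * exp (Re (?L t)) \<le> real m * exp (C' / t)) (at_right 0)"
    using ev eventually_at_right_less[of 0]
  proof eventually_elim
    case (elim t)
    let ?q = "exp (- t)"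
    have q: "0 < ?q" "?q < 1" using elim(3) by auto
    let ?e = "m - r"
    let ?\<theta> = "Im (?L t)"
    have "\<alpha> \<le> sqrt 2 * 2 / 5 * damped ?q 1"
      unfolding \<alpha>_def using elim(1) by (intro mult_left_mono) auto
    also have "\<dots> \<le> ?\<theta>" by (rule Im_log_gf_chi2_bounds(1)[OF q])
    finally have "\<alpha> \<le> ?\<theta>" .
    moreover have "?\<theta> \<le> \<beta>" using Im_log_gf_chi2_bounds(2)[OF q] unfolding \<beta>_def .
    ultimately have cb: "c \<le> \<bar>cos (?\<theta> + real ?e * (pi / 4))\<bar>"
      unfolding c_def using \<alpha> \<beta> by (intro abs_cos_add_eighth_turns_lower_bound) auto
    have cj: "exp (log_gf chi2 (cnj ?u * of_real ?q)) = cnj (exp (?L t))"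
      using exp_log_gf_cnj[where f = chi2 and z = "?u * of_real ?q", OF abs_chi2_le_1] q by (simp add: norm_mult)
    let ?w = "?u ^ ?e * exp (?L t)"
    have p1: "?\<zeta> ^ (d * ?e) = ?u ^ ?e" by (simp only: power_mult \<zeta>d)
    have p2: "?\<zeta> ^ (7 * d * ?e) = cnj ?u ^ ?e" by (simp only: power_mult[of _ "7 * d"] \<zeta>7d)
    have "(\<Sum>l\<in>{d, 7 * d}. ?\<zeta> ^ (l * ?e) * exp (log_gf chi2 (?\<zeta> ^ l * of_real ?q))) =
        ?\<zeta> ^ (d * ?e) * exp (log_gf chi2 (?\<zeta> ^ d * of_real ?q)) +
        ?\<zeta> ^ (7 * d * ?e) * exp (log_gf chi2 (?\<zeta> ^ (7 * d) * of_real ?q))"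
      using d0 by (subst sum.insert) auto
    \<comment> \<open>Conjugate points give conjugate terms, so the sum is twice a real part, whose
      phase is the argument of the generating function plus a multiple of pi / 4.\<close>
    also have "\<dots> = ?w + cnj ?w"
      unfolding p1 p2 \<zeta>d \<zeta>7d cj by (simp only: complex_cnj_mult complex_cnj_power)
    also have "\<dots> = of_real (2 * Re ?w)" by (rule complex_add_cnj)
    finally have "norm (of_real (2 * Re ?w) :: complex) \<le> real m * exp (C' / t)"
      using elim(2) by (simp only:)
    then have "2 * \<bar>Re ?w\<bar> \<le> real m * exp (C' / t)"
      by (simp only: norm_of_real abs_mult abs_numeral)
    moreover have "Re ?w = exp (Re (?L t)) * cos (?\<theta> + real ?e * (pi / 4))"
    proof -
      have "?w = of_real (exp (Re (?L t))) * (cis ?\<theta> * cis (real ?e * (pi / 4)))"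
        unfolding exp_eq_polar[of "?L t"] Complex.DeMoivre by (simp add: mult_ac)
      then show ?thesis by (simp only: cis_mult) simp
    qed
    ultimately have "2 * (exp (Re (?L t)) * \<bar>cos (?\<theta> + real ?e * (pi / 4))\<bar>) \<le> real m * exp (C' / t)"
      by (simp only: abs_mult abs_exp_cancel)
    moreover have "exp (Re (?L t)) * c \<le> exp (Re (?L t)) * \<bar>cos (?\<theta> + real ?e * (pi / 4))\<bar>"
      using cb by (intro mult_left_mono) auto
    ultimately show ?case by (simp only: mult.assoc mult.commute[of c])
  qed
  moreover have "((\<lambda>t. t * Re (?L t)) \<longlongrightarrow> ?C) (at_right 0)"
  proof (rule log_gf_asymptotic[where f = chi2, OF abs_chi2_le_1 chi2_0])
    show "0 < 8 * m" using m by simp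
    have "chi2 (n + j * 8) = chi2 n" for n j
      by (simp only: chi2_mod_8 mod_mult_self1)
    then show "chi2 (n + 8 * m) = chi2 n" for n by (simp only: mult.commute)
    show "?u ^ (8 * m) = 1" by (simp only: mult.commute[of 8] power_mult um power_one)
  qed
  ultimately show False
    using c by (intro exponential_growth_contradiction[of "2 * c", OF _ C']) simp_all
qed

section \<open>The odd character sum\<close>

lemma artanh_sums:
  fixes x :: real
  assumes "\<bar>x\<bar> < 1"
  shows "(\<lambda>i. x ^ (2 * i + 1) / real (2 * i + 1)) sums artanh x"
proof -
  have "(\<lambda>n. - ((- x) ^ n) / of_nat n - - ((- (- x)) ^ n) / of_nat n) sums (ln (1 + x) - ln (1 + - x))"
    by (intro sums_diff ln_series') (use assms in auto)
  then have "(\<lambda>n. (- ((- x) ^ n) / of_nat n - - ((- (- x)) ^ n) / of_nat n) / 2) sums ((ln (1 + x) - ln (1 + - x)) / 2)"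
    by (rule sums_divide)
  moreover have "(ln (1 + x) - ln (1 + - x)) / 2 = artanh x"
  proof -
    have "0 < 1 + x" "0 < 1 - x" using assms by auto
    then show ?thesis by (simp add: artanh_def ln_div)
  qed
  moreover have "(\<lambda>n. (- ((- x) ^ n) / of_nat n - - ((- (- x)) ^ n) / of_nat n) / 2) =
      (\<lambda>n. if odd n then x ^ n / real n else 0)"
    by (rule ext) (auto simp: add_divide_distrib[symmetric])
  ultimately have "(\<lambda>n. if odd n then x ^ n / real n else 0) sums artanh x" by simp
  moreover have "strict_mono (\<lambda>i::nat. 2 * i + 1)" by (intro strict_monoI) simp
  moreover have "(if odd n then x ^ n / real n else 0) = 0" if "n \<notin> range (\<lambda>i. 2 * i + 1)" for n
    using that by (auto elim!: oddE)
  ultimately have "(\<lambda>i. if odd (2 * i + 1) then x ^ (2 * i + 1) / real (2 * i + 1) else 0) sums artanh x"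
    by (subst sums_mono_reindex)
  then show ?thesis by simp
qed

lemma lambert_uminus_even: "even k \<Longrightarrow> lambert f k (- z) = lambert f k z"
  by (simp add: lambert_def)

context
  fixes p :: nat
  assumes p: "prime p" "2 < p"
begin

definition character_series :: "real \<Rightarrow> real" where
  "character_series x = (\<Sum>n<p. of_int (chi p n) * x ^ n) / (1 - x ^ p)"

lemma character_series_sums:
  assumes "0 \<le> x" "x < 1"
  shows "(\<lambda>n. of_int (chi p n) * x ^ n) sums character_series x"
proof -
  have "(\<lambda>n. of_int (chi p n) * of_real x ^ n) sums ((\<Sum>n<p. of_int (chi p n) * of_real x ^ n) / (1 - of_real x ^ p :: complex))"
    by (rule periodic_power_series) (use p assms chi_add[OF p] norm_of_int_power_le_1[OF abs_chi_le_1, of p _ 1] in simp_all)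
  also have "((\<Sum>n<p. of_int (chi p n) * of_real x ^ n) / (1 - of_real x ^ p :: complex)) = of_real (character_series x)"
    by (simp add: character_series_def)
  also have "(\<lambda>n. of_int (chi p n) * of_real x ^ n) = (\<lambda>n. complex_of_real (of_int (chi p n) * x ^ n))"
    by simp
  finally show ?thesis by (simp only: sums_of_real_iff)
qed

lemma abs_character_series_le:
  assumes "0 \<le> x" "x < 1"
  shows "\<bar>character_series x\<bar> \<le> x / (1 - x)"
proof -
  have "(\<lambda>n. of_int (chi p (Suc n)) * x ^ Suc n) sums character_series x"
    using character_series_sums[OF assms] by (subst sums_Suc_iff) (simp add: chi_0)
  moreover have "norm (of_int (chi p (Suc n)) * x ^ Suc n) \<le> x ^ Suc n" for n
  proof -
    have "\<bar>of_int (chi p (Suc n)) :: real\<bar> \<le> 1" using abs_chi_le_1[of p "Suc n"] by linarith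
    then show ?thesis
      using mult_right_mono[of "\<bar>of_int (chi p (Suc n)) :: real\<bar>" 1 "x ^ Suc n"] assms
      by (simp only: real_norm_def abs_mult abs_of_nonneg zero_le_power mult_1_left)
  qed
  ultimately have "norm (character_series x) \<le> (\<Sum>n. x ^ Suc n)"
    using norm_suminf_le[of "\<lambda>n. of_int (chi p (Suc n)) * x ^ Suc n" "\<lambda>n. x ^ Suc n"]
      geometric_Suc_sums[OF assms] by (simp only: sums_iff)
  then show ?thesis using geometric_Suc_sums[OF assms] by (simp only: sums_iff real_norm_def)
qed

lemma chi_power_odd: "odd k \<Longrightarrow> chi p n ^ k = chi p n"
  using abs_chi_le_1[of p n] by (cases "chi p n = 1"; cases "chi p n = - 1"; cases "chi p n = 0") (auto simp: odd_pos)

text \<open>At the negative argument even indices keep their sign and odd ones change it, so the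
  series is twice its even part minus the whole. Multiplicativity pulls \<open>chi p 2\<close> out
  of the even part and squares the variable.\<close>

lemma lambert_chi_odd:
  assumes "0 \<le> x" "x < 1" "odd k"
  shows "lambert (chi p) k (of_real x) = of_real (character_series (x ^ k))"
    and "lambert (chi p) k (- of_real x) = of_real (2 * of_int (chi p 2) * character_series (x ^ (2 * k)) - character_series (x ^ k))"
proof -
  let ?y = "x ^ k"
  have k: "k > 0" by (rule odd_pos[OF assms(3)])
  have y: "0 \<le> ?y" "?y < 1" using assms(1,2) k power_Suc_less_1[of x "k - 1"] by auto
  have y2: "0 \<le> x ^ (2 * k)" "x ^ (2 * k) < 1"
    using assms(1,2) k power_Suc_less_1[of x "2 * k - 1"] by auto
  have a: "(\<lambda>n. of_int (chi p n) * ?y ^ n) sums character_series ?y"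
    by (rule character_series_sums[OF y])
  then have "(\<lambda>n. of_int (chi p (Suc n)) * ?y ^ Suc n) sums character_series ?y"
    by (subst sums_Suc_iff) (simp add: chi_0)
  then have "(\<lambda>n. complex_of_real (of_int (chi p (Suc n)) * ?y ^ Suc n)) sums of_real (character_series ?y)"
    by (simp only: sums_of_real_iff)
  moreover have "complex_of_real (of_int (chi p (Suc n)) * ?y ^ Suc n) = of_int (chi p (Suc n) ^ k) * of_real x ^ (Suc n * k)" for n
    unfolding chi_power_odd[OF assms(3)]
    by (simp only: of_real_mult of_real_of_int_eq of_real_power power_mult[symmetric] mult.commute)
  ultimately show "lambert (chi p) k (of_real x) = of_real (character_series ?y)"
    unfolding lambert_def by (simp only: sums_unique[symmetric])
  have "(\<lambda>j. of_int (chi p 2) * (of_int (chi p j) * (x ^ (2 * k)) ^ j)) sums (of_int (chi p 2) * character_series (x ^ (2 * k)))"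
    by (intro sums_mult character_series_sums y2)
  moreover have "of_int (chi p 2) * (of_int (chi p j) * (x ^ (2 * k)) ^ j) = of_int (chi p (2 * j)) * ?y ^ (2 * j)" for j
    unfolding chi_mult[OF p] by (simp only: power_mult[symmetric] of_int_mult ac_simps)
  ultimately have "(\<lambda>j. if even (2 * j) then of_int (chi p (2 * j)) * ?y ^ (2 * j) else 0) sums (of_int (chi p 2) * character_series (x ^ (2 * k)))"
    by simp
  moreover have "strict_mono (\<lambda>i::nat. 2 * i)" by (intro strict_monoI) simp
  moreover have "(if even n then of_int (chi p n) * ?y ^ n else 0) = 0" if "n \<notin> range (\<lambda>i. 2 * i)" for n
    using that by (auto elim!: evenE)
  ultimately have e: "(\<lambda>n. if even n then of_int (chi p n) * ?y ^ n else 0) sums (of_int (chi p 2) * character_series (x ^ (2 * k)))"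
    by (subst (asm) sums_mono_reindex)
  have "(\<lambda>n. 2 * (if even n then of_int (chi p n) * ?y ^ n else 0) - of_int (chi p n) * ?y ^ n) sums
      (2 * (of_int (chi p 2) * character_series (x ^ (2 * k))) - character_series ?y)"
    by (intro sums_diff sums_mult e a)
  moreover have "2 * (if even n then of_int (chi p n) * ?y ^ n else 0) - of_int (chi p n) * ?y ^ n = of_int (chi p n) * (- ?y) ^ n" for n
    by (cases "even n") simp_all
  ultimately have "(\<lambda>n. of_int (chi p n) * (- ?y) ^ n) sums
      (2 * of_int (chi p 2) * character_series (x ^ (2 * k)) - character_series ?y)" by (simp only: mult.assoc)
  then have "(\<lambda>n. of_int (chi p (Suc n)) * (- ?y) ^ Suc n) sums
      (2 * of_int (chi p 2) * character_series (x ^ (2 * k)) - character_series ?y)"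
    by (subst sums_Suc_iff) (simp add: chi_0)
  then have "(\<lambda>n. complex_of_real (of_int (chi p (Suc n)) * (- ?y) ^ Suc n)) sums
      of_real (2 * of_int (chi p 2) * character_series (x ^ (2 * k)) - character_series ?y)"
    by (simp only: sums_of_real_iff)
  moreover have "complex_of_real (of_int (chi p (Suc n)) * (- ?y) ^ Suc n) = of_int (chi p (Suc n) ^ k) * (- of_real x) ^ (Suc n * k)" for n
    unfolding chi_power_odd[OF assms(3)] mult.commute[of "Suc n"] power_mult power_minus_odd[OF assms(3)]
    by (simp only: of_real_mult of_real_of_int_eq of_real_power of_real_minus)
  ultimately show "lambert (chi p) k (- of_real x) = of_real (2 * of_int (chi p 2) * character_series (x ^ (2 * k)) - character_series ?y)"
    unfolding lambert_def by (simp only: sums_unique[symmetric])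
qed

text \<open>At \<open>q = exp (- t)\<close> this is \<tau>(t) of the overview; replacing
  \<open>q\<close> by its square gives \<tau>(2 t).\<close>

definition odd_character_sum :: "real \<Rightarrow> real" where
  "odd_character_sum q = (\<Sum>i. character_series (q ^ (2 * i + 1)) / real (2 * i + 1))"

lemma odd_character_sum_sums:
  assumes "0 < q" "q < 1"
  shows "(\<lambda>i. character_series (q ^ (2 * i + 1)) / real (2 * i + 1)) sums odd_character_sum q"
proof -
  have "summable (\<lambda>i. character_series (q ^ (2 * i + 1)) / real (2 * i + 1))"
  proof (rule summable_comparison_test'[where N = 0])
    show "summable (\<lambda>i. q ^ Suc i / (1 - q))"
      using geometric_Suc_sums[of q] assms by (intro summable_divide sums_summable) auto
    show "norm (character_series (q ^ (2 * i + 1)) / real (2 * i + 1)) \<le> q ^ Suc i / (1 - q)" for i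
    proof -
      let ?x = "q ^ (2 * i + 1)"
      have x: "0 \<le> ?x" "?x < 1" using power_Suc_less_1[of q "2 * i"] assms by auto
      have "norm (character_series ?x / real (2 * i + 1)) \<le> \<bar>character_series ?x\<bar>"
        using divide_left_mono[of 1 "real (2 * i + 1)" "\<bar>character_series ?x\<bar>"] by simp
      also have "\<dots> \<le> ?x / (1 - ?x)" by (rule abs_character_series_le[OF x])
      also have "\<dots> \<le> q ^ Suc i / (1 - q)"
        using assms power_decreasing[of 1 "2 * i + 1" q] power_decreasing[of "Suc i" "2 * i + 1" q] by (intro frac_le) auto
      finally show ?thesis .
    qed
  qed
  then show ?thesis unfolding odd_character_sum_def by (rule summable_sums)
qed

text \<open>Even exponents agree at z and -z and drop out. At an odd exponent \<open>k\<close> the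
  two values in \<open>lambert_chi_odd\<close> differ by twice \<open>character_series (q ^ k) -
  of_int (chi p 2) * character_series (q ^ (2 * k))\<close>.\<close>

lemma log_gf_chi_difference:
  assumes q: "0 < q" "q < 1"
  shows "log_gf (chi p) (of_real q) - log_gf (chi p) (- of_real q) =
    of_real (2 * (odd_character_sum q - of_int (chi p 2) * odd_character_sum (q\<^sup>2)))"
proof -
  have n: "norm (complex_of_real q) < 1" "norm (- complex_of_real q) < 1" using q by simp_all
  let ?a = "\<lambda>k. lambert (chi p) k (of_real q) / of_nat k - lambert (chi p) k (- of_real q) / of_nat k"
  have "(\<lambda>k. ?a (Suc k)) sums (log_gf (chi p) (of_real q) - log_gf (chi p) (- of_real q))"
    unfolding log_gf_def by (intro sums_diff summable_sums summable_log_gf abs_chi_le_1 n)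
  moreover have "strict_mono (\<lambda>i::nat. 2 * i)" by (intro strict_monoI) simp
  moreover have "?a (Suc k) = 0" if "k \<notin> range (\<lambda>i. 2 * i)" for k
  proof -
    have "even (Suc k)" using that by (auto elim!: evenE)
    then show ?thesis by (simp only: lambert_uminus_even diff_self)
  qed
  ultimately have s: "(\<lambda>i. ?a (Suc (2 * i))) sums (log_gf (chi p) (of_real q) - log_gf (chi p) (- of_real q))"
    by (subst sums_mono_reindex)
  have q2: "0 < q\<^sup>2" "q\<^sup>2 < 1" using q power_Suc_less_1[of q 1] by (auto simp: power2_eq_square)
  let ?T = "\<lambda>q i. character_series (q ^ (2 * i + 1)) / real (2 * i + 1)"
  have "(\<lambda>i. 2 * (?T q i - of_int (chi p 2) * ?T (q\<^sup>2) i)) sums (2 * (odd_character_sum q - of_int (chi p 2) * odd_character_sum (q\<^sup>2)))"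
    by (intro sums_mult sums_diff odd_character_sum_sums q q2)
  then have "(\<lambda>i. complex_of_real (2 * (?T q i - of_int (chi p 2) * ?T (q\<^sup>2) i))) sums
      of_real (2 * (odd_character_sum q - of_int (chi p 2) * odd_character_sum (q\<^sup>2)))"
    by (simp only: sums_of_real_iff)
  moreover have "complex_of_real (2 * (?T q i - of_int (chi p 2) * ?T (q\<^sup>2) i)) = ?a (Suc (2 * i))" for i
  proof -
    have o: "odd (2 * i + 1)" by simp
    have e: "(q\<^sup>2) ^ (2 * i + 1) = q ^ (2 * (2 * i + 1))" by (simp only: power_mult[symmetric])
    have "?a (2 * i + 1) = of_real (character_series (q ^ (2 * i + 1)) / real (2 * i + 1) -
      (2 * of_int (chi p 2) * character_series (q ^ (2 * (2 * i + 1))) - character_series (q ^ (2 * i + 1))) / real (2 * i + 1))"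
      using q unfolding lambert_chi_odd[OF less_imp_le[OF q(1)] q(2) o]
      by (simp only: of_real_diff of_real_divide of_real_of_nat_eq)
    also have "\<dots> = of_real (2 * (?T q i - of_int (chi p 2) * ?T (q\<^sup>2) i))"
      unfolding e by (rule arg_cong[of _ _ of_real]) (simp add: diff_divide_distrib algebra_simps)
    finally show ?thesis by (simp only: Suc_eq_plus1)
  qed
  ultimately show ?thesis using s by (simp only: sums_unique2)
qed

end

section \<open>Logarithmic divergence of the odd character sum\<close>

lemma power_linear_remainder:
  fixes x :: real
  assumes "0 \<le> x" "x \<le> 1"
  shows "0 \<le> x ^ m - 1 + real m * (1 - x)" "x ^ m - 1 + real m * (1 - x) \<le> (real m)\<^sup>2 * (1 - x)\<^sup>2"
proof (induction m)
  case (Suc m)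
  have e: "x ^ Suc m - 1 + real (Suc m) * (1 - x) = x * (x ^ m - 1 + real m * (1 - x)) + real m * (1 - x)\<^sup>2"
    by (simp add: algebra_simps power2_eq_square)
  {
    case 1
    show ?case unfolding e
      by (rule add_nonneg_nonneg[OF mult_nonneg_nonneg[OF assms(1) Suc(1)]]) simp
  next
    case 2
    have "x * (x ^ m - 1 + real m * (1 - x)) \<le> 1 * ((real m)\<^sup>2 * (1 - x)\<^sup>2)"
      by (rule mult_mono) (use Suc assms in auto)
    moreover have "(real m)\<^sup>2 * (1 - x)\<^sup>2 + real m * (1 - x)\<^sup>2 \<le> (real (Suc m))\<^sup>2 * (1 - x)\<^sup>2"
      unfolding distrib_right[symmetric]
    proof (rule mult_right_mono)
      show "(real m)\<^sup>2 + real m \<le> (real (Suc m))\<^sup>2" by (simp add: power2_eq_square algebra_simps)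
    qed simp
    ultimately show ?case unfolding e by linarith
  }
qed auto

text \<open>Along t0 / 2^j each halving increases |\<tau>| by at most the new argument, and these
  increments add up to less than \<open>t0\<close>. The condition on \<open>e\<close> covers both
  signs of \<open>chi p 2\<close>.\<close>

lemma dyadic_almost_invariant_bounded:
  fixes \<tau> :: "real \<Rightarrow> real"
  assumes "0 < t0" "\<And>t. 0 < t \<Longrightarrow> t < t0 \<Longrightarrow> \<bar>\<tau> t - e * \<tau> (2 * t)\<bar> \<le> t" "\<bar>e\<bar> \<le> 1"
  shows "\<not> filterlim (\<lambda>t. \<bar>\<tau> t\<bar>) at_top (at_right 0)"
proof
  assume lim: "filterlim (\<lambda>t. \<bar>\<tau> t\<bar>) at_top (at_right 0)"
  have bound: "\<bar>\<tau> (t0 / 2 ^ j)\<bar> \<le> \<bar>\<tau> t0\<bar> + t0 * (1 - 1 / 2 ^ j)" for j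
  proof (induction j)
    case (Suc j)
    let ?t = "t0 / 2 ^ Suc j"
    have "(1 :: real) < 2 ^ Suc j" by (rule one_less_power) simp_all
    then have "?t < t0" using assms(1) by (simp add: divide_less_eq)
    moreover have "0 < ?t" using assms(1) by simp
    ultimately have "\<bar>\<tau> ?t - e * \<tau> (2 * ?t)\<bar> \<le> ?t" by (intro assms(2))
    moreover have "2 * ?t = t0 / 2 ^ j" by simp
    ultimately have "\<bar>\<tau> ?t - e * \<tau> (t0 / 2 ^ j)\<bar> \<le> ?t" by (simp only:)
    moreover have "\<bar>e * \<tau> (t0 / 2 ^ j)\<bar> \<le> \<bar>\<tau> (t0 / 2 ^ j)\<bar>"
      using mult_right_mono[OF assms(3), of "\<bar>\<tau> (t0 / 2 ^ j)\<bar>"] by (simp add: abs_mult)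
    ultimately have "\<bar>\<tau> ?t\<bar> \<le> \<bar>\<tau> (t0 / 2 ^ j)\<bar> + ?t" by linarith
    also have "\<dots> \<le> \<bar>\<tau> t0\<bar> + t0 * (1 - 1 / 2 ^ j) + ?t" using Suc.IH by linarith
    also have "\<dots> = \<bar>\<tau> t0\<bar> + t0 * (1 - 1 / 2 ^ Suc j)" by (simp add: field_simps)
    finally show ?case .
  qed simp
  have "filterlim (\<lambda>j. t0 / 2 ^ j) (at_right 0) sequentially"
    using assms(1) by real_asymp
  from filterlim_compose[OF lim this] have "filterlim (\<lambda>j. \<bar>\<tau> (t0 / 2 ^ j)\<bar>) at_top sequentially" .
  then have "eventually (\<lambda>j. \<bar>\<tau> (t0 / 2 ^ j)\<bar> > \<bar>\<tau> t0\<bar> + t0) sequentially"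
    by (rule filterlim_at_top_dense[THEN iffD1, rule_format])
  then obtain j where "\<bar>\<tau> (t0 / 2 ^ j)\<bar> > \<bar>\<tau> t0\<bar> + t0" by (auto simp: eventually_sequentially)
  moreover have "t0 * (1 - 1 / 2 ^ j) \<le> t0 * 1" using assms(1) by (intro mult_left_mono) auto
  ultimately show False using bound[of j] by linarith
qed

context
  fixes p :: nat
  assumes p: "prime p" "2 < p"
begin

text \<open>By \<open>sum0\<close> the numerator and the denominator of
  \<open>character_series\<close> both vanish at 1, and \<open>h\<close> is the quotient of their
  derivatives. The comparison is with \<open>h * x\<close>, and the error keeps a factor x, so that
  both can be summed over the odd powers of \<open>q\<close>.\<close>

lemma character_series_near_one:
  assumes sum0: "(\<Sum>n<p. chi p n) = 0"
  defines "h \<equiv> - (\<Sum>n<p. of_int (chi p n) * real n) / p"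
  obtains C where "\<And>x. 0 \<le> x \<Longrightarrow> x < 1 \<Longrightarrow> \<bar>character_series p x - h * x\<bar> \<le> C * (x * (1 - x))"
proof -
  let ?R = "\<lambda>m x. x ^ m - 1 + real m * (1 - x) :: real"
  define C where "C = (\<Sum>n<p. (real n)\<^sup>2) + \<bar>h\<bar> * (real p)\<^sup>2"
  have s0: "(\<Sum>n<p. of_int (chi p n) :: real) = 0" using sum0 by (simp flip: of_int_sum)
  have "\<bar>character_series p x - h * x\<bar> \<le> C * (x * (1 - x))" if x: "0 \<le> x" "x < 1" for x
  proof -
    let ?d = "1 - x"
    \<comment> \<open>Expansion of x^(n - 1) at 1 after taking out one factor x. At n = 0, where the
      subtraction is truncated, both sides vanish because \<open>chi p 0 = 0\<close>.\<close>
    have t: "of_int (chi p n) * x ^ n = x * (of_int (chi p n) * (1 + ?d) - of_int (chi p n) * real n * ?d + of_int (chi p n) * ?R (n - 1) x)" for n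
    proof (cases n)
      case (Suc m)
      then show ?thesis by (simp add: algebra_simps)
    qed (simp add: chi_0)
    have "(\<Sum>n<p. of_int (chi p n) * x ^ n) =
        x * ((\<Sum>n<p. of_int (chi p n)) * (1 + ?d) - (\<Sum>n<p. of_int (chi p n) * real n) * ?d + (\<Sum>n<p. of_int (chi p n) * ?R (n - 1) x))"
      unfolding t by (simp only: sum_distrib_left[symmetric] sum.distrib sum_subtractf sum_distrib_right[symmetric])
    also have "(\<Sum>n<p. of_int (chi p n) * real n) = - (h * p)" using p by (simp add: h_def)
    finally have N: "(\<Sum>n<p. of_int (chi p n) * x ^ n) - h * x * (1 - x ^ p) =
        x * ((\<Sum>n<p. of_int (chi p n) * ?R (n - 1) x) + h * ?R p x)"
      unfolding s0 by (simp add: algebra_simps)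
    have xp: "x ^ p \<le> x" using power_decreasing[of 1 p x] x p by simp
    have "character_series p x - h * x = ((\<Sum>n<p. of_int (chi p n) * x ^ n) - h * x * (1 - x ^ p)) / (1 - x ^ p)"
    proof -
      have "1 - x ^ p \<noteq> 0" using x xp by linarith
      then show ?thesis unfolding character_series_def[OF p] diff_divide_distrib
        by simp
    qed
    then have e: "\<bar>character_series p x - h * x\<bar> = x * \<bar>(\<Sum>n<p. of_int (chi p n) * ?R (n - 1) x) + h * ?R p x\<bar> / (1 - x ^ p)"
      unfolding N using x xp by (simp add: abs_mult)
    have "\<bar>(\<Sum>n<p. of_int (chi p n) * ?R (n - 1) x) + h * ?R p x\<bar> \<le> (\<Sum>n<p. (real n)\<^sup>2 * ?d\<^sup>2) + \<bar>h\<bar> * ((real p)\<^sup>2 * ?d\<^sup>2)"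
    proof (rule order.trans[OF abs_triangle_ineq add_mono])
      show "\<bar>\<Sum>n<p. of_int (chi p n) * ?R (n - 1) x\<bar> \<le> (\<Sum>n<p. (real n)\<^sup>2 * ?d\<^sup>2)"
      proof (rule order.trans[OF sum_abs sum_mono])
        fix n
        have "\<bar>of_int (chi p n) :: real\<bar> \<le> 1" using abs_chi_le_1[of p n] by linarith
        moreover have "\<bar>?R (n - 1) x\<bar> \<le> (real (n - 1))\<^sup>2 * ?d\<^sup>2"
          using power_linear_remainder[of x "n - 1"] x by auto
        ultimately have "\<bar>of_int (chi p n) * ?R (n - 1) x\<bar> \<le> 1 * ((real (n - 1))\<^sup>2 * ?d\<^sup>2)"
          unfolding abs_mult by (intro mult_mono) auto
        also have "\<dots> \<le> (real n)\<^sup>2 * ?d\<^sup>2" by (simp add: mult_right_mono power_mono)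
        finally show "\<bar>of_int (chi p n) * ?R (n - 1) x\<bar> \<le> (real n)\<^sup>2 * ?d\<^sup>2" .
      qed
      show "\<bar>h * ?R p x\<bar> \<le> \<bar>h\<bar> * ((real p)\<^sup>2 * ?d\<^sup>2)"
        unfolding abs_mult using power_linear_remainder[of x p] x by (intro mult_left_mono) auto
    qed
    also have "\<dots> = C * ?d\<^sup>2" by (simp only: C_def sum_distrib_right[symmetric] distrib_right mult.assoc)
    finally have "x * \<bar>(\<Sum>n<p. of_int (chi p n) * ?R (n - 1) x) + h * ?R p x\<bar> / (1 - x ^ p) \<le> x * (C * ?d\<^sup>2) / (1 - x)"
      using x xp by (intro frac_le mult_left_mono) (auto simp: C_def intro!: mult_nonneg_nonneg add_nonneg_nonneg sum_nonneg)
    also have "\<dots> = C * (x * (1 - x))" using x by (simp add: power2_eq_square)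
    finally show ?thesis unfolding e .
  qed
  then show ?thesis by (rule that)
qed

text \<open>The main terms h x / k sum to \<open>h * artanh q\<close>. The errors stay bounded as
  \<open>q\<close> tends to 1: the inequality 1 - q^k <= k (1 - q) cancels the divisor k and leaves
  1 - q times a geometric series.\<close>

lemma odd_character_sum_near_one:
  assumes sum0: "(\<Sum>n<p. chi p n) = 0"
  defines "h \<equiv> - (\<Sum>n<p. of_int (chi p n) * real n) / p"
  obtains C where "\<And>q. 0 < q \<Longrightarrow> q < 1 \<Longrightarrow> \<bar>odd_character_sum p q - h * artanh q\<bar> \<le> C"
proof -
  obtain C where C: "\<And>x. 0 \<le> x \<Longrightarrow> x < 1 \<Longrightarrow> \<bar>character_series p x - h * x\<bar> \<le> C * (x * (1 - x))"
    using character_series_near_one[OF sum0] unfolding h_def by blast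
  have "\<bar>odd_character_sum p q - h * artanh q\<bar> \<le> \<bar>C\<bar>" if q: "0 < q" "q < 1" for q
  proof -
    let ?x = "\<lambda>i. q ^ (2 * i + 1)"
    let ?a = "\<lambda>i. character_series p (?x i) / real (2 * i + 1) - h * (?x i / real (2 * i + 1))"
    have s: "?a sums (odd_character_sum p q - h * artanh q)"
      by (intro sums_diff sums_mult odd_character_sum_sums[OF p q] artanh_sums) (use q in auto)
    have g: "(\<lambda>i. \<bar>C\<bar> * ((1 - q) * q ^ i)) sums (\<bar>C\<bar> * ((1 - q) * (1 / (1 - q))))"
      by (intro sums_mult geometric_sums) (use q in auto)
    have "norm (?a i) \<le> \<bar>C\<bar> * ((1 - q) * q ^ i)" for i
    proof -
      let ?k = "2 * i + 1"
      have x: "0 \<le> ?x i" "?x i < 1" using power_Suc_less_1[of q "2 * i"] q by auto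
      have "norm (?a i) = \<bar>character_series p (?x i) - h * ?x i\<bar> / real ?k"
        by (simp add: diff_divide_distrib[symmetric] abs_divide del: of_nat_add of_nat_mult of_nat_Suc power_Suc)
      also have "\<dots> \<le> \<bar>C\<bar> * (?x i * (1 - ?x i)) / real ?k"
      proof (rule divide_right_mono)
        have "C * (?x i * (1 - ?x i)) \<le> \<bar>C\<bar> * (?x i * (1 - ?x i))"
          using x by (intro mult_right_mono mult_nonneg_nonneg) auto
        with C[OF x] show "\<bar>character_series p (?x i) - h * ?x i\<bar> \<le> \<bar>C\<bar> * (?x i * (1 - ?x i))" by linarith
      qed simp
      also have "\<dots> \<le> \<bar>C\<bar> * (q ^ i * (real ?k * (1 - q))) / real ?k"
      proof (intro divide_right_mono mult_left_mono mult_mono)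
        show "?x i \<le> q ^ i" using q by (intro power_decreasing) auto
        show "1 - ?x i \<le> real ?k * (1 - q)" using power_linear_remainder(1)[of q ?k] q by linarith
      qed (use x q in auto)
      also have "\<dots> = \<bar>C\<bar> * ((1 - q) * q ^ i)" by (simp add: field_simps)
      finally show ?thesis .
    qed
    then have "norm (suminf ?a) \<le> (\<Sum>i. \<bar>C\<bar> * ((1 - q) * q ^ i))"
      by (rule norm_suminf_le) (rule sums_summable[OF g])
    then show ?thesis using q unfolding sums_unique[OF s, symmetric] sums_unique[OF g, symmetric] by simp
  qed
  then show ?thesis by (rule that)
qed

lemma odd_character_sum_at_top:
  assumes sum0: "(\<Sum>n<p. chi p n) = 0" and h: "(\<Sum>n<p. chi p n * int n) \<noteq> 0"
  shows "filterlim (\<lambda>t. \<bar>odd_character_sum p (exp (- t))\<bar>) at_top (at_right 0)"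
proof -
  define h where "h = - (\<Sum>n<p. of_int (chi p n) * real n) / p"
  have "(\<Sum>n<p. of_int (chi p n) * real n) = of_int (\<Sum>n<p. chi p n * int n)" by simp
  then have "h \<noteq> 0" using h p unfolding h_def by (simp del: of_int_sum)
  obtain C where C: "\<And>q. 0 < q \<Longrightarrow> q < 1 \<Longrightarrow> \<bar>odd_character_sum p q - h * artanh q\<bar> \<le> C"
    using odd_character_sum_near_one[OF sum0] unfolding h_def by blast
  have "filterlim (\<lambda>t::real. exp (- t)) (at_left 1) (at_right 0)" by real_asymp
  from filterlim_compose[OF artanh_real_at_left_1 this]
  have "filterlim (\<lambda>t::real. artanh (exp (- t))) at_top (at_right 0)" .
  then have "filterlim (\<lambda>t::real. \<bar>h\<bar> * artanh (exp (- t))) at_top (at_right 0)"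
    using \<open>h \<noteq> 0\<close> by (intro filterlim_tendsto_pos_mult_at_top[OF tendsto_const]) auto
  then have "filterlim (\<lambda>t::real. - C + \<bar>h\<bar> * artanh (exp (- t))) at_top (at_right 0)"
    by (intro filterlim_tendsto_add_at_top[OF tendsto_const])
  then show ?thesis
  proof (rule filterlim_at_top_mono)
    show "eventually (\<lambda>t. - C + \<bar>h\<bar> * artanh (exp (- t)) \<le> \<bar>odd_character_sum p (exp (- t))\<bar>) (at_right 0)"
      using eventually_at_right_less[of 0]
    proof eventually_elim
      case (elim t)
      have "\<bar>odd_character_sum p (exp (- t)) - h * artanh (exp (- t))\<bar> \<le> C" using elim by (intro C) auto
      moreover have "\<bar>h\<bar> * artanh (exp (- t)) \<le> \<bar>h * artanh (exp (- t))\<bar>"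
        unfolding abs_mult by (intro mult_left_mono) auto
      ultimately show ?case by linarith
    qed
  qed
qed

text \<open>Modulo 2 the signs of \<open>chi p\<close> disappear, and the sum of all n < p is p (p -
  1) / 2, which is odd for such \<open>p\<close>.\<close>

lemma chi_first_moment_odd:
  assumes "p mod 4 = 3"
  shows "odd (\<Sum>n<p. chi p n * int n)"
proof -
  have "even (chi p n * int n - int n)" if "n < p" for n
  proof (cases "n = 0")
    case False
    then have "\<not> p dvd n" using that by (auto dest: dvd_imp_le)
    then have "chi p n = 1 \<or> chi p n = - 1"
      using chi_eq_0_iff[OF p, of n] abs_chi_le_1[of p n] by linarith
    then show ?thesis by auto
  qed simp
  then have "even (\<Sum>n<p. chi p n * int n - int n)" by (intro dvd_sum) auto
  then have "even ((\<Sum>n<p. chi p n * int n) - (\<Sum>n<p. int n))" by (simp only: sum_subtractf)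
  moreover have "odd (\<Sum>n<p. int n)"
  proof -
    obtain j where j: "p = 4 * j + 3" using assms div_mult_mod_eq[of p 4] by (metis mult.commute)
    have "2 * (\<Sum>n<k. int n) = int k * (int k - 1)" for k
      by (induction k) (simp_all add: algebra_simps)
    from this[of p] have "2 * (\<Sum>n<p. int n) = 2 * ((4 * int j + 3) * (2 * int j + 1))"
      unfolding j by (simp add: algebra_simps)
    then have "(\<Sum>n<p. int n) = (4 * int j + 3) * (2 * int j + 1)" by simp
    then show ?thesis by simp
  qed
  ultimately show ?thesis by simp
qed

lemma chi_minus_one_3_mod_4:
  assumes "p mod 4 = 3"
  shows "chi p (p - 1) = - 1"
proof -
  obtain j where j: "p = 4 * j + 3" using assms div_mult_mod_eq[of p 4] by (metis mult.commute)
  show ?thesis unfolding chi_minus_one[OF p] unfolding j by simp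
qed

end

section \<open>Convergence of the odd character sum for p = 1 modulo 4\<close>

lemma artanh_exp_minus:
  fixes u :: real
  assumes "u > 0"
  shows "2 * artanh (exp (- (2 * u))) = ln (cosh u / sinh u)"
proof -
  have "exp (- (2 * u)) = exp (- u) / exp u" by (simp flip: exp_diff)
  moreover have "exp u > exp (- u)" using assms by simp
  ultimately have "(1 + exp (- (2 * u))) / (1 - exp (- (2 * u))) = cosh u / sinh u"
    by (simp add: cosh_def sinh_def field_simps)
  then show ?thesis by (simp add: artanh_def)
qed

text \<open>Follows from the addition formula and cosh >= 1. It makes the bound on the second
  differences independent of \<open>t\<close>.\<close>

lemma sinh_of_nat_mult_ge:
  fixes b :: real
  assumes "b \<ge> 0"
  shows "real j * sinh b \<le> sinh (real j * b)"
proof (induction j)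
  case (Suc j)
  have "sinh (real (Suc j) * b) = sinh (real j * b) * cosh b + cosh (real j * b) * sinh b"
    by (simp add: distrib_right sinh_add add.commute)
  moreover have "real j * sinh b * 1 \<le> sinh (real j * b) * cosh b"
    using Suc assms by (intro mult_mono) (auto simp: cosh_real_ge_1)
  moreover have "1 * sinh b \<le> cosh (real j * b) * sinh b"
    using assms by (intro mult_right_mono) (auto simp: cosh_real_ge_1)
  ultimately show ?case by (simp add: distrib_right)
qed simp

text \<open>The product formulas for \<open>cosh\<close> and \<open>sinh\<close> at \<open>a + b\<close> and \<open>a - b\<close> turn the second difference
  into logarithms of \<open>1 + sinh\<^sup>2 b / cosh\<^sup>2 a\<close> and \<open>sinh\<^sup>2 a / (sinh (a + b) * sinh (a - b))\<close>.\<close>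

lemma artanh_exp_second_difference:
  fixes a b :: real
  assumes "0 < b" "b < a"
  shows "\<bar>artanh (exp (- (2 * (a + b)))) + artanh (exp (- (2 * (a - b)))) - 2 * artanh (exp (- (2 * a)))\<bar>
    \<le> (sinh b / sinh (a - b))\<^sup>2"
proof -
  let ?C = "cosh a" and ?S = "sinh a" and ?s = "sinh b" and ?d = "sinh (a - b)"
  have pos: "0 < ?C" "0 < ?S" "0 < ?s" "0 < ?d" "0 < sinh (a + b)" "0 < cosh (a + b)" "0 < cosh (a - b)"
    using assms by auto
  have C2: "?C\<^sup>2 = ?S\<^sup>2 + 1" and c2: "(cosh b)\<^sup>2 = ?s\<^sup>2 + 1" by (simp_all add: cosh_square_eq)
  have cc: "cosh (a + b) * cosh (a - b) = ?C\<^sup>2 + ?s\<^sup>2"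
  proof -
    have "cosh (a + b) * cosh (a - b) = ?C\<^sup>2 * (cosh b)\<^sup>2 - ?S\<^sup>2 * ?s\<^sup>2"
      by (simp add: cosh_add cosh_diff power2_eq_square algebra_simps)
    then show ?thesis unfolding c2 C2 by (simp add: algebra_simps)
  qed
  have ss: "sinh (a + b) * ?d = ?S\<^sup>2 - ?s\<^sup>2"
  proof -
    have "sinh (a + b) * ?d = ?S\<^sup>2 * (cosh b)\<^sup>2 - ?C\<^sup>2 * ?s\<^sup>2"
      by (simp add: sinh_add sinh_diff power2_eq_square algebra_simps)
    then show ?thesis unfolding c2 C2 by (simp add: algebra_simps)
  qed
  have ssp: "0 < ?S\<^sup>2 - ?s\<^sup>2" unfolding ss[symmetric] using pos by simp
  let ?W = "artanh (exp (- (2 * (a + b)))) + artanh (exp (- (2 * (a - b)))) - 2 * artanh (exp (- (2 * a)))"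
  have "2 * ?W = ln (cosh (a + b) / sinh (a + b)) + ln (cosh (a - b) / ?d) - 2 * ln (?C / ?S)"
  proof -
    have "0 < a + b" "0 < a - b" "0 < a" using assms by auto
    note eqs = this[THEN artanh_exp_minus]
    show ?thesis unfolding eqs[symmetric] by (simp only: right_diff_distrib distrib_left)
  qed
  also have "\<dots> = ln (cosh (a + b) * cosh (a - b)) - ln (sinh (a + b) * ?d) - (ln (?C\<^sup>2) - ln (?S\<^sup>2))"
    using pos by (simp add: ln_div ln_mult ln_realpow)
  also have "\<dots> = ln ((?C\<^sup>2 + ?s\<^sup>2) / ?C\<^sup>2) + ln (?S\<^sup>2 / (?S\<^sup>2 - ?s\<^sup>2))"
    unfolding cc ss using pos ssp by (simp add: ln_div add_pos_pos)
  also have "(?C\<^sup>2 + ?s\<^sup>2) / ?C\<^sup>2 = 1 + ?s\<^sup>2 / ?C\<^sup>2" using pos by (simp add: field_simps)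
  also have "?S\<^sup>2 / (?S\<^sup>2 - ?s\<^sup>2) = 1 + ?s\<^sup>2 / (?S\<^sup>2 - ?s\<^sup>2)" using ssp by (simp add: field_simps)
  finally have W: "2 * ?W = ln (1 + ?s\<^sup>2 / ?C\<^sup>2) + ln (1 + ?s\<^sup>2 / (?S\<^sup>2 - ?s\<^sup>2))" .
  have n: "0 \<le> ?s\<^sup>2 / ?C\<^sup>2" "0 \<le> ?s\<^sup>2 / (?S\<^sup>2 - ?s\<^sup>2)" using ssp by auto
  have "?d \<le> ?S" using assms by simp
  then have "?d \<le> ?C" using sinh_less_cosh_real[of a] by linarith
  then have "?s\<^sup>2 / ?C\<^sup>2 \<le> ?s\<^sup>2 / ?d\<^sup>2" using pos by (intro divide_left_mono power_mono mult_pos_pos) auto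
  moreover have "?d * ?d \<le> sinh (a + b) * ?d" using pos assms by (intro mult_right_mono) auto
  then have "?s\<^sup>2 / (?S\<^sup>2 - ?s\<^sup>2) \<le> ?s\<^sup>2 / ?d\<^sup>2"
    using pos ssp unfolding ss by (intro divide_left_mono mult_pos_pos) (auto simp: power2_eq_square)
  moreover have "ln (1 + ?s\<^sup>2 / ?C\<^sup>2) \<le> ?s\<^sup>2 / ?C\<^sup>2" "ln (1 + ?s\<^sup>2 / (?S\<^sup>2 - ?s\<^sup>2)) \<le> ?s\<^sup>2 / (?S\<^sup>2 - ?s\<^sup>2)"
    using n by (intro ln_add_one_self_le_self; simp)+
  moreover have "0 \<le> ln (1 + ?s\<^sup>2 / ?C\<^sup>2)" "0 \<le> ln (1 + ?s\<^sup>2 / (?S\<^sup>2 - ?s\<^sup>2))"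
    using n by (intro ln_ge_zero; simp)+
  ultimately have "\<bar>2 * ?W\<bar> \<le> 2 * (?s\<^sup>2 / ?d\<^sup>2)" unfolding W by linarith
  then show ?thesis by (simp only: abs_mult abs_numeral power_divide mult_le_cancel_left_pos zero_less_numeral)
qed

text \<open>Each term diverges like - (1 / 2) ln t. Since (1 + e^(-a t)) / (1 - e^(-a t)) is
  asymptotic to 2 / (a t), only the ratio of the scales survives in the difference.\<close>

lemma artanh_exp_ratio:
  assumes "0 < a" "0 < b"
  shows "((\<lambda>t. artanh (exp (- (a * t))) - artanh (exp (- (b * t)))) \<longlongrightarrow> (ln b - ln a) / 2) (at_right (0::real))"
proof -
  have "((\<lambda>t. (1 + exp (- (a * t))) / (1 - exp (- (a * t))) / ((1 + exp (- (b * t))) / (1 - exp (- (b * t))))) \<longlongrightarrow> b / a) (at_right 0)"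
    using assms by (real_asymp simp: field_simps)
  then have "((\<lambda>t. ln ((1 + exp (- (a * t))) / (1 - exp (- (a * t))) / ((1 + exp (- (b * t))) / (1 - exp (- (b * t))))) / 2) \<longlongrightarrow> ln (b / a) / 2) (at_right 0)"
    using assms by (intro tendsto_divide[OF tendsto_ln tendsto_const]) auto
  moreover have "eventually (\<lambda>t. ln ((1 + exp (- (a * t))) / (1 - exp (- (a * t))) / ((1 + exp (- (b * t))) / (1 - exp (- (b * t))))) / 2
      = artanh (exp (- (a * t))) - artanh (exp (- (b * t)))) (at_right 0)"
    using eventually_at_right_less[of 0]
  proof eventually_elim
    case (elim t)
    have "0 < (1 + exp (- (c * t))) / (1 - exp (- (c * t)))" if "c > 0" for c
      using that elim by (intro divide_pos_pos add_pos_pos) auto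
    note pos = this[OF assms(1)] this[OF assms(2)]
    then have "ln ((1 + exp (- (a * t))) / (1 - exp (- (a * t))) / ((1 + exp (- (b * t))) / (1 - exp (- (b * t))))) =
        ln ((1 + exp (- (a * t))) / (1 - exp (- (a * t)))) - ln ((1 + exp (- (b * t))) / (1 - exp (- (b * t))))"
      by (rule ln_divide_pos)
    then show ?case unfolding artanh_def by (simp only: diff_divide_distrib)
  qed
  ultimately have "((\<lambda>t. artanh (exp (- (a * t))) - artanh (exp (- (b * t)))) \<longlongrightarrow> ln (b / a) / 2) (at_right 0)"
    by (rule Lim_transform_eventually)
  then show ?thesis using assms by (simp add: ln_div)
qed

lemma ln_sin_product_sums:
  assumes "0 < x" "x < (1::real)"
  shows "(\<lambda>j. ln (1 - x\<^sup>2 / (real (Suc j))\<^sup>2)) sums ln (sin (pi * x) / (pi * x))"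
proof -
  have pos: "0 < 1 - x\<^sup>2 / (real (Suc j))\<^sup>2" for j
  proof -
    have "x\<^sup>2 < 1" using assms power_Suc_less_1[of x 1] by (simp add: power2_eq_square)
    moreover have "(1::real) \<le> (real (Suc j))\<^sup>2" by (rule one_le_power) simp
    ultimately have "x\<^sup>2 < (real (Suc j))\<^sup>2" by linarith
    then show ?thesis by (simp add: divide_less_eq del: of_nat_Suc)
  qed
  have "(\<lambda>n. \<Prod>k=1..n. 1 - x\<^sup>2 / of_nat k ^ 2) \<longlonglongrightarrow> sin (pi * x) / (pi * x)"
    using assms by (intro sin_product_formula_real') simp
  moreover have "sin (pi * x) / (pi * x) > 0"
    using assms by (intro divide_pos_pos sin_gt_zero) auto
  ultimately have "(\<lambda>n. ln (\<Prod>k=1..n. 1 - x\<^sup>2 / of_nat k ^ 2)) \<longlonglongrightarrow> ln (sin (pi * x) / (pi * x))"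
    by (intro tendsto_ln) auto
  moreover have "ln (\<Prod>k=1..n. 1 - x\<^sup>2 / of_nat k ^ 2) = (\<Sum>j<n. ln (1 - x\<^sup>2 / (real (Suc j))\<^sup>2))" for n
  proof -
    have "ln (\<Prod>k\<in>{1..n}. 1 - x\<^sup>2 / of_nat k ^ 2) = (\<Sum>k\<in>{1..n}. ln (1 - x\<^sup>2 / of_nat k ^ 2))"
    proof (rule ln_prod)
      fix k assume "k \<in> {1..n}"
      then have "k = Suc (k - 1)" by simp
      then show "1 - x\<^sup>2 / of_nat k ^ 2 \<noteq> 0" using pos[of "k - 1"] by simp
    qed simp
    then show ?thesis by (simp only: One_nat_def sum.atLeast1_atMost_eq)
  qed
  ultimately show ?thesis unfolding sums_def by simp
qed

lemma sum_lessThan_symmetric: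
  fixes g :: "nat \<Rightarrow> real"
  assumes "p = 2 * h + 1" "\<And>n. 0 < n \<Longrightarrow> n < p \<Longrightarrow> g (p - n) = g n"
  shows "(\<Sum>n<p. g n) = g 0 + 2 * (\<Sum>n\<in>{1..h}. g n)"
proof -
  have "{..<p} = {0..<h + 1 + h}" using assms(1) by auto
  then have "(\<Sum>n<p. g n) = (\<Sum>n\<in>{0..<h + 1}. g n) + (\<Sum>n\<in>{h + 1..<h + 1 + h}. g n)"
    by (simp only:) (subst sum.atLeastLessThan_concat, auto)
  also have "(\<Sum>n\<in>{0..<h + 1}. g n) = g 0 + (\<Sum>n\<in>{1..h}. g n)"
    by (subst sum.atLeast_Suc_lessThan) (auto simp: atLeastLessThanSuc_atLeastAtMost)
  also have "(\<Sum>n\<in>{h + 1..<h + 1 + h}. g n) = (\<Sum>n\<in>{1..h}. g n)"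
    using assms by (intro sum.reindex_bij_witness[of _ "\<lambda>i. p - i" "\<lambda>n. p - n"]) auto
  finally show ?thesis by simp
qed

lemma sum_symmetric_interval:
  fixes f :: "nat \<Rightarrow> 'a :: comm_monoid_add"
  assumes "h \<le> P"
  shows "sum f {P - h..<P + h + 1} = f P + (\<Sum>i\<in>{1..h}. f (P + i) + f (P - i))"
proof -
  have "sum f {P - h..<P + h + 1} = sum f {P - h..<P} + sum f {P..<P + h + 1}"
    using assms by (subst sum.atLeastLessThan_concat) auto
  also have "sum f {P..<P + h + 1} = f P + sum f {Suc P..<P + h + 1}"
    by (subst sum.atLeast_Suc_lessThan) auto
  also have "sum f {Suc P..<P + h + 1} = (\<Sum>i\<in>{1..h}. f (P + i))"
    by (rule sum.reindex_bij_witness[of _ "\<lambda>i. P + i" "\<lambda>n. n - P"]) auto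
  also have "sum f {P - h..<P} = (\<Sum>i\<in>{1..h}. f (P - i))"
    using assms by (intro sum.reindex_bij_witness[of _ "\<lambda>i. P - i" "\<lambda>n. P - n"]) auto
  finally show ?thesis by (simp add: sum.distrib ac_simps)
qed

context
  fixes p :: nat
  assumes p: "prime p" "2 < p"
begin

text \<open>Exchanges the sums over the odd exponents and over \<open>n\<close>; the inner sum is
  then an \<open>artanh\<close> series. The exchange is a dominated limit in the cut-off
  \<open>N\<close> of the sum over \<open>n\<close>.\<close>

lemma odd_character_sum_artanh_sums:
  assumes q: "0 < q" "q < 1"
  shows "(\<lambda>n. of_int (chi p n) * artanh (q ^ n)) sums odd_character_sum p q"
proof -
  let ?a = "\<lambda>i N. (\<Sum>n<N. of_int (chi p n) * (q ^ (2 * i + 1)) ^ n) / real (2 * i + 1)"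
  have x: "0 \<le> q ^ (2 * i + 1)" "q ^ (2 * i + 1) < 1" for i
    using power_Suc_less_1[of q "2 * i"] q by auto
  have "(\<lambda>N. ?a i N) \<longlonglongrightarrow> character_series p (q ^ (2 * i + 1)) / real (2 * i + 1)" for i
    using character_series_sums[OF p x[of i]] unfolding sums_def by (intro tendsto_divide tendsto_const) auto
  moreover have "norm (?a i N) \<le> q ^ Suc i / (1 - q)" for i N
  proof -
    let ?x = "q ^ (2 * i + 1)"
    have "norm (?a i N) \<le> norm (\<Sum>n<N. of_int (chi p n) * ?x ^ n)"
      using divide_left_mono[of 1 "real (2 * i + 1)" "norm (\<Sum>n<N. of_int (chi p n) * ?x ^ n)"]
      by (simp del: of_nat_add of_nat_mult power_Suc)
    \<comment> \<open>The term n = 0 is removed through \<open>chi p 0 = 0\<close>: its bound 1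
      would not decay with \<open>i\<close>.\<close>
    also have "\<dots> \<le> (\<Sum>n<N. if n = 0 then 0 else ?x ^ n)"
    proof (rule sum_norm_le)
      fix n
      have "\<bar>of_int (chi p n) :: real\<bar> \<le> 1" using abs_chi_le_1[of p n] by linarith
      then show "norm (of_int (chi p n) * ?x ^ n) \<le> (if n = 0 then 0 else ?x ^ n)"
        using mult_right_mono[of "\<bar>of_int (chi p n) :: real\<bar>" 1 "?x ^ n"] x[of i]
        by (simp add: abs_mult chi_0 del: power_Suc)
    qed
    also have "\<dots> \<le> (\<Sum>n<Suc N. if n = 0 then 0 else ?x ^ n)" using x[of i] by (simp del: power_Suc)
    also have "\<dots> = (\<Sum>n<N. ?x ^ Suc n)" by (subst sum.lessThan_Suc_shift) simp
    also have "\<dots> \<le> ?x / (1 - ?x)"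
      using sum_le_suminf[OF sums_summable[OF geometric_Suc_sums[OF x[of i]]], of "{..<N}"] x[of i]
      unfolding sums_unique[OF geometric_Suc_sums[OF x[of i]], symmetric] by (simp del: power_Suc) 
    also have "\<dots> \<le> q ^ Suc i / (1 - q)"
      using q power_decreasing[of 1 "2 * i + 1" q] power_decreasing[of "Suc i" "2 * i + 1" q] by (intro frac_le) auto
    finally show ?thesis .
  qed
  moreover have "summable (\<lambda>i. q ^ Suc i / (1 - q))"
    using geometric_Suc_sums[of q] q by (intro summable_divide sums_summable) auto
  ultimately have "(\<lambda>N. \<Sum>i. ?a i N) \<longlonglongrightarrow> odd_character_sum p q"
    unfolding odd_character_sum_def[OF p]
    by (intro tannery(2)[where M = "\<lambda>i. q ^ Suc i / (1 - q)"]) auto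
  moreover have "(\<Sum>i. ?a i N) = (\<Sum>n<N. of_int (chi p n) * artanh (q ^ n))" for N
  proof -
    have "(\<lambda>i. \<Sum>n<N. of_int (chi p n) * ((q ^ n) ^ (2 * i + 1) / real (2 * i + 1))) sums
        (\<Sum>n<N. of_int (chi p n) * artanh (q ^ n))"
    proof (rule sums_sum)
      fix n
      show "(\<lambda>i. of_int (chi p n) * ((q ^ n) ^ (2 * i + 1) / real (2 * i + 1))) sums (of_int (chi p n) * artanh (q ^ n))"
      proof (cases n)
        case 0
        then show ?thesis by (simp add: chi_0)
      next
        case (Suc m)
        have "\<bar>q ^ n\<bar> < 1" unfolding Suc using power_Suc_less_1[of q m] q by (simp del: power_Suc)
        then show ?thesis by (intro sums_mult artanh_sums)
      qed
    qed
    moreover have "(\<Sum>n<N. of_int (chi p n) * ((q ^ n) ^ (2 * i + 1) / real (2 * i + 1))) = ?a i N" for i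
      unfolding sum_divide_distrib power_mult[symmetric] by (simp only: mult.commute[of "2 * i + 1"] times_divide_eq_right)
    ultimately show ?thesis by (simp only: sums_unique[symmetric])
  qed
  ultimately show ?thesis unfolding sums_def by simp
qed

context
  assumes mod4: "p mod 4 = 1" and sum0: "(\<Sum>n<p. chi p n) = 0"
begin

lemma chi_reflect_even: "0 < i \<Longrightarrow> i \<le> p \<Longrightarrow> chi p (p - i) = chi p i"
proof -
  obtain j where j: "p = 4 * j + 1" using mod4 div_mult_mod_eq[of p 4] by (metis mult.commute)
  have "chi p (p - 1) = 1" unfolding chi_minus_one[OF p] unfolding j by simp
  then show "0 < i \<Longrightarrow> i \<le> p \<Longrightarrow> chi p (p - i) = chi p i" using chi_reflect[OF p, of i] by simp
qed

definition half :: nat where "half = (p - 1) div 2"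

lemma p_eq_half: "p = 2 * half + 1"
  using prime_odd_nat[OF p] p(2) by (auto simp: half_def elim!: oddE)

text \<open>The cut after \<open>p * J + half\<close> ends a window of length \<open>p\<close>
  centred at \<open>p * J\<close>. In each window the evenness of \<open>chi p\<close> pairs the two
  points at distance \<open>i\<close> from the centre.\<close>

lemma sum_even_character:
  fixes g :: "nat \<Rightarrow> real"
  shows "(\<Sum>n<p * J + half + 1. of_int (chi p n) * g n) = (\<Sum>i\<in>{1..half}. of_int (chi p i) * g i) +
    (\<Sum>j<J. \<Sum>i\<in>{1..half}. of_int (chi p i) * (g (p * Suc j + i) + g (p * Suc j - i)))"
proof (induction J)
  case 0
  have "(\<Sum>n<half + 1. of_int (chi p n) * g n) = (\<Sum>n\<in>{1..half}. of_int (chi p n) * g n)"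
    by (rule sum.mono_neutral_right) (auto simp: chi_0 Suc_le_eq)
  then show ?case by simp
next
  case (Suc J)
  let ?P = "p * Suc J"
  let ?f = "\<lambda>n. of_int (chi p n) * g n"
  have e: "p * J + half + 1 = ?P - half" using p_eq_half by simp
  have hp: "half \<le> ?P" using p_eq_half by simp
  have "(\<Sum>n<?P + half + 1. ?f n) = (\<Sum>n<?P - half. ?f n) + sum ?f {?P - half..<?P + half + 1}"
    unfolding lessThan_atLeast0 by (subst sum.atLeastLessThan_concat) auto
  also have "sum ?f {?P - half..<?P + half + 1} = ?f ?P + (\<Sum>i\<in>{1..half}. ?f (?P + i) + ?f (?P - i))"
    by (rule sum_symmetric_interval[OF hp])
  also have "?f ?P = 0" using chi_eq_0_iff[OF p, of ?P] by simp
  also have "(\<Sum>i\<in>{1..half}. ?f (?P + i) + ?f (?P - i)) =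
      (\<Sum>i\<in>{1..half}. of_int (chi p i) * (g (p * Suc J + i) + g (p * Suc J - i)))"
  proof (rule sum.cong[OF refl])
    fix i assume i: "i \<in> {1..half}"
    then have ip: "0 < i" "i \<le> p" using p_eq_half by auto
    have per: "chi p (n + p * k) = chi p n" for n k
      by (rule chi_cong[OF p]) (simp only: unique_euclidean_semiring_class.cong_def mod_mult_self2)
    have "chi p (?P + i) = chi p i" unfolding add.commute[of ?P] by (rule per)
    moreover have "?P - i = (p - i) + p * J" using ip by simp
    then have "chi p (?P - i) = chi p (p - i)"
      by (simp only: per)
    ultimately show "?f (?P + i) + ?f (?P - i) = of_int (chi p i) * (g (p * Suc J + i) + g (p * Suc J - i))"
      using chi_reflect_even[OF ip] by (simp add: distrib_left)
  qed
  finally show ?case using Suc.IH unfolding e by simp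
qed

lemma sum_chi_half: "(\<Sum>i\<in>{1..half}. of_int (chi p i) :: real) = 0"
proof -
  have "(\<Sum>n<p. of_int (chi p n) :: real) = 0" using sum0 by (simp flip: of_int_sum)
  also have "(\<Sum>n<p. of_int (chi p n) :: real) = of_int (chi p 0) + 2 * (\<Sum>n\<in>{1..half}. of_int (chi p n))"
    by (intro sum_lessThan_symmetric p_eq_half) (simp add: chi_reflect_even)
  finally show ?thesis by (simp add: chi_0)
qed

text \<open>Every \<open>artanh (exp (- n t))\<close> diverges as \<open>t\<close> tends to 0, so
  there are no termwise limits. But \<open>chi p\<close> sums to 0 over \<open>{1..half}\<close>, so
  the value at the centre of each window may be subtracted. The resulting second differences
  converge and are O(1 / (j + 1)^2) uniformly in \<open>t\<close>; their limits are the logarithms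
  in Euler's product for the sine.\<close>

lemma odd_character_sum_tendsto:
  "((\<lambda>t. odd_character_sum p (exp (- t))) \<longlongrightarrow> - (\<Sum>i\<in>{1..half}. of_int (chi p i) * ln (sin (pi * (i / p)))) / 2) (at_right 0)"
proof -
  let ?L = "\<lambda>u::real. artanh (exp (- u))"
  let ?B = "\<lambda>j t. \<Sum>i\<in>{1..half}. of_int (chi p i) * (?L (real (p * Suc j + i) * t) + ?L (real (p * Suc j - i) * t) - 2 * ?L (real (p * Suc j) * t))"
  \<comment> \<open>The initial half window has no pairs; subtracting the value at n = 1 gives the
    limit - (ln i) / 2.\<close>
  let ?H = "\<lambda>t. \<Sum>i\<in>{1..half}. of_int (chi p i) * (?L (real i * t) - ?L (1 * t))"
  let ?x = "\<lambda>i. real i / real p"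
  have ip: "0 < i" "i < p" "0 < ?x i" "?x i < 1" if "i \<in> {1..half}" for i
    using that p_eq_half by auto
  have H: "(?H \<longlongrightarrow> (\<Sum>i\<in>{1..half}. of_int (chi p i) * ((ln 1 - ln (real i)) / 2))) (at_right 0)"
    by (intro tendsto_sum tendsto_mult tendsto_const artanh_exp_ratio) auto
  have Bl: "((\<lambda>t. ?B j t) \<longlongrightarrow> (\<Sum>i\<in>{1..half}. of_int (chi p i) * (- ln (1 - (?x i)\<^sup>2 / (real (Suc j))\<^sup>2) / 2))) (at_right 0)" for j
  proof (intro tendsto_sum tendsto_mult tendsto_const)
    fix i assume i: "i \<in> {1..half}"
    let ?P = "real (p * Suc j)"
    have lt: "i < p * Suc j" using ip[OF i] by (simp add: trans_less_add1)
    have P: "0 < ?P" "0 < real (p * Suc j + i)" "0 < real (p * Suc j - i)"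
      unfolding of_nat_0_less_iff using lt ip[OF i] by linarith+
    have "((\<lambda>t. (?L (real (p * Suc j + i) * t) - ?L (?P * t)) + (?L (real (p * Suc j - i) * t) - ?L (?P * t))) \<longlongrightarrow>
        (ln ?P - ln (real (p * Suc j + i))) / 2 + (ln ?P - ln (real (p * Suc j - i))) / 2) (at_right 0)"
      by (intro tendsto_add artanh_exp_ratio P)
    moreover have "(ln ?P - ln (real (p * Suc j + i))) / 2 + (ln ?P - ln (real (p * Suc j - i))) / 2 =
        - ln (1 - (?x i)\<^sup>2 / (real (Suc j))\<^sup>2) / 2"
    proof -
      have "1 - (?x i)\<^sup>2 / (real (Suc j))\<^sup>2 = real (p * Suc j + i) * real (p * Suc j - i) / (?P * ?P)"
      proof -
        have "real (p * Suc j - i) = ?P - real i" "real (p * Suc j + i) = ?P + real i"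
          using lt by (simp_all add: of_nat_diff del: of_nat_mult)
        moreover have "(?x i)\<^sup>2 / (real (Suc j))\<^sup>2 = (real i)\<^sup>2 / (?P * ?P)"
        proof -
          have "(a / b)\<^sup>2 / c\<^sup>2 = a\<^sup>2 / ((b * c) * (b * c))" for a b c :: real
            by (simp add: power2_eq_square)
          then show ?thesis by (simp only: of_nat_mult)
        qed
        moreover have "1 - (real i)\<^sup>2 / (?P * ?P) = (?P * ?P - (real i)\<^sup>2) / (?P * ?P)"
          using P(1) by (subst diff_divide_distrib) (simp del: of_nat_mult)
        ultimately show ?thesis by (simp only: power2_eq_square) (simp add: algebra_simps)
      qed
      then have "ln (1 - (?x i)\<^sup>2 / (real (Suc j))\<^sup>2) = ln (real (p * Suc j + i)) + ln (real (p * Suc j - i)) - (ln ?P + ln ?P)"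
        using P by (simp only: ln_divide_pos ln_mult_pos mult_pos_pos)
      then show ?thesis by (simp only:) (simp add: field_simps)
    qed
    ultimately show "((\<lambda>t. ?L (real (p * Suc j + i) * t) + ?L (real (p * Suc j - i) * t) - 2 * ?L (?P * t)) \<longlongrightarrow>
        - ln (1 - (?x i)\<^sup>2 / (real (Suc j))\<^sup>2) / 2) (at_right 0)"
      by (simp only: add_diff_eq diff_add_eq mult_2 diff_diff_add)
  qed
  have Bb: "norm (?B j t) \<le> real half * (1 / (real (Suc j))\<^sup>2)" if t: "t > 0" for j t
  proof -
    have "norm (?B j t) \<le> (\<Sum>i\<in>{1..half}. 1 / (real (Suc j))\<^sup>2)"
    proof (rule sum_norm_le)
      fix i assume i: "i \<in> {1..half}"
      let ?a = "real (p * Suc j) * t / 2" and ?b = "real i * t / 2"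
      have lt: "i < p * Suc j" using ip[OF i] by (simp add: trans_less_add1)
      have b: "0 < ?b" using t ip[OF i] by simp
      have "real i < real (p * Suc j)" using lt by (simp only: of_nat_less_iff)
      then have ba: "?b < ?a" using t by (simp del: of_nat_mult)
      \<comment> \<open>Amounts to (j + 2) i <= p (j + 1), which follows from 2 i < p and j + 2 <= 2
        (j + 1). It bounds the ratio of hyperbolic sines by 1 / (j + 1) for every t > 0.\<close>
      have ge: "real (Suc j) * ?b \<le> ?a - ?b"
      proof -
        have "Suc j * i + i \<le> p * Suc j"
        proof -
          have "Suc j * i + i = i * (j + 2)" by simp
          also have "\<dots> \<le> half * (2 * (j + 1))" using i by (intro mult_le_mono) auto
          also have "\<dots> = 2 * half * Suc j" by simp
          also have "\<dots> \<le> p * Suc j" by (intro mult_le_mono1) (subst p_eq_half, simp)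
          finally show ?thesis .
        qed
        then have "real (Suc j * i + i) \<le> real (p * Suc j)" by (simp only: of_nat_le_iff)
        then have "real (Suc j) * real i + real i \<le> real (p * Suc j)"
          by (simp only: of_nat_add[of "Suc j * i"] of_nat_mult[of "Suc j" i])
        then have "(real (Suc j) * real i + real i) * (t / 2) \<le> real (p * Suc j) * (t / 2)"
          using t by (intro mult_right_mono) auto
        moreover have "A * (B * t / 2) \<le> P * t / 2 - B * t / 2" if "(A * B + B) * (t / 2) \<le> P * (t / 2)" for A B P :: real
          using that by (simp add: algebra_simps)
        ultimately show ?thesis by blast
      qed
      have "\<bar>?L (2 * (?a + ?b)) + ?L (2 * (?a - ?b)) - 2 * ?L (2 * ?a)\<bar> \<le> (sinh ?b / sinh (?a - ?b))\<^sup>2"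
        by (rule artanh_exp_second_difference[OF b ba])
      also have "\<dots> \<le> (1 / real (Suc j))\<^sup>2"
      proof (rule power_mono)
        have "real (Suc j) * sinh ?b \<le> sinh (real (Suc j) * ?b)" using b by (intro sinh_of_nat_mult_ge) simp
        also have "\<dots> \<le> sinh (?a - ?b)" using ge by (simp only: sinh_real_le_iff)
        finally have le: "real (Suc j) * sinh ?b \<le> sinh (?a - ?b)" .
        have "0 < sinh (?a - ?b)" using ba by (simp only: sinh_real_pos_iff diff_gt_0_iff_gt)
        moreover have "x / y \<le> 1 / c" if "c * x \<le> y" "0 < y" "0 < c" for c x y :: real
          using that by (simp add: field_simps)
        ultimately show "sinh ?b / sinh (?a - ?b) \<le> 1 / real (Suc j)" using le by simp
        show "0 \<le> sinh ?b / sinh (?a - ?b)" using b ba by (intro divide_nonneg_nonneg) auto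
      qed
      finally have le: "\<bar>?L (2 * (?a + ?b)) + ?L (2 * (?a - ?b)) - 2 * ?L (2 * ?a)\<bar> \<le> 1 / (real (Suc j))\<^sup>2"
        by (simp only: power_divide power_one)
      have "2 * (?a + ?b) = real (p * Suc j + i) * t" "2 * ?a = real (p * Suc j) * t"
        by (simp_all add: algebra_simps)
      moreover have "2 * (?a - ?b) = real (p * Suc j - i) * t"
        using lt by (simp add: of_nat_diff algebra_simps)
      ultimately have le': "\<bar>?L (real (p * Suc j + i) * t) + ?L (real (p * Suc j - i) * t) - 2 * ?L (real (p * Suc j) * t)\<bar> \<le> 1 / (real (Suc j))\<^sup>2"
        using le by (simp only:)
      have "\<bar>of_int (chi p i) :: real\<bar> \<le> 1" using abs_chi_le_1[of p i] by linarith
      from mult_mono[OF this le'] show "norm (of_int (chi p i) * (?L (real (p * Suc j + i) * t) + ?L (real (p * Suc j - i) * t) - 2 * ?L (real (p * Suc j) * t))) \<le> 1 / (real (Suc j))\<^sup>2"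
        by (simp only: real_norm_def abs_mult mult_1_left abs_ge_zero zero_le_one)
    qed
    then show ?thesis by (simp only: sum_constant card_atLeastAtMost) simp
  qed
  have sM: "summable (\<lambda>j. real half * (1 / (real (Suc j))\<^sup>2))"
    by (intro summable_mult summable_inverse_squares_Suc)
  have "eventually (\<lambda>t. \<forall>j. norm (?B j t) \<le> real half * (1 / (real (Suc j))\<^sup>2)) (at_right 0)"
    using eventually_at_right_less[of 0] by eventually_elim (use Bb in blast)
  note tan = tannery(2)[OF Bl this sM trivial_limit_at_right_real]
  have val: "(\<lambda>j. \<Sum>i\<in>{1..half}. of_int (chi p i) * (- ln (1 - (?x i)\<^sup>2 / (real (Suc j))\<^sup>2) / 2)) sums
      (\<Sum>i\<in>{1..half}. of_int (chi p i) * (- ln (sin (pi * ?x i) / (pi * ?x i)) / 2))"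
    by (intro sums_sum sums_mult sums_divide sums_minus ln_sin_product_sums ip)
  have "((\<lambda>t. ?H t + (\<Sum>j. ?B j t)) \<longlongrightarrow> (\<Sum>i\<in>{1..half}. of_int (chi p i) * ((ln 1 - ln (real i)) / 2)) +
      (\<Sum>i\<in>{1..half}. of_int (chi p i) * (- ln (sin (pi * ?x i) / (pi * ?x i)) / 2))) (at_right 0)"
    using tendsto_add[OF H tan] unfolding sums_unique[OF val, symmetric] .
  \<comment> \<open>The \<open>ln i\<close> of the initial half window cancels the one in ln(pi i /
    p). The remaining constant ln pi - ln p disappears by \<open>sum_chi_half\<close>.\<close>
  also have "(\<Sum>i\<in>{1..half}. of_int (chi p i) * ((ln 1 - ln (real i)) / 2)) +
      (\<Sum>i\<in>{1..half}. of_int (chi p i) * (- ln (sin (pi * ?x i) / (pi * ?x i)) / 2)) =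
      (\<Sum>i\<in>{1..half}. - (of_int (chi p i) * ln (sin (pi * ?x i))) / 2 + of_int (chi p i) * ((ln pi - ln p) / 2))"
    unfolding sum.distrib[symmetric]
  proof (rule sum.cong[OF refl])
    fix i assume i: "i \<in> {1..half}"
    have "pi * ?x i < pi * 1" using ip(4)[OF i] by (intro mult_strict_left_mono) auto
    moreover have 0: "0 < pi * ?x i" by (rule mult_pos_pos[OF pi_gt_zero ip(3)[OF i]])
    ultimately have "0 < sin (pi * ?x i)" by (intro sin_gt_zero) (simp_all only: mult_1_right)
    moreover note 0
    ultimately have "ln (sin (pi * ?x i) / (pi * ?x i)) = ln (sin (pi * ?x i)) - ln (pi * ?x i)" by (rule ln_divide_pos)
    also have "ln (pi * ?x i) = ln pi + ln (?x i)" using ip[OF i] by (intro ln_mult_pos) auto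
    also have "ln (?x i) = ln (real i) - ln p" using ip[OF i] by (intro ln_divide_pos) auto
    finally show "of_int (chi p i) * ((ln 1 - ln (real i)) / 2) + of_int (chi p i) * (- ln (sin (pi * ?x i) / (pi * ?x i)) / 2) =
      - (of_int (chi p i) * ln (sin (pi * ?x i))) / 2 + of_int (chi p i) * ((ln pi - ln p) / 2)"
      by (simp only:) (simp add: field_simps)
  qed
  also have "\<dots> = - (\<Sum>i\<in>{1..half}. of_int (chi p i) * ln (sin (pi * ?x i))) / 2"
    by (simp only: sum.distrib sum_distrib_right[symmetric] sum_chi_half sum_negf sum_divide_distrib[symmetric] mult_zero_left add_0_right)
  finally have lim: "((\<lambda>t. ?H t + (\<Sum>j. ?B j t)) \<longlongrightarrow> - (\<Sum>i\<in>{1..half}. of_int (chi p i) * ln (sin (pi * ?x i))) / 2) (at_right 0)" .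
  have "eventually (\<lambda>t. ?H t + (\<Sum>j. ?B j t) = odd_character_sum p (exp (- t))) (at_right 0)"
    using eventually_at_right_less[of 0]
  proof eventually_elim
    case (elim t)
    let ?g = "\<lambda>n. ?L (real n * t)"
    have pw: "exp (- t) ^ n = exp (- (real n * t))" for n by (simp flip: exp_of_nat_mult)
    have "(\<lambda>n. of_int (chi p n) * artanh (exp (- t) ^ n)) sums odd_character_sum p (exp (- t))"
      by (rule odd_character_sum_artanh_sums) (use elim in auto)
    then have "(\<lambda>N. \<Sum>n<N. of_int (chi p n) * ?g n) \<longlonglongrightarrow> odd_character_sum p (exp (- t))"
      unfolding pw sums_def .
    moreover have "filterlim (\<lambda>J. p * J + half + 1) sequentially sequentially"
      using p by (intro filterlim_subseq strict_monoI) auto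
    ultimately have l1: "(\<lambda>J. \<Sum>n<p * J + half + 1. of_int (chi p n) * ?g n) \<longlonglongrightarrow> odd_character_sum p (exp (- t))"
      by (rule filterlim_compose)
    have c: "(\<Sum>i\<in>{1..half}. of_int (chi p i) * f i) = (\<Sum>i\<in>{1..half}. of_int (chi p i) * (f i - c))" for f and c :: real
      unfolding right_diff_distrib sum_subtractf sum_distrib_right[symmetric] sum_chi_half by simp
    have "(\<Sum>n<p * J + half + 1. of_int (chi p n) * ?g n) = ?H t + (\<Sum>j<J. ?B j t)" for J
      unfolding sum_even_character
      using c[of "\<lambda>i. ?L (real i * t)" "?L (1 * t)"]
        c[of "\<lambda>i. ?L (real (p * Suc j + i) * t) + ?L (real (p * Suc j - i) * t)" "2 * ?L (real (p * Suc j) * t)" for j]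
      by (simp only:)
    with l1 have l2: "(\<lambda>J. ?H t + (\<Sum>j<J. ?B j t)) \<longlonglongrightarrow> odd_character_sum p (exp (- t))" by (simp only:)
    have "summable (\<lambda>j. ?B j t)"
      by (rule summable_comparison_test'[where N = 0, OF sM]) (use Bb[OF elim] in blast)
    then have "(\<lambda>J. \<Sum>j<J. ?B j t) \<longlonglongrightarrow> (\<Sum>j. ?B j t)" by (rule summable_LIMSEQ)
    then have "(\<lambda>J. ?H t + (\<Sum>j<J. ?B j t)) \<longlonglongrightarrow> ?H t + (\<Sum>j. ?B j t)" by (intro tendsto_add tendsto_const)
    then show ?case using l2 by (rule LIMSEQ_unique)
  qed
  with lim show ?thesis by (rule Lim_transform_eventually)
qed

end

end

section \<open>Nonvanishing of the log-sine sum\<close>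

text \<open>Gauss's lemma for 2: with p = 8 k + 5 the doubles exceeding (p - 1) / 2 come from x
  between 2 k + 2 and 4 k + 2, which is an odd number of values.\<close>

lemma chi_two_5_mod_8:
  assumes p: "prime p" "2 < p" and mod8: "p mod 8 = 5"
  shows "chi p 2 = - 1"
proof -
  have "\<not> int p dvd 2" using p(2) by (auto dest: zdvd_imp_le)
  then interpret GAUSS p 2
    using p by unfold_locales (simp_all add: cong_0_iff)
  obtain k where k: "p = 8 * k + 5" using mod8 div_mult_mod_eq[of p 8] by (metis mult.commute)
  have h: "(int p - 1) div 2 = 4 * int k + 2" unfolding k by simp
  have "E = (\<lambda>x. x * 2) ` {2 * int k + 2..4 * int k + 2}"
  proof (intro subset_antisym subsetI)
    fix y assume "y \<in> E"
    then obtain x where x: "0 < x" "x \<le> 4 * int k + 2" "y = x * 2 mod int p" "4 * int k + 2 < y"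
      unfolding E_def C_def B_def A_def h by auto
    then have "y = x * 2" by (simp add: k)
    with x show "y \<in> (\<lambda>x. x * 2) ` {2 * int k + 2..4 * int k + 2}" by auto
  next
    fix y assume "y \<in> (\<lambda>x. x * 2) ` {2 * int k + 2..4 * int k + 2}"
    then obtain x where x: "2 * int k + 2 \<le> x" "x \<le> 4 * int k + 2" "y = x * 2" by auto
    then have y: "y = x * 2 mod int p" by (simp add: k)
    have "x * 2 mod int p \<in> (\<lambda>x. x mod int p) ` (\<lambda>x. x * 2) ` {0<..4 * int k + 2}"
      using x by (intro imageI) simp
    then show "y \<in> E" unfolding E_def C_def B_def A_def h y[symmetric] using x by simp
  qed
  then have "card E = card {2 * int k + 2..4 * int k + 2}"
    by (simp add: card_image inj_on_def)
  also have "\<dots> = 2 * k + 1" by simp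
  finally have "Legendre 2 (int p) = - 1" using gauss_lemma by simp
  then show ?thesis by (simp add: chi_def)
qed

section \<open>Chord lengths and quadratic residues\<close>

context
  fixes p :: nat
  assumes p: "prime p" "2 < p" and mod4: "p mod 4 = 1" and two: "chi p 2 = - 1"
begin

abbreviation (input) "\<zeta> \<equiv> cis (2 * pi / p)"

text \<open>The chord has length 2 |sin(pi n / p)|. At multiples of \<open>p\<close> the value is a
  default of \<open>ln\<close>; there it is only ever multiplied by
  \<open>chi p n = 0\<close>.\<close>

definition log_chord :: "nat \<Rightarrow> real" where
  "log_chord n = ln (norm (1 - \<zeta> ^ n))"

lemma zeta_power_p: "\<zeta> ^ p = 1"
  using p by (simp add: Complex.DeMoivre)

lemma norm_one_minus_zeta_power: "norm (1 - \<zeta> ^ n) = 2 * \<bar>sin (pi * (n / p))\<bar>"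
proof -
  have "\<zeta> ^ n = exp (\<i> * of_real (2 * (pi * (n / p))))"
  proof -
    have "real n * (2 * pi / p) = 2 * (pi * (n / p))" by simp
    then show ?thesis unfolding Complex.DeMoivre by (simp only: cis_conv_exp)
  qed
  then show ?thesis using dist_exp_i_1[of "2 * (pi * (n / p))"]
    by (subst norm_minus_commute) (simp only: nonzero_mult_div_cancel_left zero_neq_numeral[symmetric] not_False_eq_True)
qed

lemma zeta_ne_1: "\<zeta> \<noteq> 1"
proof -
  have "0 < pi / p" "pi / p < pi" using p by (simp_all add: divide_less_eq)
  then have "0 < sin (pi * (1 / p))" by (intro sin_gt_zero) auto
  then show ?thesis using norm_one_minus_zeta_power[of 1] by auto
qed

lemma zeta_power_eq_1_iff: "\<zeta> ^ n = 1 \<longleftrightarrow> p dvd n"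
  by (rule root_power_eq_1_iff[OF p zeta_power_p zeta_ne_1])

lemma log_chord_mod: "log_chord (n mod p) = log_chord n"
  unfolding log_chord_def root_power_mod[OF p zeta_power_p] ..

lemma zeta_power_reflect: "z ^ p = 1 \<Longrightarrow> norm z = 1 \<Longrightarrow> n \<le> p \<Longrightarrow> z ^ (p - n) = cnj (z ^ n)" for z :: complex
proof -
  assume z: "z ^ p = 1" "norm z = 1" and n: "n \<le> p"
  have c: "z * cnj z = 1" using z(2) by (simp add: complex_norm_square[symmetric])
  have "z ^ (p - n) * z ^ n = 1" using z n by (simp flip: power_add)
  moreover have "cnj (z ^ n) * z ^ n = 1" using c by (simp add: power_mult_distrib[symmetric] mult.commute)
  moreover have "z ^ n \<noteq> 0" using z(2) by auto
  ultimately show "z ^ (p - n) = cnj (z ^ n)" by (metis mult_right_cancel)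
qed

definition residues_set :: "nat set" where
  "residues_set = {n. n < p \<and> chi p n = 1}"

lemma finite_residues_set: "finite residues_set"
  by (simp add: residues_set_def)

lemma sum_residues_set: "sum g residues_set = (\<Sum>n<p. if chi p n = 1 then g n else 0)"
  for g :: "nat \<Rightarrow> 'a :: comm_monoid_add"
proof -
  have "residues_set = {n \<in> {..<p}. chi p n = 1}" by (auto simp: residues_set_def)
  then show ?thesis by (simp only: sum.inter_filter[OF finite_lessThan])
qed

lemma not_dvd_2: "\<not> p dvd 2"
  using p(2) by (auto dest: dvd_imp_le)

text \<open>Since \<open>chi p 2 = - 1\<close>, doubling modulo \<open>p\<close> maps the residues
  bijectively onto the nonresidues.\<close>

lemma sum_nonresidues:
  "(\<Sum>n<p. if chi p n = - 1 then g (n mod p) else 0) = (\<Sum>n\<in>residues_set. g (2 * n mod p))"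
  for g :: "nat \<Rightarrow> 'a :: comm_monoid_add"
proof -
  have "(\<Sum>n<p. if chi p n = - 1 then g (n mod p) else 0) =
    (\<Sum>n<p. if chi p (2 * n mod p) = - 1 then g (2 * n mod p mod p) else 0)"
    by (rule sum_mult_mod[OF p not_dvd_2, symmetric])
  also have "\<dots> = (\<Sum>n\<in>residues_set. g (2 * n mod p))"
    unfolding sum_residues_set
    by (intro sum.cong refl) (simp add: chi_mod[OF p] chi_mult[OF p] two)
  finally show ?thesis .
qed

lemma card_residues_set: "card residues_set = (p - 1) div 2"
proof -
  have N: "(\<Sum>n<p. if chi p n = - 1 then 1 else 0 :: nat) = card residues_set"
    using sum_nonresidues[of "\<lambda>_. 1 :: nat"] by simp
  have Q: "(\<Sum>n<p. if chi p n = 1 then 1 else 0 :: nat) = card residues_set"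
    using sum_residues_set[of "\<lambda>_. 1 :: nat"] by simp
  have "(\<Sum>n<p. (if chi p n = 1 then 1 else 0 :: nat) + (if chi p n = - 1 then 1 else 0)) = (\<Sum>n<p. if n = 0 then 0 else 1)"
  proof (rule sum.cong[OF refl])
    fix n assume n: "n \<in> {..<p}"
    show "(if chi p n = 1 then 1 else 0 :: nat) + (if chi p n = - 1 then 1 else 0) = (if n = 0 then 0 else 1)"
    proof (cases "n = 0")
      case False
      then have "chi p n \<noteq> 0" using n chi_eq_0_iff[OF p, of n] by (auto dest: dvd_imp_le)
      then have "chi p n = 1 \<or> chi p n = - 1" using abs_chi_le_1[of p n] by linarith
      then show ?thesis using False by auto
    qed (simp add: chi_0)
  qed
  also have "\<dots> = (\<Sum>n\<in>{1..<p}. 1)" by (rule sum.mono_neutral_cong_right) auto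
  finally have "card residues_set + card residues_set = p - 1" by (simp add: sum.distrib N Q)
  then show ?thesis by simp
qed

section \<open>Consequences of a vanishing log-sine sum\<close>

context
  assumes log0: "(\<Sum>i\<in>{1..half p}. of_int (chi p i) * ln (sin (pi * (i / p)))) = 0"
begin

lemma sum0: "(\<Sum>n<p. chi p n) = 0"
  by (rule sum_chi_eq_0[OF p two])

lemmas p_half = p_eq_half[OF p mod4 sum0]

lemma sum_chi_log_chord: "(\<Sum>n<p. of_int (chi p n) * log_chord n) = 0"
proof -
  let ?g = "\<lambda>n. of_int (chi p n) * log_chord n"
  have "?g (p - n) = ?g n" if "0 < n" "n < p" for n
    using that zeta_power_reflect[OF zeta_power_p, of n] chi_reflect_even[OF p mod4 sum0, of n]
    by (simp add: log_chord_def complex_mod_cnj[of "1 - \<zeta> ^ n", symmetric] del: complex_mod_cnj)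
  then have "(\<Sum>n<p. ?g n) = ?g 0 + 2 * (\<Sum>n\<in>{1..half p}. ?g n)"
    by (intro sum_lessThan_symmetric p_half) auto
  also have "(\<Sum>n\<in>{1..half p}. ?g n) = (\<Sum>n\<in>{1..half p}. of_int (chi p n) * ln 2 + of_int (chi p n) * ln (sin (pi * (n / p))))"
  proof (rule sum.cong[OF refl])
    fix n assume "n \<in> {1..half p}"
    then have n: "0 < n" "n < p" using p_half by auto
    then have "real n / real p < 1" "0 < real n / real p" by auto
    then have "pi * (n / p) < pi * 1" "0 < pi * (n / p)" by (intro mult_strict_left_mono mult_pos_pos; simp)+
    then have "0 < sin (pi * (n / p))" by (intro sin_gt_zero) (simp_all only: mult_1_right)
    then have "log_chord n = ln 2 + ln (sin (pi * (n / p)))"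
      unfolding log_chord_def norm_one_minus_zeta_power by (simp only: abs_of_pos ln_mult_pos zero_less_numeral)
    then show "?g n = of_int (chi p n) * ln 2 + of_int (chi p n) * ln (sin (pi * (n / p)))"
      by (simp only: distrib_left)
  qed
  also have "\<dots> = 0"
    unfolding sum.distrib log0 sum_distrib_right[symmetric] sum_chi_half[OF p mod4 sum0] by simp
  finally show ?thesis by (simp add: chi_0)
qed

text \<open>Multiplying the indices by \<open>a\<close> changes the character sum of
  \<open>log_chord\<close> only by the sign \<open>chi p a\<close>. Its nonresidue half is moved
  onto the residues by doubling, which leaves logarithms of |1 - \<zeta>^(2 a n)| / |1 - \<zeta>^(a
  n)|.\<close>

lemma sum_log_chord_double:
  assumes a: "\<not> p dvd a"
  shows "(\<Sum>n\<in>residues_set. log_chord (2 * (a * n)) - log_chord (a * n)) = 0"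
proof -
  have "0 = (\<Sum>n<p. of_int (chi p (a * n mod p)) * log_chord (a * n mod p))"
    using sum_mult_mod[OF p a, of "\<lambda>n. of_int (chi p n) * log_chord n"] sum_chi_log_chord by simp
  also have "\<dots> = of_int (chi p a) * (\<Sum>n<p. of_int (chi p n) * log_chord (a * n))"
    by (simp add: chi_mod[OF p] chi_mult[OF p] log_chord_mod sum_distrib_left mult.assoc)
  finally have "(\<Sum>n<p. of_int (chi p n) * log_chord (a * n)) = 0"
    using a chi_eq_0_iff[OF p, of a] by simp
  moreover have "(\<Sum>n<p. of_int (chi p n) * log_chord (a * n)) =
    (\<Sum>n<p. (if chi p n = 1 then log_chord (a * n) else 0) - (if chi p n = - 1 then log_chord (a * (n mod p)) else 0))"
  proof (rule sum.cong[OF refl])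
    fix n assume n: "n \<in> {..<p}"
    have "chi p n = 0 \<or> chi p n = 1 \<or> chi p n = - 1" using abs_chi_le_1[of p n] by linarith
    then show "of_int (chi p n) * log_chord (a * n) =
      (if chi p n = 1 then log_chord (a * n) else 0) - (if chi p n = - 1 then log_chord (a * (n mod p)) else 0)"
      using n by auto
  qed
  moreover have "log_chord (a * (2 * n mod p)) = log_chord (2 * (a * n))" for n
  proof -
    have "a * (2 * n mod p) mod p = 2 * (a * n) mod p" by (simp add: mod_mult_right_eq ac_simps)
    then show ?thesis using log_chord_mod[of "a * (2 * n mod p)"] log_chord_mod[of "2 * (a * n)"] by simp
  qed
  ultimately show ?thesis
    using sum_nonresidues[of "\<lambda>n. log_chord (a * n)"]
    by (simp add: sum_subtractf sum_residues_set[symmetric])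
qed

text \<open>Each factor is (1 - \<zeta>^(2 a n)) / (1 - \<zeta>^(a n)), so the product has modulus 1
  by \<open>sum_log_chord_double\<close>. As \<open>chi p\<close> is even, the residues pair up as n
  and p - n with conjugate factors, so the product is also a nonnegative real number.\<close>

lemma residue_product_eq_1:
  assumes a: "\<not> p dvd a"
  shows "(\<Prod>n\<in>residues_set. 1 + \<zeta> ^ (a * n)) = 1"
proof -
  let ?z = "\<zeta> ^ a"
  let ?U = "\<Prod>n\<in>residues_set. 1 + ?z ^ n"
  have zp: "?z ^ p = 1" using zeta_power_p by (metis power_mult mult.commute power_one)
  have nz: "norm ?z = 1" by (simp add: norm_power)
  have nd: "\<not> p dvd a * n" "\<not> p dvd 2 * (a * n)" if "n \<in> residues_set" for n
  proof -
    have "\<not> p dvd n" using that chi_eq_0_iff[OF p, of n] by (auto simp: residues_set_def)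
    then show "\<not> p dvd a * n" using a p(1) by (simp add: prime_dvd_mult_iff)
    then show "\<not> p dvd 2 * (a * n)" using not_dvd_2 p(1) prime_dvd_mult_iff by blast
  qed
  have ln1: "ln (norm (1 + ?z ^ n)) = log_chord (2 * (a * n)) - log_chord (a * n)" and ne: "1 + ?z ^ n \<noteq> 0"
    if n: "n \<in> residues_set" for n
  proof -
    have "1 - ?z ^ n \<noteq> 0" using nd(1)[OF n] zeta_power_eq_1_iff[of "a * n"] by (simp add: power_mult)
    moreover have "1 - (?z ^ n)\<^sup>2 \<noteq> 0"
      using nd(2)[OF n] zeta_power_eq_1_iff[of "2 * (a * n)"] by (simp add: power_mult[symmetric] mult_ac)
    moreover have f: "1 - (?z ^ n)\<^sup>2 = (1 + ?z ^ n) * (1 - ?z ^ n)" by (simp add: algebra_simps power2_eq_square)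
    ultimately show "1 + ?z ^ n \<noteq> 0" by auto
    with \<open>1 - ?z ^ n \<noteq> 0\<close> have "ln (norm (1 - (?z ^ n)\<^sup>2)) = ln (norm (1 + ?z ^ n)) + ln (norm (1 - ?z ^ n))"
      unfolding f norm_mult by (intro ln_mult_pos) auto
    moreover have "(?z ^ n)\<^sup>2 = \<zeta> ^ (2 * (a * n))" by (simp add: power_mult[symmetric] mult_ac)
    ultimately show "ln (norm (1 + ?z ^ n)) = log_chord (2 * (a * n)) - log_chord (a * n)"
      by (simp add: log_chord_def power_mult)
  qed
  have "ln (norm ?U) = (\<Sum>n\<in>residues_set. ln (norm (1 + ?z ^ n)))"
    unfolding prod_norm[symmetric] by (rule ln_prod) (use finite_residues_set ne in auto)
  also have "\<dots> = (\<Sum>n\<in>residues_set. log_chord (2 * (a * n)) - log_chord (a * n))"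
    by (rule sum.cong[OF refl]) (rule ln1)
  also have "\<dots> = 0" by (rule sum_log_chord_double[OF a])
  finally have "ln (norm ?U) = 0" .
  moreover have "norm ?U > 0" using ne finite_residues_set by simp
  ultimately have U1: "norm ?U = 1" by simp
  define H where "H = residues_set \<inter> {1..half p}"
  have H: "n \<in> H \<Longrightarrow> 0 < n \<and> n < p \<and> n \<le> half p \<and> chi p n = 1" for n by (auto simp: H_def residues_set_def)
  have split: "residues_set = H \<union> (\<lambda>n. p - n) ` H"
  proof (intro subset_antisym subsetI)
    fix n assume n: "n \<in> residues_set"
    then have np: "0 < n" "n < p" "chi p n = 1" by (auto simp: residues_set_def chi_0 intro: Nat.gr0I)
    show "n \<in> H \<union> (\<lambda>n. p - n) ` H"
    proof (cases "n \<le> half p")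
      case False
      then have "p - n \<in> H" using np chi_reflect_even[OF p mod4 sum0, of n] p_half
        by (auto simp: H_def residues_set_def)
      moreover have "n = p - (p - n)" using np by simp
      ultimately show ?thesis by blast
    qed (use n np in \<open>auto simp: H_def\<close>)
  next
    fix n assume "n \<in> H \<union> (\<lambda>n. p - n) ` H"
    then show "n \<in> residues_set"
    proof
      assume "n \<in> (\<lambda>n. p - n) ` H"
      then obtain i where i: "n = p - i" "i \<in> H" by blast
      then show ?thesis using H[of i] chi_reflect_even[OF p mod4 sum0, of i] by (auto simp: residues_set_def)
    qed (simp add: H_def)
  qed
  have fin: "finite H" using finite_residues_set by (simp add: H_def)
  have dis: "H \<inter> (\<lambda>n. p - n) ` H = {}"
  proof (rule equals0I)
    fix n assume n: "n \<in> H \<inter> (\<lambda>n. p - n) ` H"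
    then obtain i where i: "n = p - i" "i \<in> H" by auto
    have "n \<le> half p" "i \<le> half p" using H[of n] H[of i] n i by auto
    with i(1) p_half show False by linarith
  qed
  have inj: "inj_on (\<lambda>n. p - n) H"
  proof (rule inj_onI)
    fix x y assume "x \<in> H" "y \<in> H" "p - x = p - y"
    then show "x = y" using H[of x] H[of y] by linarith
  qed
  have "?U = (\<Prod>n\<in>H. 1 + ?z ^ n) * (\<Prod>n\<in>(\<lambda>n. p - n) ` H. 1 + ?z ^ n)"
    unfolding split by (rule prod.union_disjoint[OF fin finite_imageI[OF fin] dis])
  also have "(\<Prod>n\<in>(\<lambda>n. p - n) ` H. 1 + ?z ^ n) = (\<Prod>n\<in>H. 1 + ?z ^ (p - n))"
    by (simp only: prod.reindex[OF inj] comp_def)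
  also have "\<dots> = (\<Prod>n\<in>H. cnj (1 + ?z ^ n))"
  proof (rule prod.cong[OF refl])
    fix n assume "n \<in> H"
    then have "?z ^ (p - n) = cnj (?z ^ n)" using H[of n] by (intro zeta_power_reflect[OF zp nz]) simp
    then show "1 + ?z ^ (p - n) = cnj (1 + ?z ^ n)" by (simp only: complex_cnj_add complex_cnj_one)
  qed
  also have "(\<Prod>n\<in>H. 1 + ?z ^ n) * \<dots> = of_real ((norm (\<Prod>n\<in>H. 1 + ?z ^ n))\<^sup>2)"
    by (simp only: cnj_prod[symmetric] complex_norm_square)
  finally have "?U = of_real ((norm (\<Prod>n\<in>H. 1 + ?z ^ n))\<^sup>2)" .
  moreover from this have "norm ?U = (norm (\<Prod>n\<in>H. 1 + ?z ^ n))\<^sup>2" by (simp only: norm_of_real abs_power2)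
  ultimately have "?U = 1" using U1 by (simp only: of_real_1)
  then show ?thesis by (simp add: power_mult)
qed

text \<open>Summing the product over all \<open>a < p\<close> counts, up to a factor \<open>p\<close>, the sets of residues with sum \<open>0\<close> modulo \<open>p\<close>;
  hence \<open>p\<close> divides \<open>2 ^ ((p - 1) div 2) - 1\<close>, against \<open>chi p 2 = - 1\<close>.\<close>

lemma residue_product_contradiction: False
proof -
  have "(\<Sum>a<p. \<Prod>n\<in>residues_set. 1 + \<zeta> ^ (a * n)) = (\<Sum>a<p. if a = 0 then 2 ^ card residues_set else 1)"
  proof (rule sum.cong[OF refl])
    fix a assume a: "a \<in> {..<p}"
    show "(\<Prod>n\<in>residues_set. 1 + \<zeta> ^ (a * n)) = (if a = 0 then 2 ^ card residues_set else 1)"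
    proof (cases "a = 0")
      case False
      then have "\<not> p dvd a" using a by (auto dest: dvd_imp_le)
      from residue_product_eq_1[OF this] False show ?thesis by simp
    qed simp
  qed
  also have "\<dots> = (\<Sum>a<p. (if a = 0 then 2 ^ card residues_set - 1 else 0) + 1)"
    by (intro sum.cong refl) auto
  also have "\<dots> = 2 ^ card residues_set - 1 + of_nat p"
    using p by (simp add: sum.distrib)
  finally have 1: "(\<Sum>a<p. \<Prod>n\<in>residues_set. 1 + \<zeta> ^ (a * n)) = 2 ^ card residues_set - 1 + of_nat p" .
  have "(\<Prod>n\<in>residues_set. 1 + \<zeta> ^ (a * n)) = (\<Sum>X\<in>Pow residues_set. \<zeta> ^ (a * (\<Sum>n\<in>X. n)))" for a
  proof -
    have "(\<Prod>n\<in>residues_set. \<zeta> ^ (a * n) + 1) = (\<Sum>X\<in>Pow residues_set. (\<Prod>n\<in>X. \<zeta> ^ (a * n)) * (\<Prod>n\<in>residues_set - X. 1))"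
      by (rule prod_add[OF finite_residues_set])
    then show ?thesis by (simp add: power_sum sum_distrib_left add.commute)
  qed
  then have "(\<Sum>a<p. \<Prod>n\<in>residues_set. 1 + \<zeta> ^ (a * n)) = (\<Sum>X\<in>Pow residues_set. \<Sum>a<p. \<zeta> ^ (a * (\<Sum>n\<in>X. n)))"
    by (simp only:) (rule sum.swap)
  also have "\<dots> = (\<Sum>X\<in>Pow residues_set. of_nat (if p dvd (\<Sum>n\<in>X. n) then p else 0))"
  proof (rule sum.cong[OF refl])
    fix X
    show "(\<Sum>a<p. \<zeta> ^ (a * (\<Sum>n\<in>X. n))) = of_nat (if p dvd (\<Sum>n\<in>X. n) then p else 0)"
    proof (cases "p dvd (\<Sum>n\<in>X. n)")
      case True
      then have "\<zeta> ^ (a * (\<Sum>n\<in>X. n)) = 1" for a using zeta_power_eq_1_iff by simp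
      then show ?thesis using True by simp
    next
      case False
      have "p > 0" using p by simp
      from sum_powers_root_of_unity[OF this False] False show ?thesis by (simp only: if_False of_nat_0)
    qed
  qed
  finally have "2 ^ card residues_set - 1 + of_nat p = (of_nat (\<Sum>X\<in>Pow residues_set. if p dvd (\<Sum>n\<in>X. n) then p else 0) :: complex)"
    using 1 by simp
  then have "complex_of_int (2 ^ card residues_set - 1 + int p) = of_int (int (\<Sum>X\<in>Pow residues_set. if p dvd (\<Sum>n\<in>X. n) then p else 0))"
    by (simp del: of_nat_sum)
  then have e: "2 ^ card residues_set - 1 + int p = int (\<Sum>X\<in>Pow residues_set. if p dvd (\<Sum>n\<in>X. n) then p else 0)"
    by (simp only: of_int_eq_iff)
  have "int p dvd 2 ^ card residues_set - 1 + int p" unfolding e int_dvd_int_iff by (rule dvd_sum) auto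
  then have "int p dvd 2 ^ ((p - 1) div 2) - 1" unfolding card_residues_set by simp
  then have "[int 2 ^ ((p - 1) div 2) = 1] (mod int p)" by (simp add: cong_iff_dvd_diff)
  then have "[chi p 2 = 1] (mod int p)" using chi_cong_power[OF p, of 2] cong_trans by blast
  then have "chi p 2 = 1" by (rule cong_small_imp_eq[OF _ p(2) abs_chi_le_1]) simp
  then show False using two by simp
qed

end

lemma log_sine_sum_nonzero: "(\<Sum>i\<in>{1..half p}. of_int (chi p i) * ln (sin (pi * (i / p)))) \<noteq> 0"
  using residue_product_contradiction by blast

end

section \<open>Arithmetic progressions\<close>

lemma abs_le_of_exp_near_1:
  fixes d :: real
  assumes "\<bar>exp d - 1\<bar> \<le> \<delta>" "\<delta> \<le> 1 / 2"
  shows "\<bar>d\<bar> \<le> 2 * \<delta>"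
proof -
  define x where "x = exp d - 1"
  have x: "\<bar>x\<bar> \<le> \<delta>" "\<bar>x\<bar> \<le> 1 / 2" using assms by (auto simp: x_def)
  have "d = ln (1 + x)" by (simp add: x_def)
  moreover have "\<bar>ln (1 + x) - x\<bar> \<le> 2 * x\<^sup>2"
    by (rule abs_ln_one_plus_x_minus_x_bound[OF x(2)])
  moreover have "x\<^sup>2 \<le> \<bar>x\<bar> * (1 / 2)"
    using mult_left_mono[OF x(2), of "\<bar>x\<bar>"] by (simp add: power2_eq_square)
  ultimately show ?thesis using x(1) by linarith
qed

context
  fixes p :: nat
  assumes p: "prime p" "2 < p"
begin

text \<open>The points 1 and -1 enter with relative sign (-1)^(m - r) and combine to exp M (exp D
  \<plusminus> 1) with D real. This has to be exponentially small against exp M, which forces the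
  minus sign and an exponentially small D; \<open>t\<close> is a convenient majorant of that
  error.\<close>

lemma vanishing_imp_almost_invariant:
  assumes vanish: "vanishes_on_some_AP (\<lambda>n. signed_partition_number n (chi p))"
    and sum0: "(\<Sum>n<p. chi p n) = 0"
    and less: "\<And>m \<omega>. m > 0 \<Longrightarrow> \<omega> ^ m = 1 \<Longrightarrow> \<omega>\<^sup>2 \<noteq> 1 \<Longrightarrow>
      growth (chi p) (p * m) \<omega> < growth (chi p) (p * m) 1"
  shows "eventually (\<lambda>t. \<bar>odd_character_sum p (exp (- t)) - of_int (chi p 2) * odd_character_sum p (exp (- (2 * t)))\<bar> \<le> t) (at_right 0)"
proof -
  from vanish obtain m r where m: "8 dvd m" "r < m" and z: "\<And>n. n mod m = r \<Longrightarrow> signed_partition_number n (chi p) = 0"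
    by (rule vanishes_on_some_AP_refine) blast
  then obtain k where "m = 8 * k" by (elim dvdE)
  then obtain d where d: "m = 2 * d" by (metis mult.assoc numeral_Bit0_eq_double)
  have d0: "d > 0" using m d by auto
  let ?\<zeta> = "cis (2 * pi / m)"
  have \<zeta>d: "?\<zeta> ^ d = - 1" using d0 by (simp add: Complex.DeMoivre d)
  have \<zeta>m: "?\<zeta> ^ m = 1" using m by (simp add: Complex.DeMoivre)
  let ?C = "growth (chi p) (p * m) 1"
  obtain C' where C': "C' < ?C" and ev: "eventually (\<lambda>t. norm (\<Sum>l\<in>{0, d}. ?\<zeta> ^ (l * (m - r)) *
        exp (log_gf (chi p) (?\<zeta> ^ l * of_real (exp (- t))))) \<le> real m * exp (C' / t)) (at_right 0)"
  proof (rule dominant_terms_cancel[where f = "chi p" and P = p and m = m and r = r and D = "{0, d}" and C = ?C])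
    show "{0, d} \<subseteq> {..<m}" using d d0 by auto
    show "growth (chi p) (p * m) (?\<zeta> ^ l) < ?C" if l: "l < m" "l \<notin> {0, d}" for l
    proof (rule less)
      show "m > 0" using m by simp
      have "(?\<zeta> ^ l) ^ m = (?\<zeta> ^ m) ^ l" by (simp only: power_mult[symmetric] mult.commute)
      then show "(?\<zeta> ^ l) ^ m = 1" by (simp only: \<zeta>m power_one)
      have "?\<zeta> ^ l \<noteq> 1" using cis_root_power_inj[of l m 0] l d0 d by auto
      moreover have "?\<zeta> ^ l \<noteq> - 1" using cis_root_power_inj[of l m d] l d d0 \<zeta>d by auto
      ultimately show "(?\<zeta> ^ l)\<^sup>2 \<noteq> 1" by (simp only: power2_eq_1_iff) simp
    qed
    show "0 < p" using p by simp
  qed (use abs_chi_le_1 chi_0 chi_add[OF p] m z in auto)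
  let ?T = "odd_character_sum p"
  let ?b = "\<lambda>t. Re (log_gf (chi p) (- of_real (exp (- t))))"
  let ?D = "\<lambda>t. 2 * (?T (exp (- t)) - of_int (chi p 2) * ?T ((exp (- t))\<^sup>2))"
  define \<epsilon> :: real where "\<epsilon> = (- 1) ^ (m - r)"
  have bound: "eventually (\<lambda>t. exp (?b t) * \<bar>exp (?D t) + \<epsilon>\<bar> \<le> real m * exp (C' / t)) (at_right 0)"
    using ev eventually_at_right_less[of 0]
  proof eventually_elim
    case (elim t)
    let ?q = "exp (- t)"
    let ?M = "log_gf (chi p) (- of_real ?q)"
    have "log_gf (chi p) (of_real ?q) = ?M + of_real (?D t)"
      using log_gf_chi_difference[OF p, of ?q] elim(2) by (simp add: algebra_simps)
    then have e: "exp (log_gf (chi p) (of_real ?q)) = exp ?M * of_real (exp (?D t))"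
      by (simp only: exp_add exp_of_real)
    have "(\<Sum>l\<in>{0, d}. ?\<zeta> ^ (l * (m - r)) * exp (log_gf (chi p) (?\<zeta> ^ l * of_real ?q))) =
        ?\<zeta> ^ (0 * (m - r)) * exp (log_gf (chi p) (?\<zeta> ^ 0 * of_real ?q)) +
        ?\<zeta> ^ (d * (m - r)) * exp (log_gf (chi p) (?\<zeta> ^ d * of_real ?q))"
      using d0 by (subst sum.insert) auto
    also have "\<dots> = exp (log_gf (chi p) (of_real ?q)) + (- 1) ^ (m - r) * exp ?M"
      unfolding power_mult \<zeta>d by simp
    also have "\<dots> = exp ?M * of_real (exp (?D t) + \<epsilon>)"
      unfolding e \<epsilon>_def by (simp add: algebra_simps)
    finally have "norm (exp ?M * of_real (exp (?D t) + \<epsilon>)) \<le> real m * exp (C' / t)" using elim(1) by (simp only:)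
    then show ?case by (simp only: norm_mult norm_of_real norm_exp_eq_Re)
  qed
  have bC: "((\<lambda>t. t * ?b t) \<longlongrightarrow> ?C) (at_right 0)"
  proof -
    have "((\<lambda>t. t * Re (log_gf (chi p) (- 1 * of_real (exp (- t))))) \<longlongrightarrow> growth (chi p) (p * m) (- 1)) (at_right 0)"
    proof (rule log_gf_asymptotic[where f = "chi p", OF abs_chi_le_1 chi_0])
      show "0 < p * m" using p m by simp
      show "chi p (n + p * m) = chi p n" for n
        by (rule chi_cong[OF p]) (simp only: unique_euclidean_semiring_class.cong_def mod_mult_self2)
      show "(- 1 :: complex) ^ (p * m) = 1" using d by simp
    qed
    moreover have "growth (chi p) (p * m) (- 1) = ?C"
      by (rule growth_chi_minus_one[OF p sum0]) (use m d in auto)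
    ultimately show ?thesis by simp
  qed
  have "\<epsilon> = 1 \<or> \<epsilon> = - 1" unfolding \<epsilon>_def by (cases "even (m - r)") auto
  moreover have "\<epsilon> \<noteq> 1"
  proof
    assume "\<epsilon> = 1"
    from bound have "eventually (\<lambda>t. 1 * exp (?b t) \<le> real m * exp (C' / t)) (at_right 0)"
    proof eventually_elim
      case (elim t)
      have "1 \<le> \<bar>exp x + 1\<bar>" for x :: real using exp_gt_zero[of x] by linarith
      then have "exp (?b t) * 1 \<le> exp (?b t) * \<bar>exp (?D t) + \<epsilon>\<bar>"
        unfolding \<open>\<epsilon> = 1\<close> by (intro mult_left_mono) simp_all
      also have "\<dots> \<le> real m * exp (C' / t)" by (rule elim)
      finally show ?case by (simp only: mult_1_left mult_1_right)
    qed
    then show False by (rule exponential_growth_contradiction[OF zero_less_one C' bC])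
  qed
  ultimately have \<epsilon>: "\<epsilon> = - 1" by blast
  \<comment> \<open>An intermediate rate: |exp M| eventually exceeds exp(K / t), so the relative
    error is at most m exp(- (K - C') / t), which is below \<open>t\<close> for small
    \<open>t\<close>.\<close>
  define K where "K = (?C + C') / 2"
  have K: "C' < K" "K < ?C" using C' by (simp_all add: K_def)
  have "((\<lambda>t. real m * exp (- ((K - C') / t)) / t) \<longlongrightarrow> 0) (at_right 0)"
    using K(1) by real_asymp
  then have "eventually (\<lambda>t. real m * exp (- ((K - C') / t)) / t < 1) (at_right 0)"
    by (rule order_tendstoD) simp
  moreover have "eventually (\<lambda>t::real. t < 1 / 2) (at_right 0)"
    by (rule eventually_at_right_real[THEN eventually_mono, of 0 "1 / 2"]) auto
  ultimately show ?thesis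
    using bound order_tendstoD(1)[OF bC K(2)] eventually_at_right_less[of 0]
  proof eventually_elim
    case (elim t)
    let ?\<delta> = "real m * exp (- ((K - C') / t))"
    have d: "?\<delta> \<le> t" using elim(1,5) by (simp add: divide_less_eq)
    have "K / t \<le> ?b t" using elim(4,5) by (simp add: pos_divide_le_eq mult.commute)
    then have "exp (K / t) * \<bar>exp (?D t) + \<epsilon>\<bar> \<le> exp (?b t) * \<bar>exp (?D t) + \<epsilon>\<bar>"
      by (intro mult_right_mono) auto
    also have "\<dots> \<le> real m * exp (C' / t)" by (rule elim(3))
    also have "C' / t = K / t + - ((K - C') / t)" by (simp add: diff_divide_distrib)
    also have "real m * exp (K / t + - ((K - C') / t)) = exp (K / t) * ?\<delta>" by (simp only: exp_add mult.left_commute)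
    finally have "\<bar>exp (?D t) - 1\<bar> \<le> ?\<delta>" unfolding \<epsilon> by simp
    then have "\<bar>?D t\<bar> \<le> 2 * ?\<delta>" by (rule abs_le_of_exp_near_1) (use d elim(2) in linarith)
    then have "\<bar>?T (exp (- t)) - of_int (chi p 2) * ?T ((exp (- t))\<^sup>2)\<bar> \<le> ?\<delta>"
      by (simp only: abs_mult abs_numeral mult_le_cancel_left_pos zero_less_numeral)
    then have "\<bar>?T (exp (- t)) - of_int (chi p 2) * ?T ((exp (- t))\<^sup>2)\<bar> \<le> t" using d by (rule order.trans)
    moreover have "(exp (- t))\<^sup>2 = exp (- (2 * t))" by (simp flip: exp_double)
    ultimately show ?case by (simp only:)
  qed
qed

text \<open>Here the odd exponents contribute purely imaginary means, so the dominance of 1 and -1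
  holds for every such \<open>p\<close>, including 3.\<close>

theorem chi_not_vanishing_3_mod_4:
  assumes mod4: "p mod 4 = 3"
  shows "\<not> vanishes_on_some_AP (\<lambda>n. signed_partition_number n (chi p))"
proof
  assume vanish: "vanishes_on_some_AP (\<lambda>n. signed_partition_number n (chi p))"
  let ?\<tau> = "\<lambda>t. odd_character_sum p (exp (- t))"
  note m1 = chi_minus_one_3_mod_4[OF p mod4]
  note sum0 = sum_chi_eq_0[OF p m1]
  have "eventually (\<lambda>t. \<bar>?\<tau> t - of_int (chi p 2) * ?\<tau> (2 * t)\<bar> \<le> t) (at_right 0)"
    by (rule vanishing_imp_almost_invariant[OF vanish sum0]) (rule growth_chi_less_odd_character[OF p m1])
  then obtain t0 where t0: "t0 > 0" "\<And>t. 0 < t \<Longrightarrow> t < t0 \<Longrightarrow> \<bar>?\<tau> t - of_int (chi p 2) * ?\<tau> (2 * t)\<bar> \<le> t"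
    unfolding eventually_at_right_field by auto
  moreover have "\<bar>of_int (chi p 2) :: real\<bar> \<le> 1" using abs_chi_le_1[of p 2] by linarith
  ultimately have "\<not> filterlim (\<lambda>t. \<bar>?\<tau> t\<bar>) at_top (at_right 0)"
    by (rule dyadic_almost_invariant_bounded)
  moreover have "(\<Sum>n<p. chi p n * int n) \<noteq> 0" using chi_first_moment_odd[OF p mod4] by auto
  ultimately show False using odd_character_sum_at_top[OF p sum0] by blast
qed

text \<open>As \<open>chi p 2 = - 1\<close>, the limits of \<tau>(t) and \<tau>(2 t) add instead of
  cancelling, so almost invariance forces the limit to be 0. Excluding 5 leaves p >= 13, the range
  of \<open>growth_chi_less_large\<close>.\<close>

theorem chi_not_vanishing_5_mod_8:
  assumes mod8: "p mod 8 = 5" and "p \<noteq> 5"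
  shows "\<not> vanishes_on_some_AP (\<lambda>n. signed_partition_number n (chi p))"
proof
  assume vanish: "vanishes_on_some_AP (\<lambda>n. signed_partition_number n (chi p))"
  let ?\<tau> = "\<lambda>t. odd_character_sum p (exp (- t))"
  have p8: "p = 8 * (p div 8) + 5" using mod8 div_mult_mod_eq[of p 8] by simp
  have "p div 8 \<noteq> 0" using p8 assms(2) by auto
  then have p13: "13 \<le> p" using p8 by linarith
  have mod4: "p mod 4 = 1"
  proof -
    have "p mod 4 = p mod 8 mod 4" by (simp add: mod_mod_cancel)
    then show ?thesis unfolding mod8 by simp
  qed
  note two = chi_two_5_mod_8[OF p mod8]
  note sum0 = sum_chi_eq_0[OF p two]
  define S where "S = - (\<Sum>i\<in>{1..half p}. of_int (chi p i) * ln (sin (pi * (i / p)))) / 2"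
  have lim: "(?\<tau> \<longlongrightarrow> S) (at_right 0)"
    unfolding S_def by (rule odd_character_sum_tendsto[OF p mod4 sum0])
  have "filterlim (\<lambda>t::real. 2 * t) (at_right 0) (at_right 0)" by real_asymp
  from filterlim_compose[OF lim this] have "((\<lambda>t. ?\<tau> (2 * t)) \<longlongrightarrow> S) (at_right 0)" .
  with lim have "((\<lambda>t. \<bar>?\<tau> t + ?\<tau> (2 * t)\<bar>) \<longlongrightarrow> \<bar>S + S\<bar>) (at_right 0)"
    by (intro tendsto_rabs tendsto_add)
  moreover have "eventually (\<lambda>t. \<bar>?\<tau> t - of_int (chi p 2) * ?\<tau> (2 * t)\<bar> \<le> t) (at_right 0)"
    by (rule vanishing_imp_almost_invariant[OF vanish sum0]) (rule growth_chi_less_large[OF p sum0 p13])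
  then have "eventually (\<lambda>t. \<bar>?\<tau> t + ?\<tau> (2 * t)\<bar> \<le> t) (at_right 0)"
    by eventually_elim (simp add: two)
  moreover have "((\<lambda>t::real. t) \<longlongrightarrow> 0) (at_right 0)" by (rule tendsto_ident_at)
  ultimately have "\<bar>S + S\<bar> \<le> 0"
    by (intro tendsto_le[OF trivial_limit_at_right_real])
  then have "S = 0" by simp
  then show False using log_sine_sum_nonzero[OF p mod4 two] by (simp only: S_def)
qed

end

theorem theorem1p10:
  shows "(\<forall>p::nat. prime p \<and> odd p \<and> p \<noteq> 5 \<and> \<not> [p = 1] (mod 8) \<longrightarrow>
            \<not> vanishes_on_some_AP (\<lambda>n. signed_partition_number n (chi p))) \<and>
         \<not> vanishes_on_some_AP (\<lambda>n. signed_partition_number n chi2)"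
proof (intro conjI allI impI chi2_not_vanishing)
  fix p :: nat
  assume a: "prime p \<and> odd p \<and> p \<noteq> 5 \<and> \<not> [p = 1] (mod 8)"
  then have "p \<noteq> 2" by auto
  with a have p: "prime p" "2 < p" using prime_ge_2_nat[of p] by auto
  have "p mod 8 \<noteq> 1" using a by (auto simp: unique_euclidean_semiring_class.cong_def)
  moreover have "odd (p mod 8)" using a by (simp add: dvd_mod_iff)
  moreover have "p mod 8 < 8" by simp
  moreover have "r = 3 \<or> r = 5 \<or> r = 7" if "r < 8" "odd r" "r \<noteq> 1" for r :: nat
  proof -
    have "r = 0 \<or> r = 1 \<or> r = 2 \<or> r = 3 \<or> r = 4 \<or> r = 5 \<or> r = 6 \<or> r = 7"
      using that(1) by arith
    then show ?thesis using that by (elim disjE) simp_all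
  qed
  ultimately have r: "p mod 8 = 3 \<or> p mod 8 = 5 \<or> p mod 8 = 7" by blast
  have "p mod 4 = p mod 8 mod 4" by (simp add: mod_mod_cancel)
  then have "p mod 4 = 3 \<or> p mod 8 = 5" using r by (elim disjE) simp_all
  then show "\<not> vanishes_on_some_AP (\<lambda>n. signed_partition_number n (chi p))"
  proof
    assume "p mod 4 = 3"
    then show ?thesis by (rule chi_not_vanishing_3_mod_4[OF p])
  next
    assume "p mod 8 = 5"
    then show ?thesis using a by (intro chi_not_vanishing_5_mod_8[OF p]) simp_all
  qed
qed

end
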